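(* Let $L$ be a link in $S^3$ with at least two components. Suppose that there exists a trivial component $\ell_0$ of $L$ (that is, $\ell_0$ is an unknot) and that $lk(\ell_0,\ell)$ is even for every component $\ell\subset L-\ell_0$. Then, for every odd $n\ge 3$, any diagram of $L$ admits a two-tone $D_n$-coloring which assigns reflections $a_i$ to the arcs on $\ell_0$ and nontrivial rotations $b_j$ to all the other arcs.
   Context: Dihedral groups: $D_n=\langle a,b\mid a^2=b^n=(ab)^2=e\rangle$ is the dihedral group of degree $n$ (order $2n$). Put $a_i=ab^i$ ($0\le i\le n-1$, the reflections) and $b_j=b^j$ ($1\le j\le n-1$, the nontrivial rotations), so $D_n=\{e,a_0,\dots,a_{n-1},b_1,\dots,b_{n-1}\}$. Colorings: links are oriented (arbitrarily). A $D_n$-coloring on a diagram $D$ of an oriented link is a map $\Gamma:\{\text{arcs of }D\}\to D_n$ such that at each crossing, with over arc $x$, under arc $y$ before passing through the crossing and under arc $z$ after it, one has $\Gamma(x)\Gamma(z)=\Gamma(y)\Gamma(x)$ if the crossing is positive and $\Gamma(z)\Gamma(x)=\Gamma(x)\Gamma(y)$ if it is negative. The coloring $\Gamma$ is two-tone if $e\notin\mathrm{Im}(\Gamma)$ and $\mathrm{Im}(\Gamma)$ contains at least one $a_i$ and at least one $b_j$. The parity of a linking number does not depend on the chosen orientations. *)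

theory Defs
  imports "HOL-Analysis.Analysis" "HOL-Algebra.Generated_Groups"
begin

section \<open>Links in the 3-sphere\<close>

text \<open>The 3-sphere is the unit sphere of \<open>\<complex>\<^sup>2\<close> (the norm on a product type is the Euclidean one).\<close>

definition S3 :: "(complex \<times> complex) set"
  where "S3 = sphere 0 1"

definition is_link :: "(complex \<times> complex) set \<Rightarrow> bool"
  where "is_link L \<longleftrightarrow>
    L \<subseteq> S3 \<and> finite (components L) \<and>
    (\<forall>l\<in>components L. l homeomorphic sphere (0::complex) 1)"

definition ambient_isotopy :: "(real \<Rightarrow> complex \<times> complex \<Rightarrow> complex \<times> complex) \<Rightarrow> bool"
  where "ambient_isotopy H \<longleftrightarrow>
    continuous_on ({0..1} \<times> S3) (\<lambda>(t, x). H t x) \<and>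
    (\<forall>t\<in>{0..1}. \<exists>g. homeomorphism S3 S3 (H t) g) \<and>
    (\<forall>x\<in>S3. H 0 x = x)"

definition great_circle :: "(complex \<times> complex) set"
  where "great_circle = {p \<in> S3. snd p = 0}"

definition unknot :: "(complex \<times> complex) set \<Rightarrow> bool"
  where "unknot K \<longleftrightarrow> (\<exists>H. ambient_isotopy H \<and> H 1 ` K = great_circle)"


section \<open>Diagrams\<close>

text \<open>
  Euclidean 3-space is \<open>\<complex> \<times> \<real>\<close>. Its points are projected to the plane by \<^const>\<open>fst\<close>, and at a
  double point of the projection the strand with the larger \<^const>\<open>snd\<close> is the over strand.
  It is identified with \<^const>\<open>S3\<close> minus the point \<open>(0, \<i>)\<close> by stereographic projection, whose
  inverse is the following map.
\<close>

definition inv_stereo :: "complex \<times> real \<Rightarrow> complex \<times> complex"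
  where "inv_stereo p =
    ((2 / ((norm p)\<^sup>2 + 1)) *\<^sub>R fst p,
     Complex (2 * snd p / ((norm p)\<^sup>2 + 1)) (((norm p)\<^sup>2 - 1) / ((norm p)\<^sup>2 + 1)))"

lemma inv_stereo_in_S3: "inv_stereo p \<in> S3"
proof -
  define r where "r = (norm p)\<^sup>2"
  have r: "r = (norm (fst p))\<^sup>2 + (snd p)\<^sup>2"
    by (cases p) (simp add: r_def norm_Pair)
  have r1: "r + 1 \<noteq> 0" using r_def by (smt (verit) zero_le_power2)
  have "(norm (inv_stereo p))\<^sup>2
      = (2 / (r + 1))\<^sup>2 * (norm (fst p))\<^sup>2 + ((2 * snd p / (r + 1))\<^sup>2 + ((r - 1) / (r + 1))\<^sup>2)"
    by (simp add: inv_stereo_def norm_Pair power_mult_distrib power_divide cmod_def add_divide_distrib distrib_left flip: r_def)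
  also have "\<dots> = (4 * ((norm (fst p))\<^sup>2 + (snd p)\<^sup>2) + (r - 1)\<^sup>2) / (r + 1)\<^sup>2"
    by (simp add: power_divide power_mult_distrib add_divide_distrib)
  also have "\<dots> = (4 * r + (r - 1)\<^sup>2) / (r + 1)\<^sup>2"
    by (simp add: r)
  also have "\<dots> = 1"
  proof -
    have "4 * r + (r - 1)\<^sup>2 = (r + 1)\<^sup>2" by (simp add: power2_eq_square algebra_simps)
    then show ?thesis using r1 by simp
  qed
  finally show ?thesis
    by (simp add: S3_def power2_eq_1_iff) (smt (verit) norm_ge_zero)
qed

text \<open>
  A diagram is given by one curve per component, which is 1-periodic and thereby oriented.
  The clauses below say that the curves are continuously differentiable, that they are immersed in
  the plane, that together they embed a disjoint union of circles in space, that different strands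
  cross transversely in the plane, and that there are no triple points.
\<close>

definition plane_velocity :: "('i \<Rightarrow> real \<Rightarrow> complex \<times> real) \<Rightarrow> 'i \<Rightarrow> real \<Rightarrow> complex"
  where "plane_velocity D i t = fst (vector_derivative (D i) (at t))"

definition plane_det :: "complex \<Rightarrow> complex \<Rightarrow> real"
  where "plane_det u v = Re u * Im v - Im u * Re v"

definition link_diagram :: "'i set \<Rightarrow> ('i \<Rightarrow> real \<Rightarrow> complex \<times> real) \<Rightarrow> bool"
  where "link_diagram I D \<longleftrightarrow>
    finite I \<and>
    (\<forall>i\<in>I. (\<forall>t. D i (t + 1) = D i t) \<and> D i C1_differentiable_on UNIV \<and>
            (\<forall>t. plane_velocity D i t \<noteq> 0)) \<and>
    (\<forall>i\<in>I. \<forall>j\<in>I. \<forall>s t. D i s = D j t \<longrightarrow> i = j \<and> s - t \<in> \<int>) \<and>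
    (\<forall>i\<in>I. \<forall>j\<in>I. \<forall>s t. D i s \<noteq> D j t \<and> fst (D i s) = fst (D j t) \<longrightarrow>
       plane_det (plane_velocity D i s) (plane_velocity D j t) \<noteq> 0) \<and>
    (\<forall>p\<in>(\<Union>i\<in>I. range (D i)). \<forall>q\<in>(\<Union>i\<in>I. range (D i)). \<forall>r\<in>(\<Union>i\<in>I. range (D i)).
       fst p = fst q \<and> fst q = fst r \<longrightarrow> p = q \<or> q = r \<or> p = r)"

text \<open>
  The curves of a diagram of \<open>L\<close> are indexed by the components of \<open>L\<close>. The curve \<open>D l\<close>
  represents the component \<open>l\<close>.
\<close>

definition diagram_of_link ::
    "((complex \<times> complex) set \<Rightarrow> real \<Rightarrow> complex \<times> real) \<Rightarrow> (complex \<times> complex) set \<Rightarrow> bool"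
  where "diagram_of_link D L \<longleftrightarrow>
    link_diagram (components L) D \<and>
    (\<exists>H. ambient_isotopy H \<and> (\<forall>l\<in>components L. H 1 ` l = inv_stereo ` range (D l)))"

text \<open>At parameter \<open>s\<close> the curve \<open>i\<close> passes over the curve \<open>j\<close> at parameter \<open>t\<close>.\<close>

definition crossing ::
    "'i set \<Rightarrow> ('i \<Rightarrow> real \<Rightarrow> complex \<times> real) \<Rightarrow> 'i \<Rightarrow> real \<Rightarrow> 'i \<Rightarrow> real \<Rightarrow> bool"
  where "crossing I D i s j t \<longleftrightarrow>
    i \<in> I \<and> j \<in> I \<and> fst (D i s) = fst (D j t) \<and> snd (D j t) < snd (D i s)"

definition crossing_positive ::
    "('i \<Rightarrow> real \<Rightarrow> complex \<times> real) \<Rightarrow> 'i \<Rightarrow> real \<Rightarrow> 'i \<Rightarrow> real \<Rightarrow> bool"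
  where "crossing_positive D i s j t \<longleftrightarrow>
    plane_det (plane_velocity D i s) (plane_velocity D j t) > 0"

text \<open>
  The linking number of two different components is half of the sum of the signs of all crossings
  between them, whichever of the two components is over. This sum is always even, so \<open>div\<close> is exact.
\<close>

definition signed_crossings ::
    "'i set \<Rightarrow> ('i \<Rightarrow> real \<Rightarrow> complex \<times> real) \<Rightarrow> 'i \<Rightarrow> 'i \<Rightarrow> int"
  where "signed_crossings I D i j =
    (\<Sum>(s, t) \<in> {(s, t). s \<in> {0..<1} \<and> t \<in> {0..<1} \<and> crossing I D i s j t}.
       if crossing_positive D i s j t then 1 else - 1)"

definition linking_number ::
    "'i set \<Rightarrow> ('i \<Rightarrow> real \<Rightarrow> complex \<times> real) \<Rightarrow> 'i \<Rightarrow> 'i \<Rightarrow> int"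
  where "linking_number I D i j = (signed_crossings I D i j + signed_crossings I D j i) div 2"

text \<open>
  The arcs are the pieces into which the link falls when it is cut at the lower points of all
  crossings.
\<close>

definition under_points :: "'i set \<Rightarrow> ('i \<Rightarrow> real \<Rightarrow> complex \<times> real) \<Rightarrow> (complex \<times> real) set"
  where "under_points I D = {D j t | i s j t. crossing I D i s j t}"

definition arcs :: "'i set \<Rightarrow> ('i \<Rightarrow> real \<Rightarrow> complex \<times> real) \<Rightarrow> (complex \<times> real) set set"
  where "arcs I D = components ((\<Union>i\<in>I. range (D i)) - under_points I D)"


section \<open>Dihedral groups\<close>

text \<open>The pair \<open>(r, i)\<close> stands for \<open>a\<^sup>r b\<^sup>i\<close>, where \<open>r\<close> is read as 0 or 1. The multiplication
  uses \<open>b\<^sup>i a = a b\<^sup>-\<^sup>i\<close>.\<close>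

definition dihedral :: "nat \<Rightarrow> (bool \<times> int) monoid"
  where "dihedral n =
    \<lparr>carrier = UNIV \<times> {0..<int n},
     mult = (\<lambda>(r, i) (s, j). (r \<noteq> s, ((if s then - i else i) + j) mod int n)),
     one = (False, 0)\<rparr>"

definition dih_a :: "bool \<times> int"
  where "dih_a = (True, 0)"

definition dih_b :: "nat \<Rightarrow> bool \<times> int"
  where "dih_b n = (False, 1 mod int n)"

definition dih_reflection :: "nat \<Rightarrow> nat \<Rightarrow> bool \<times> int"
  where "dih_reflection n i = dih_a \<otimes>\<^bsub>dihedral n\<^esub> (dih_b n [^]\<^bsub>dihedral n\<^esub> i)"

definition dih_rotation :: "nat \<Rightarrow> nat \<Rightarrow> bool \<times> int"
  where "dih_rotation n j = dih_b n [^]\<^bsub>dihedral n\<^esub> j"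

definition reflections :: "nat \<Rightarrow> (bool \<times> int) set"
  where "reflections n = dih_reflection n ` {0..<n}"

definition nontrivial_rotations :: "nat \<Rightarrow> (bool \<times> int) set"
  where "nontrivial_rotations n = dih_rotation n ` {1..<n}"

lemma dihedral_group:
  assumes "n \<ge> 1"
  shows "group (dihedral n)"
proof (rule groupI)
  show "\<And>x y. x \<in> carrier (dihedral n) \<Longrightarrow> y \<in> carrier (dihedral n) \<Longrightarrow>
      x \<otimes>\<^bsub>dihedral n\<^esub> y \<in> carrier (dihedral n)"
    using assms by (auto simp: dihedral_def)
  show "\<one>\<^bsub>dihedral n\<^esub> \<in> carrier (dihedral n)"
    using assms by (auto simp: dihedral_def)
  show "\<And>x y z. x \<in> carrier (dihedral n) \<Longrightarrow> y \<in> carrier (dihedral n) \<Longrightarrow>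
      z \<in> carrier (dihedral n) \<Longrightarrow>
      x \<otimes>\<^bsub>dihedral n\<^esub> y \<otimes>\<^bsub>dihedral n\<^esub> z = x \<otimes>\<^bsub>dihedral n\<^esub> (y \<otimes>\<^bsub>dihedral n\<^esub> z)"
    by (auto simp: dihedral_def mod_simps algebra_simps)
  show "\<And>x. x \<in> carrier (dihedral n) \<Longrightarrow> \<one>\<^bsub>dihedral n\<^esub> \<otimes>\<^bsub>dihedral n\<^esub> x = x"
    by (auto simp: dihedral_def)
  fix x assume x: "x \<in> carrier (dihedral n)"
  obtain r i where [simp]: "x = (r, i)" by fastforce
  show "\<exists>y\<in>carrier (dihedral n). y \<otimes>\<^bsub>dihedral n\<^esub> x = \<one>\<^bsub>dihedral n\<^esub>"
    by (rule bexI[of _ "(r, (if r then i else - i) mod int n)"])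
       (use assms x in \<open>auto simp: dihedral_def mod_simps\<close>)
qed

lemma dih_b_pow: "n \<ge> 1 \<Longrightarrow> dih_b n [^]\<^bsub>dihedral n\<^esub> (k::nat) = (False, int k mod int n)"
  by (induction k) (auto simp: dihedral_def dih_b_def nat_pow_def mod_simps algebra_simps)

lemma dih_reflection_eq:
  assumes "n \<ge> 1"
  shows "dih_reflection n k = (True, int k mod int n)"
  unfolding dih_reflection_def dih_b_pow[OF assms] by (simp add: dih_a_def dihedral_def)

lemma dihedral_relations:
  assumes "n \<ge> 1"
  shows "dih_a [^]\<^bsub>dihedral n\<^esub> (2::nat) = \<one>\<^bsub>dihedral n\<^esub>"
    and "dih_b n [^]\<^bsub>dihedral n\<^esub> n = \<one>\<^bsub>dihedral n\<^esub>"
    and "(dih_a \<otimes>\<^bsub>dihedral n\<^esub> dih_b n) [^]\<^bsub>dihedral n\<^esub> (2::nat) = \<one>\<^bsub>dihedral n\<^esub>"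
proof -
  show "dih_b n [^]\<^bsub>dihedral n\<^esub> n = \<one>\<^bsub>dihedral n\<^esub>"
    unfolding dih_b_pow[OF assms] by (simp add: dihedral_def)
qed (simp_all add: numeral_2_eq_2 nat_pow_def dihedral_def dih_a_def dih_b_def mod_simps)

lemma dihedral_order: "order (dihedral n) = 2 * n"
  by (simp add: order_def dihedral_def card_cartesian_product)

lemma dihedral_elements:
  assumes "n \<ge> 1"
  shows "carrier (dihedral n) = {\<one>\<^bsub>dihedral n\<^esub>} \<union> reflections n \<union> nontrivial_rotations n"
proof (intro equalityI subsetI)
  fix x assume "x \<in> carrier (dihedral n)"
  then obtain r i where x: "x = (r, int i)" and i: "i < n"
    by (auto simp: dihedral_def) (metis nonneg_int_cases of_nat_less_iff)
  show "x \<in> {\<one>\<^bsub>dihedral n\<^esub>} \<union> reflections n \<union> nontrivial_rotations n"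
  proof (cases "r \<or> i = 0")
    case True
    then show ?thesis
      using x i assms dih_reflection_eq[OF assms, of i]
      by (cases r) (force simp: reflections_def dihedral_def)+
  next
    case False
    then have "x = dih_rotation n i" "i \<in> {1..<n}"
      using x i by (auto simp: dih_rotation_def dih_b_pow[OF assms])
    then show ?thesis by (auto simp: nontrivial_rotations_def)
  qed
next
  fix x assume "x \<in> {\<one>\<^bsub>dihedral n\<^esub>} \<union> reflections n \<union> nontrivial_rotations n"
  then show "x \<in> carrier (dihedral n)"
    using assms
    by (auto simp: reflections_def nontrivial_rotations_def dih_reflection_eq dih_rotation_def
        dih_b_pow) (auto simp: dihedral_def)
qed

lemma dihedral_generated:
  assumes "n \<ge> 1"
  shows "generate (dihedral n) {dih_a, dih_b n} = carrier (dihedral n)"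
proof
  interpret group "dihedral n" by (rule dihedral_group[OF assms])
  have ab: "{dih_a, dih_b n} \<subseteq> carrier (dihedral n)"
    using assms by (auto simp: dihedral_def dih_a_def dih_b_def)
  show "generate (dihedral n) {dih_a, dih_b n} \<subseteq> carrier (dihedral n)"
    by (rule generate_incl[OF ab])
  interpret S: subgroup "generate (dihedral n) {dih_a, dih_b n}" "dihedral n"
    by (rule generate_is_subgroup[OF ab])
  have a: "dih_a \<in> generate (dihedral n) {dih_a, dih_b n}"
    and b: "dih_b n \<in> generate (dihedral n) {dih_a, dih_b n}"
    by (auto intro: generate.incl)
  have "dih_b n [^]\<^bsub>dihedral n\<^esub> (k::nat) \<in> generate (dihedral n) {dih_a, dih_b n}" for k
    by (induction k) (auto intro: b)
  then show "carrier (dihedral n) \<subseteq> generate (dihedral n) {dih_a, dih_b n}"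
    unfolding dihedral_elements[OF assms] reflections_def nontrivial_rotations_def
      dih_reflection_def dih_rotation_def
    using a by auto
qed


section \<open>Dihedral colorings\<close>

text \<open>The under arcs before and after a crossing are the arcs that contain the under strand just
  before and just after its parameter \<open>t\<close>.\<close>

definition dihedral_coloring ::
    "nat \<Rightarrow> 'i set \<Rightarrow> ('i \<Rightarrow> real \<Rightarrow> complex \<times> real) \<Rightarrow>
     ((complex \<times> real) set \<Rightarrow> bool \<times> int) \<Rightarrow> bool"
  where "dihedral_coloring n I D \<Gamma> \<longleftrightarrow>
    (\<forall>x\<in>arcs I D. \<Gamma> x \<in> carrier (dihedral n)) \<and>
    (\<forall>i s j t. \<forall>x\<in>arcs I D. \<forall>y\<in>arcs I D. \<forall>z\<in>arcs I D.
       crossing I D i s j t \<and> D i s \<in> x \<and>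
       (\<forall>\<^sub>F r in at_left t. D j r \<in> y) \<and> (\<forall>\<^sub>F r in at_right t. D j r \<in> z) \<longrightarrow>
       (if crossing_positive D i s j t
        then \<Gamma> x \<otimes>\<^bsub>dihedral n\<^esub> \<Gamma> z = \<Gamma> y \<otimes>\<^bsub>dihedral n\<^esub> \<Gamma> x
        else \<Gamma> z \<otimes>\<^bsub>dihedral n\<^esub> \<Gamma> x = \<Gamma> x \<otimes>\<^bsub>dihedral n\<^esub> \<Gamma> y))"

definition two_tone ::
    "nat \<Rightarrow> 'i set \<Rightarrow> ('i \<Rightarrow> real \<Rightarrow> complex \<times> real) \<Rightarrow>
     ((complex \<times> real) set \<Rightarrow> bool \<times> int) \<Rightarrow> bool"
  where "two_tone n I D \<Gamma> \<longleftrightarrow>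
    \<one>\<^bsub>dihedral n\<^esub> \<notin> \<Gamma> ` arcs I D \<and>
    \<Gamma> ` arcs I D \<inter> reflections n \<noteq> {} \<and>
    \<Gamma> ` arcs I D \<inter> nontrivial_rotations n \<noteq> {}"

end

theory Submission
  imports Defs
begin

text \<open>The double cover of the 3-sphere branched along the unknot \<open>\<ell>\<^sub>0\<close> is again a 3-sphere. Every
  other component has even linking number with \<open>\<ell>\<^sub>0\<close>, so it lifts to two closed curves, which the
  deck transformation exchanges. Let \<open>F\<close> be a complex function on the double cover whose zero set
  is the union of one lift of each of these components, transverse along them. The quotient of \<open>F\<close> by
  its composition with the deck transformation is inverted by the deck transformation, so the
  logarithms of the quotient form a covering of the link complement whose deck group is the infinite
  dihedral group. A meridian of \<open>\<ell>\<^sub>0\<close> exchanges the sheets of the double cover and acts as a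
  reflection, and a meridian of another component acts as a translation by \<open>1\<close> or \<open>- 1\<close>. By the
  Wirtinger relations the reduction of this action modulo \<open>n\<close> is the coloring.

  The evenness of the linking number has to be brought into the form that the angle around \<open>\<ell>\<^sub>0\<close>
  has an even winding number along the component. Continuing a logarithm below and above the diagram
  shows that this winding number is, up to sign, the signed count of the crossings where \<open>\<ell>\<^sub>0\<close> is
  over, and also of those where it is under, hence the linking number.\<close>

section \<open>Functions with a prescribed zero set\<close>

text \<open>The isotopies supply a mere homeomorphism of the 3-sphere, so a priori nothing relates
  the angle around the great circle to the tubes and crossings of the diagram. The relation is one
  integer: a function that vanishes exactly on the knot, with degree one in the tube of the diagram,
  has a logarithm on the unwrapped complement of the great circle and winds \<open>d\<close> times
  there. If a meridian of the diagram changes the angle by \<open>k\<close> turns, it changes this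
  logarithm by \<open>d * k\<close> periods, and by degree one this is a single period. Coverings
  given by logarithms take the place of homomorphisms of the link group. Logarithms exist over every
  contractible set, so a covering is handled through its sections over such sets. The region above
  the whole diagram is contractible and carries the reference section; it acts as a base point, and
  a color compares two continuations across a strand, one above it and one below it. Functions with
  given zeros exist because local equations differ by nonvanishing factors, whose logarithms over a
  contractible overlap can be extended.\<close>

text \<open>\<open>A\<close> is a local equation of \<open>Z\<close>, given only near
  \<open>Z\<close>. The factor \<open>G\<close> cannot be read off as \<open>F x / A x\<close> on
  \<open>Z\<close> itself; its continuity and nonvanishing there record that \<open>F\<close>
  vanishes in the same transverse way as \<open>A\<close>.\<close>

definition divisor_on :: "'a::euclidean_space set \<Rightarrow> ('a \<Rightarrow> complex) \<Rightarrow> 'a set \<Rightarrow> 'a set \<Rightarrow> bool"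
  where "divisor_on V A Z C \<longleftrightarrow> (\<exists>F G. continuous_on C F \<and> (\<forall>x\<in>C. F x = 0 \<longleftrightarrow> x \<in> Z) \<and>
     continuous_on (C \<inter> V) G \<and> (\<forall>x\<in>C \<inter> V. G x \<noteq> 0 \<and> F x = A x * G x))"

lemma divisor_on_subset: "divisor_on V A Z C \<Longrightarrow> C' \<subseteq> C \<Longrightarrow> divisor_on V A Z C'"
  unfolding divisor_on_def by (elim ex_forward) (blast intro: continuous_on_subset)

text \<open>The ratio of the two functions extends across \<open>Z\<close> as the ratio of
  \<open>G1\<close> and \<open>G2\<close>, so it is continuous and nonvanishing on the whole
  overlap. Contractibility gives it a logarithm, Tietze extends the logarithm to \<open>C2\<close>,
  and multiplying \<open>F2\<close> by its exponential makes the two functions agree.\<close>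

lemma divisor_on_Un:
  fixes Z :: "'a::euclidean_space set"
  assumes V: "open V" and Z: "closed Z" "Z \<subseteq> V"
    and C: "closed C1" "closed C2" "contractible (C1 \<inter> C2)"
    and 1: "divisor_on V A Z C1" and 2: "divisor_on V A Z C2"
  shows "divisor_on V A Z (C1 \<union> C2)"
proof -
  obtain F1 G1 where F1: "continuous_on C1 F1" "\<And>x. x \<in> C1 \<Longrightarrow> F1 x = 0 \<longleftrightarrow> x \<in> Z"
    and G1: "continuous_on (C1 \<inter> V) G1" "\<And>x. x \<in> C1 \<Longrightarrow> x \<in> V \<Longrightarrow> G1 x \<noteq> 0"
       "\<And>x. x \<in> C1 \<Longrightarrow> x \<in> V \<Longrightarrow> F1 x = A x * G1 x"
    using 1 unfolding divisor_on_def by auto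
  obtain F2 G2 where F2: "continuous_on C2 F2" "\<And>x. x \<in> C2 \<Longrightarrow> F2 x = 0 \<longleftrightarrow> x \<in> Z"
    and G2: "continuous_on (C2 \<inter> V) G2" "\<And>x. x \<in> C2 \<Longrightarrow> x \<in> V \<Longrightarrow> G2 x \<noteq> 0"
       "\<And>x. x \<in> C2 \<Longrightarrow> x \<in> V \<Longrightarrow> F2 x = A x * G2 x"
    using 2 unfolding divisor_on_def by auto
  define J where "J = C1 \<inter> C2"
  define R where "R x = (if x \<in> V then G1 x / G2 x else F1 x / F2 x)" for x
  have Req: "R x = F1 x / F2 x" if "x \<in> J - Z" for x
    using that F1(2)[of x] G1(3)[of x] G2(3)[of x] by (auto simp: R_def J_def)
  have "continuous_on (J \<inter> V \<union> (J - Z)) R"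
  proof (rule continuous_on_Un_local_open)
    show "openin (top_of_set (J \<inter> V \<union> (J - Z))) (J \<inter> V)"
      unfolding openin_open using V by (intro exI[of _ V]) auto
    show "openin (top_of_set (J \<inter> V \<union> (J - Z))) (J - Z)"
      unfolding openin_open using Z by (intro exI[of _ "- Z"]) auto
    have "continuous_on (J \<inter> V) (\<lambda>x. G1 x / G2 x)"
      using G1(1) G2(1) G2(2) by (intro continuous_on_divide) (auto simp: J_def elim: continuous_on_subset)
    then show "continuous_on (J \<inter> V) R"
      by (rule continuous_on_eq) (auto simp: R_def)
    have "continuous_on (J - Z) (\<lambda>x. F1 x / F2 x)"
      using F1(1) F2(1) F2(2) by (intro continuous_on_divide) (auto simp: J_def elim: continuous_on_subset)
    then show "continuous_on (J - Z) R"
      by (rule continuous_on_eq) (auto simp: Req)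
  qed
  moreover have "J \<inter> V \<union> (J - Z) = J" using Z by auto
  ultimately have "continuous_on J R" by simp
  moreover have "R x \<noteq> 0" if "x \<in> J" for x
    using that Z G1(2)[of x] G2(2)[of x] F1(2)[of x] F2(2)[of x] by (auto simp: R_def J_def)
  moreover have "contractible J" using C(3) by (simp add: J_def)
  ultimately obtain r where r: "continuous_on J r" "\<And>x. x \<in> J \<Longrightarrow> R x = exp (r x)"
    using continuous_logarithm_on_contractible[of J R] by blast
  have "closedin (top_of_set C2) J" 
    unfolding J_def closedin_closed using C by (intro exI[of _ C1]) auto
  then obtain q where q: "continuous_on C2 q" "\<And>x. x \<in> J \<Longrightarrow> q x = r x"
    using Tietze_unbounded[OF r(1)] by blast
  have Gq: "G1 x = exp (q x) * G2 x" if "x \<in> J" "x \<in> V" for x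
    using that q(2)[of x] r(2)[of x] G2(2)[of x] by (simp add: R_def J_def field_simps)
  have Fq: "F1 x = exp (q x) * F2 x" if "x \<in> J" for x
  proof (cases "x \<in> V")
    case True
    then show ?thesis using Gq[OF that True] G1(3)[of x] G2(3)[of x] that by (simp add: J_def)
  next
    case False
    then have "x \<notin> Z" using Z by auto
    then show ?thesis using that q(2)[of x] r(2)[of x] F2(2)[of x] False by (simp add: R_def J_def field_simps)
  qed
  define F where "F x = (if x \<in> C1 then F1 x else exp (q x) * F2 x)" for x
  define G where "G x = (if x \<in> C1 then G1 x else exp (q x) * G2 x)" for x
  have "continuous_on (C1 \<union> C2) F" unfolding F_def
  proof (rule continuous_on_cases_local)
    show "closedin (top_of_set (C1 \<union> C2)) C1" "closedin (top_of_set (C1 \<union> C2)) C2"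
      using C by (auto intro: closed_subset)
    show "continuous_on C2 (\<lambda>x. exp (q x) * F2 x)"
      by (intro continuous_intros q F2)
  qed (use F1 Fq in \<open>auto simp: J_def\<close>)
  moreover have "continuous_on (C1 \<inter> V \<union> C2 \<inter> V) G" unfolding G_def
  proof (rule continuous_on_cases_local)
    show "closedin (top_of_set (C1 \<inter> V \<union> C2 \<inter> V)) (C1 \<inter> V)"
      unfolding closedin_closed using C by (intro exI[of _ C1]) auto
    show "closedin (top_of_set (C1 \<inter> V \<union> C2 \<inter> V)) (C2 \<inter> V)"
      unfolding closedin_closed using C by (intro exI[of _ C2]) auto
    show "continuous_on (C2 \<inter> V) (\<lambda>x. exp (q x) * G2 x)"
      by (intro continuous_intros continuous_on_subset[OF q(1)] G2) auto
  qed (use G1 Gq in \<open>auto simp: J_def\<close>)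
  moreover have "C1 \<inter> V \<union> C2 \<inter> V = (C1 \<union> C2) \<inter> V" by auto
  moreover have "F x = 0 \<longleftrightarrow> x \<in> Z" if "x \<in> C1 \<union> C2" for x
    using that F1(2)[of x] F2(2)[of x] by (auto simp: F_def)
  moreover have "G x \<noteq> 0 \<and> F x = A x * G x" if "x \<in> (C1 \<union> C2) \<inter> V" for x
    using that G1(2,3)[of x] G2(2,3)[of x] by (auto simp: F_def G_def)
  ultimately show ?thesis unfolding divisor_on_def by metis
qed

text \<open>On small boxes a solution is obvious, and the two halves of a split box overlap in a
  convex set, so \<open>divisor_on_Un\<close> applies at every split. The subdivision is that of
  gauge integration, with \<open>operative\<close> as its induction principle.\<close>

lemma divisor_on_cbox:
  fixes Z :: "'a::euclidean_space set"
  assumes V: "open V" and Z: "closed Z" "Z \<subseteq> V"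
    and A: "continuous_on V A" "\<And>x. x \<in> V \<Longrightarrow> A x = 0 \<longleftrightarrow> x \<in> Z"
  shows "divisor_on V A Z (cbox a b)"
proof -
  \<comment> \<open>An operative predicate must hold on every box without interior, hence the first
    disjunct. A flat half of a split then carries no information, but by \<open>half\<close> the
    other half is in that case the whole box.\<close>
  define P where "P C \<longleftrightarrow> interior C = {} \<or> divisor_on V A Z C" for C
  have half: "interior (cbox a b \<inter> {x. x \<bullet> k \<le> c}) \<noteq> {} \<or> cbox a b \<inter> {x. c \<le> x \<bullet> k} = cbox a b"
    "interior (cbox a b \<inter> {x. c \<le> x \<bullet> k}) \<noteq> {} \<or> cbox a b \<inter> {x. x \<bullet> k \<le> c} = cbox a b"
    if k: "k \<in> Basis" and ne: "interior (cbox a b) \<noteq> {}" for a b k :: 'a and c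
  proof -
    have ab: "\<And>i. i \<in> Basis \<Longrightarrow> a \<bullet> i < b \<bullet> i" using ne by (simp add: interior_cbox box_ne_empty)
    show "interior (cbox a b \<inter> {x. x \<bullet> k \<le> c}) \<noteq> {} \<or> cbox a b \<inter> {x. c \<le> x \<bullet> k} = cbox a b"
    proof (cases "a \<bullet> k < c")
      case True
      then show ?thesis using ab k unfolding interval_split[OF k] interior_cbox box_ne_empty
        by (auto simp: min_def)
    next
      case False
      then show ?thesis using k by (auto simp: mem_box) (meson dual_order.trans linorder_le_less_linear less_imp_le)
    qed
    show "interior (cbox a b \<inter> {x. c \<le> x \<bullet> k}) \<noteq> {} \<or> cbox a b \<inter> {x. x \<bullet> k \<le> c} = cbox a b"
    proof (cases "c < b \<bullet> k")
      case True
      then show ?thesis using ab k unfolding interval_split[OF k] interior_cbox box_ne_empty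
        by (auto simp: max_def)
    next
      case False
      then show ?thesis using k by (auto simp: mem_box) (meson dual_order.trans linorder_le_less_linear less_imp_le)
    qed
  qed
  have op: "operative conj True P"
  proof -
    interpret Groups.comm_monoid conj True by standard auto
    show ?thesis
    proof standard
      show "P (cbox a b) = True" if "box a b = {}" for a b using that by (simp add: P_def)
      show "P (cbox a b) = (P (cbox a b \<inter> {x. x \<bullet> k \<le> c}) \<and> P (cbox a b \<inter> {x. c \<le> x \<bullet> k}))"
        if k: "k \<in> Basis" for a b c k
      proof
        assume "P (cbox a b)"
        then show "P (cbox a b \<inter> {x. x \<bullet> k \<le> c}) \<and> P (cbox a b \<inter> {x. c \<le> x \<bullet> k})"
          unfolding P_def by (metis divisor_on_subset inf_le1 interior_mono subset_empty)
      next
        assume *: "P (cbox a b \<inter> {x. x \<bullet> k \<le> c}) \<and> P (cbox a b \<inter> {x. c \<le> x \<bullet> k})"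
        show "P (cbox a b)"
        proof (cases "interior (cbox a b) = {}")
          case False
          have cv: "convex (cbox a b \<inter> {x. x \<bullet> k \<le> c} \<inter> (cbox a b \<inter> {x. c \<le> x \<bullet> k}))"
            unfolding interval_split[OF k] by (intro convex_Int convex_box)
          have un: "cbox a b \<inter> {x. x \<bullet> k \<le> c} \<union> cbox a b \<inter> {x. c \<le> x \<bullet> k} = cbox a b" by auto
          show ?thesis
          proof (cases "divisor_on V A Z (cbox a b \<inter> {x. x \<bullet> k \<le> c}) \<and> divisor_on V A Z (cbox a b \<inter> {x. c \<le> x \<bullet> k})")
            case True
            have "divisor_on V A Z (cbox a b \<inter> {x. x \<bullet> k \<le> c} \<union> cbox a b \<inter> {x. c \<le> x \<bullet> k})"
              by (rule divisor_on_Un[OF V Z]) (use True cv k in \<open>auto simp: interval_split convex_imp_contractible\<close>)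
            then show ?thesis unfolding P_def un by simp
          next
            case False2: False
            then show ?thesis using half[OF k False, of c] * unfolding P_def by metis
          qed
        qed (simp add: P_def)
      qed
    qed
  qed
  \<comment> \<open>Near \<open>Z\<close> the function is \<open>A\<close> with factor
    \<open>1\<close>; away from \<open>Z\<close> it is \<open>1\<close> with factor
    \<open>1 / A x\<close>.\<close>
  have loc: "\<exists>e>0. \<forall>C \<subseteq> ball x e. divisor_on V A Z C" for x
  proof (cases "x \<in> Z")
    case True
    then obtain e where e: "e > 0" "ball x e \<subseteq> V" using V Z open_contains_ball by blast
    have "divisor_on V A Z C" if "C \<subseteq> ball x e" for C
      unfolding divisor_on_def using that e A
      by (intro exI[of _ A] exI[of _ "\<lambda>_. 1"]) (auto intro: continuous_on_subset)
    then show ?thesis using e by blast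
  next
    case False
    then obtain e where e: "e > 0" "ball x e \<subseteq> - Z" using Z(1) open_contains_ball[of "-Z"] by auto
    have "divisor_on V A Z C" if C: "C \<subseteq> ball x e" for C
      unfolding divisor_on_def
    proof (rule exI[of _ "\<lambda>_. 1"], rule exI[of _ "\<lambda>x. 1 / A x"], intro conjI)
      show "continuous_on (C \<inter> V) (\<lambda>x. 1 / A x)"
        using C e A by (intro continuous_intros) (auto intro: continuous_on_subset)
    qed (use C e A in \<open>auto\<close>)
    then show ?thesis using e by blast
  qed
  then obtain e where e: "\<And>x. e x > 0" "\<And>x C. C \<subseteq> ball x (e x) \<Longrightarrow> divisor_on V A Z C" by metis
  \<comment> \<open>The unit ball is added so that the enclosing box has interior points; on a flat
    box \<open>P\<close> would say nothing.\<close>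
  have "bounded (cbox a b \<union> ball 0 1)" by simp
  then obtain c where c: "cbox a b \<union> ball 0 1 \<subseteq> cbox (- c) c"
    by (metis bounded_subset_cbox_symmetric)
  have sub: "cbox a b \<subseteq> cbox (- c) c" using c by simp
  have "ball 0 1 \<subseteq> interior (cbox (- c) c)" using c by (intro interior_maximal) auto
  then have ne: "interior (cbox (- c) c) \<noteq> {}" by (metis centre_in_ball empty_iff subset_iff zero_less_one)
  have "gauge (\<lambda>x. ball x (e x))" using e by (simp add: gauge_ball_dependent)
  then obtain p where p: "p tagged_division_of cbox (- c) c" "(\<lambda>x. ball x (e x)) fine p"
    using fine_division_exists by blast
  interpret operative conj True P by (rule op)
  have "P C" if "C \<in> snd ` p" for C
  proof -
    from that obtain x where "(x, C) \<in> p" by auto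
    then have "C \<subseteq> ball x (e x)" using p(2) by (auto simp: fine_def)
    then show ?thesis using e(2) by (simp add: P_def)
  qed
  moreover have "finite (snd ` p)" using p(1) by blast
  ultimately have "P (cbox (- c) c)"
    unfolding division[OF division_of_tagged_division[OF p(1)], symmetric] comm_monoid_set_F_and by blast
  then have "divisor_on V A Z (cbox (- c) c)" using ne unfolding P_def by blast
  then show ?thesis using sub by (rule divisor_on_subset)
qed

section \<open>Tubes around the strands\<close>

lemma periodic_shift:
  fixes f :: "real \<Rightarrow> 'a"
  assumes "\<And>t. f (t + 1) = f t"
  shows "f (t + of_int k) = f t"
proof (induction k)
  case (nonneg n)
  show ?case
  proof (induction n)
    case (Suc n)
    have "f (t + of_int (int (Suc n))) = f ((t + of_int (int n)) + 1)" by (simp add: algebra_simps)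
    then show ?case using assms Suc by simp
  qed simp
next
  case (neg n)
  have *: "f (t - real n) = f t" for n t
  proof (induction n)
    case (Suc n)
    have "f (t - real (Suc n)) = f ((t - real (Suc n)) + 1)" using assms by metis
    also have "(t - real (Suc n)) + 1 = t - real n" by simp
    finally show ?case using Suc by simp
  qed simp
  have "t + of_int (- int (Suc n)) = t - real (Suc n)" by simp
  then show ?case using *[of t "Suc n"] by (simp only:)
qed

lemma periodic_range:
  fixes f :: "real \<Rightarrow> 'a"
  assumes "\<And>t. f (t + 1) = f t"
  shows "range f = f ` {0..1}"
proof -
  have "f t \<in> f ` {0..1}" for t
    using periodic_shift[of f t "- \<lfloor>t\<rfloor>", OF assms]
    by (intro image_eqI[of _ _ "t - of_int \<lfloor>t\<rfloor>"]) (auto, linarith)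
  then show ?thesis by auto
qed

text \<open>A shift brings the first argument into the unit interval; the second differs from it by
  less than \<open>1\<close>, so the compact window \<open>{-1..2}\<close> contains both.\<close>

lemma periodic_uniformly_continuous:
  fixes f :: "real \<Rightarrow> 'a::metric_space"
  assumes per: "\<And>t. f (t + 1) = f t" and cont: "continuous_on UNIV f" and e: "e > 0"
  obtains d where "d > 0" "\<And>s t. \<bar>s - t\<bar> < d \<Longrightarrow> dist (f s) (f t) < e"
proof -
  have "uniformly_continuous_on {-1..2} f"
    using cont by (intro compact_uniformly_continuous) (auto intro: continuous_on_subset)
  then obtain d where d: "d > 0"
    "\<And>s t. s \<in> {-1..2} \<Longrightarrow> t \<in> {-1..2} \<Longrightarrow> dist t s < d \<Longrightarrow> dist (f t) (f s) < e"
    unfolding uniformly_continuous_on_def using e by metis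
  show thesis
  proof (rule that[of "min d 1"])
    show "min d 1 > 0" using d by simp
    fix s t :: real assume st: "\<bar>s - t\<bar> < min d 1"
    define k where "k = \<lfloor>s\<rfloor>"
    have k: "0 \<le> s - of_int k" "s - of_int k < 1" unfolding k_def by linarith+
    have "dist (f (s + of_int (- k))) (f (t + of_int (- k))) < e"
      using k st by (intro d(2)) (auto simp: dist_real_def)
    then show "dist (f s) (f t) < e" by (simp only: periodic_shift[of f, OF per])
  qed
qed

lemma periodic_bounded:
  fixes f :: "real \<Rightarrow> 'a::real_normed_vector"
  assumes per: "\<And>t. f (t + 1) = f t" and cont: "continuous_on UNIV f"
  obtains B where "B > 0" "\<And>t. norm (f t) \<le> B"
proof -
  have "compact (range f)"
    unfolding periodic_range[of f, OF per] using cont by (intro compact_continuous_image) (auto intro: continuous_on_subset)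
  then have "bounded (range f)" by (rule compact_imp_bounded)
  then obtain B where "B > 0" "\<forall>x\<in>range f. norm x \<le> B" unfolding bounded_pos by blast
  then show thesis by (intro that[of B]) auto
qed

lemma periodic_bounded_below:
  fixes f :: "real \<Rightarrow> 'a::real_normed_vector"
  assumes per: "\<And>t. f (t + 1) = f t" and cont: "continuous_on UNIV f" and nz: "\<And>t. f t \<noteq> 0"
  obtains m where "m > 0" "\<And>t. m \<le> norm (f t)"
proof -
  have c: "continuous_on UNIV (\<lambda>t. inverse (norm (f t)))"
    using nz by (intro continuous_intros cont) auto
  obtain B where B: "B > 0" "\<And>t. norm (inverse (norm (f t))) \<le> B"
    using periodic_bounded[of "\<lambda>t. inverse (norm (f t))", OF _ c] per by metis
  show thesis
  proof (rule that[of "inverse B"])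
    fix t show "inverse B \<le> norm (f t)"
      using B(1) B(2)[of t] nz[of t] by (simp add: field_simps)
  qed (use B in simp)
qed

section \<open>Strips around immersed plane curves and tubes around their lifts\<close>

lemma plane_det_ii: "plane_det v (\<i> * u) = v \<bullet> u"
  by (simp add: plane_det_def inner_complex_def)

lemma periodic_deriv:
  fixes f :: "real \<Rightarrow> 'a::real_normed_vector"
  assumes per: "\<And>t. f (t + 1) = f t" and "\<And>t. (f has_vector_derivative f' t) (at t)"
  shows "f' (t + 1) = f' t"
proof -
  have "((\<lambda>x. x + 1) has_vector_derivative 1) (at t)" by (auto intro!: derivative_eq_intros)
  from vector_diff_chain_at[OF this assms(2)]
  have "((\<lambda>x. f (x + 1)) has_vector_derivative f' (t + 1)) (at t)" by (simp add: o_def)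
  then have "(f has_vector_derivative f' (t + 1)) (at t)" by (simp add: per)
  then show ?thesis using assms(2) vector_derivative_unique_at by blast
qed

lemma chord_bound:
  fixes f :: "real \<Rightarrow> 'a::real_normed_vector"
  assumes der: "\<And>t. (f has_vector_derivative f' t) (at t)"
    and d: "\<And>s t. \<bar>s - t\<bar> < d \<Longrightarrow> norm (f' s - f' t) \<le> e"
    and st: "\<bar>s - t\<bar> < d"
  shows "norm (f t - f s - (t - s) *\<^sub>R f' s) \<le> e * \<bar>t - s\<bar>"
proof -
  have "norm (f t - f s - (t - s) *\<^sub>R f' s) \<le> norm (t - s) * e"
  proof (rule differentiable_bound_linearization[where S="closed_segment s t"])
    show "(f has_derivative (\<lambda>h. h *\<^sub>R f' x)) (at x within closed_segment s t)" for x
      using der[of x] by (auto simp: has_vector_derivative_def intro: has_derivative_at_withinI)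
    show "s + x *\<^sub>R (t - s) \<in> closed_segment s t" if "x \<in> {0..1}" for x
      using that by (auto simp: closed_segment_def algebra_simps)
    show "onorm ((\<lambda>i. i *\<^sub>R f' x) - (\<lambda>i. i *\<^sub>R f' s)) \<le> e" if "x \<in> closed_segment s t" for x
    proof (rule onorm_le)
      fix i :: real
      have "\<bar>x - s\<bar> < d" using that st by (auto simp: closed_segment_eq_real_ivl split: if_splits)
      then have *: "norm (f' x - f' s) \<le> e" by (rule d)
      have "norm (((\<lambda>i. i *\<^sub>R f' x) - (\<lambda>i. i *\<^sub>R f' s)) i) = \<bar>i\<bar> * norm (f' x - f' s)"
        by (simp flip: scaleR_right_diff_distrib)
      also have "\<dots> \<le> \<bar>i\<bar> * e" using * by (intro mult_left_mono) auto
      finally show "norm (((\<lambda>i. i *\<^sub>R f' x) - (\<lambda>i. i *\<^sub>R f' s)) i) \<le> e * norm i" by (simp add: mult.commute)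
    qed
  qed auto
  then show ?thesis by (simp add: mult.commute)
qed

text \<open>The curve is only C1, so its normals may meet arbitrarily close to it. The secant
  direction \<open>u\<close> over a fixed step \<open>h\<close> is Lipschitz and still close to the
  velocity, and the field orthogonal to \<open>u\<close> replaces the normals. Injectivity is local
  in the parameter because the plane curve may cross itself.\<close>

lemma planar_tube:
  fixes \<gamma> v :: "real \<Rightarrow> complex"
  assumes per: "\<And>t. \<gamma> (t + 1) = \<gamma> t" and der: "\<And>t. (\<gamma> has_vector_derivative v t) (at t)"
    and cont: "continuous_on UNIV v" and nz: "\<And>t. v t \<noteq> 0"
  obtains nn b d where "b > 0" "d > 0" "continuous_on UNIV nn" "\<And>t. nn (t + 1) = nn t"
    "\<And>t. plane_det (v t) (nn t) > 0"
    "\<And>s s' y y'. \<bar>s - s'\<bar> < d \<Longrightarrow> \<bar>y\<bar> < b \<Longrightarrow> \<bar>y'\<bar> < b \<Longrightarrow>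
        \<gamma> s + of_real y * nn s = \<gamma> s' + of_real y' * nn s' \<Longrightarrow> s = s' \<and> y = y'"
proof -
  have perv: "v (t + 1) = v t" for t using periodic_deriv[OF per der] .
  obtain M where M: "M > 0" "\<And>t. norm (v t) \<le> M" using periodic_bounded[OF perv cont] by blast
  obtain m where m: "m > 0" "\<And>t. m \<le> norm (v t)" using periodic_bounded_below[OF perv cont nz] by blast
  obtain d where d: "d > 0" "\<And>s t. \<bar>s - t\<bar> < d \<Longrightarrow> dist (v s) (v t) < m / 4"
    using periodic_uniformly_continuous[OF perv cont, of "m / 4"] m by auto
  have chord: "norm (\<gamma> t - \<gamma> s - (t - s) *\<^sub>R v s) \<le> m / 4 * \<bar>t - s\<bar>" if "\<bar>s - t\<bar> < d" for s t
  proof (rule chord_bound[OF der _ that])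
    show "norm (v s - v t) \<le> m / 4" if "\<bar>s - t\<bar> < d" for s t using d(2)[OF that] by (simp add: dist_norm)
  qed
  have lip: "norm (\<gamma> t - \<gamma> s) \<le> M * \<bar>t - s\<bar>" for s t
  proof -
    have "norm (\<gamma> t - \<gamma> s) \<le> M * norm (t - s)"
    proof (rule differentiable_bound[of UNIV])
      show "(\<gamma> has_derivative (\<lambda>h. h *\<^sub>R v x)) (at x within UNIV)" for x
        using der[of x] by (simp add: has_vector_derivative_def)
      show "onorm (\<lambda>h. h *\<^sub>R v x) \<le> M" for x
        using M by (intro onorm_le) (simp add: mult.commute[of M] mult_left_mono)
    qed auto
    then show ?thesis by simp
  qed
  have contg: "continuous_on UNIV \<gamma>"
    using der by (meson continuous_at_imp_continuous_on has_vector_derivative_continuous)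
  define h where "h = d / 2"
  have h: "h > 0" "h < d" using d by (auto simp: h_def)
  define u where "u s = (\<gamma> (s + h) - \<gamma> s) /\<^sub>R h" for s
  have contu: "continuous_on UNIV u"
    unfolding u_def by (intro continuous_intros continuous_on_compose2[OF contg] contg) auto
  have peru: "u (t + 1) = u t" for t
    using per[of "t + h"] per[of t] by (simp add: u_def add.commute add.left_commute)
  have uv: "norm (u s - v s) \<le> m / 4" for s
  proof -
    have "u s - v s = (\<gamma> (s + h) - \<gamma> s - ((s + h) - s) *\<^sub>R v s) /\<^sub>R h"
      using h by (simp add: u_def algebra_simps)
    also have "norm \<dots> = norm (\<gamma> (s + h) - \<gamma> s - ((s + h) - s) *\<^sub>R v s) / h"
      using h by (simp add: divide_inverse_commute)
    also have "\<dots> \<le> (m / 4 * \<bar>(s + h) - s\<bar>) / h"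
      using h by (intro divide_right_mono chord) auto
    also have "\<dots> = m / 4" using h by simp
    finally show ?thesis .
  qed
  have vu: "v s \<bullet> u s \<ge> 3/4 * (norm (v s))\<^sup>2" for s
  proof -
    have "\<bar>v s \<bullet> (u s - v s)\<bar> \<le> norm (v s) * norm (u s - v s)" by (rule Cauchy_Schwarz_ineq2)
    also have "\<dots> \<le> norm (v s) * (norm (v s) / 4)"
      using uv[of s] m(2)[of s] by (intro mult_left_mono) auto
    finally have "\<bar>v s \<bullet> (u s - v s)\<bar> \<le> (norm (v s))\<^sup>2 / 4" by (simp add: power2_eq_square)
    moreover have "v s \<bullet> u s = (norm (v s))\<^sup>2 + v s \<bullet> (u s - v s)"
      by (simp add: inner_diff_right power2_norm_eq_inner)
    ultimately show ?thesis by linarith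
  qed
  have nu: "norm (u s) \<le> 5/4 * norm (v s)" for s
    using uv[of s] m(2)[of s] norm_triangle_sub[of "u s" "v s"] by linarith
  have lipu: "norm (u t - u s) \<le> 2 * M / h * \<bar>t - s\<bar>" for s t
  proof -
    have "u t - u s = ((\<gamma> (t + h) - \<gamma> (s + h)) - (\<gamma> t - \<gamma> s)) /\<^sub>R h"
      by (simp add: u_def algebra_simps)
    also have "norm \<dots> = norm ((\<gamma> (t + h) - \<gamma> (s + h)) - (\<gamma> t - \<gamma> s)) / h"
      using h by (simp add: divide_inverse_commute)
    also have "\<dots> \<le> (M * \<bar>t - s\<bar> + M * \<bar>t - s\<bar>) / h"
      using h lip[of "t + h" "s + h"] lip[of t s]
        norm_triangle_ineq4[of "\<gamma> (t + h) - \<gamma> (s + h)" "\<gamma> t - \<gamma> s"]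
      by (intro divide_right_mono) auto
    finally show ?thesis by (simp add: algebra_simps)
  qed
  \<comment> \<open>\<open>u\<close> has Lipschitz constant \<open>2 * M / h\<close>, so a
    displacement below \<open>b\<close> contributes at most \<open>m / 5\<close>. Added to the chord
    error \<open>m / 4\<close> and multiplied by the \<open>5/4\<close> of \<open>nu\<close>, this
    yields \<open>9/16\<close>, less than the \<open>3/4\<close> of \<open>vu\<close>.\<close>
  define b where "b = m * h / (10 * M)"
  have b: "b > 0" using m h M by (simp add: b_def)
  show thesis
  proof (rule that[of b d "\<lambda>s. \<i> * u s"])
    show "continuous_on UNIV (\<lambda>s. \<i> * u s)" by (intro continuous_intros contu)
    show "0 < plane_det (v t) (\<i> * u t)" for t
      using vu[of t] nz[of t] by (simp add: plane_det_ii) (smt (verit) zero_less_power zero_less_norm_iff)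
    fix s s' y y' :: real
    assume s: "\<bar>s - s'\<bar> < d" and y: "\<bar>y\<bar> < b" "\<bar>y'\<bar> < b"
      and eq: "\<gamma> s + of_real y * (\<i> * u s) = \<gamma> s' + of_real y' * (\<i> * u s')"
    have ii: "(\<i> * w) \<bullet> w = 0" for w by (simp add: inner_complex_def)
    have yb: "\<bar>y'\<bar> * (2 * M / h) \<le> m / 5"
    proof -
      have "\<bar>y'\<bar> * (2 * M / h) \<le> b * (2 * M / h)" using y h M by (intro mult_right_mono) auto
      also have "\<dots> = m / 5" using h M by (simp add: b_def field_simps)
      finally show ?thesis .
    qed
    have ss: "s = s'"
    proof (rule ccontr)
      assume ne: "s \<noteq> s'"
      \<comment> \<open>Pairing with \<open>u s\<close> removes the displacement at
        \<open>s\<close>, which is orthogonal to it.\<close>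
      have "0 = (\<gamma> s' - \<gamma> s + of_real y' * (\<i> * u s') - of_real y * (\<i> * u s)) \<bullet> u s"
        using eq by (simp add: algebra_simps)
      also have "\<dots> = (\<gamma> s' - \<gamma> s) \<bullet> u s + (y' *\<^sub>R (\<i> * u s')) \<bullet> u s - (y *\<^sub>R (\<i> * u s)) \<bullet> u s"
        by (simp only: scaleR_conv_of_real inner_diff_left inner_add_left)
      also have "\<dots> = (\<gamma> s' - \<gamma> s) \<bullet> u s + (y' *\<^sub>R (\<i> * (u s' - u s))) \<bullet> u s"
        by (simp add: ii right_diff_distrib scaleR_right_diff_distrib inner_diff_left)
      also have "(\<gamma> s' - \<gamma> s) \<bullet> u s = (\<gamma> s' - \<gamma> s - (s' - s) *\<^sub>R v s) \<bullet> u s + (s' - s) * (v s \<bullet> u s)"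
        by (simp add: algebra_simps inner_diff_left)
      finally have eq0: "(s' - s) * (v s \<bullet> u s) =
          - ((\<gamma> s' - \<gamma> s - (s' - s) *\<^sub>R v s) \<bullet> u s) - (y' *\<^sub>R (\<i> * (u s' - u s))) \<bullet> u s" by simp
      have "\<bar>(\<gamma> s' - \<gamma> s - (s' - s) *\<^sub>R v s) \<bullet> u s\<bar> \<le> norm (\<gamma> s' - \<gamma> s - (s' - s) *\<^sub>R v s) * norm (u s)"
        by (rule Cauchy_Schwarz_ineq2)
      also have "\<dots> \<le> (m / 4 * \<bar>s' - s\<bar>) * norm (u s)" using chord[OF s] by (intro mult_right_mono) auto
      finally have 1: "\<bar>(\<gamma> s' - \<gamma> s - (s' - s) *\<^sub>R v s) \<bullet> u s\<bar> \<le> (m / 4 * \<bar>s' - s\<bar>) * norm (u s)" .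
      have "\<bar>(y' *\<^sub>R (\<i> * (u s' - u s))) \<bullet> u s\<bar> \<le> norm (y' *\<^sub>R (\<i> * (u s' - u s))) * norm (u s)"
        by (rule Cauchy_Schwarz_ineq2)
      also have "\<dots> = \<bar>y'\<bar> * norm (u s' - u s) * norm (u s)" by (simp add: norm_mult)
      also have "\<dots> \<le> \<bar>y'\<bar> * (2 * M / h * \<bar>s' - s\<bar>) * norm (u s)"
        by (intro mult_right_mono mult_left_mono lipu) auto
      also have "\<dots> = (\<bar>y'\<bar> * (2 * M / h)) * \<bar>s' - s\<bar> * norm (u s)" by simp
      also have "\<dots> \<le> m / 5 * \<bar>s' - s\<bar> * norm (u s)" using yb by (intro mult_right_mono) auto
      finally have 2: "\<bar>(y' *\<^sub>R (\<i> * (u s' - u s))) \<bullet> u s\<bar> \<le> m / 5 * \<bar>s' - s\<bar> * norm (u s)" .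
      have "\<bar>s' - s\<bar> * (v s \<bullet> u s) = \<bar>(s' - s) * (v s \<bullet> u s)\<bar>"
        using vu[of s] by (simp add: abs_mult) (smt (verit) zero_le_power2)
      also have "\<dots> \<le> \<bar>s' - s\<bar> * ((m / 4 + m / 5) * norm (u s))"
      proof -
        have "\<bar>(s' - s) * (v s \<bullet> u s)\<bar> \<le> m / 4 * \<bar>s' - s\<bar> * norm (u s) + m / 5 * \<bar>s' - s\<bar> * norm (u s)"
          unfolding eq0 using 1 2 by linarith
        then show ?thesis by (simp add: algebra_simps)
      qed
      finally have "v s \<bullet> u s \<le> (m / 4 + m / 5) * norm (u s)"
        using ne by (simp add: mult_le_cancel_left)
      also have "\<dots> \<le> (9/20 * norm (v s)) * (5/4 * norm (v s))"
        using nu[of s] m(2)[of s] m(1) by (intro mult_mono) auto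
      also have "\<dots> = 9/16 * (norm (v s))\<^sup>2" by (simp add: power2_eq_square)
      finally have "(norm (v s))\<^sup>2 \<le> 0" using vu[of s] by linarith
      then show False using nz[of s] by simp
    qed
    have "u s \<noteq> 0" using vu[of s] nz[of s] by (auto)
    then show "s = s' \<and> y = y'" using eq ss by simp
  qed (use b d peru in auto)
qed

text \<open>Strip coordinates are packed into one complex number: the real part runs along the
  strand, the imaginary part across it (to the left, by the sign of the determinant required in
  \<open>diag\<close>).\<close>

definition ptube :: "('i \<Rightarrow> real \<Rightarrow> complex \<times> real) \<Rightarrow> ('i \<Rightarrow> real \<Rightarrow> complex) \<Rightarrow> 'i \<Rightarrow> complex \<Rightarrow> complex"
  where "ptube D nn i q = fst (D i (Re q)) + of_real (Im q) * nn i (Re q)"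

text \<open>The strip is thickened vertically, so that \<open>fst\<close> maps the tube to the
  planar strip and over and under can be read off the last coordinate.\<close>

definition tube :: "('i \<Rightarrow> real \<Rightarrow> complex \<times> real) \<Rightarrow> ('i \<Rightarrow> real \<Rightarrow> complex) \<Rightarrow> 'i \<Rightarrow> complex \<times> real \<Rightarrow> complex \<times> real"
  where "tube D nn i p = (ptube D nn i (fst p), snd (D i (Re (fst p))) + snd p)"

definition link_of :: "'i set \<Rightarrow> ('i \<Rightarrow> real \<Rightarrow> complex \<times> real) \<Rightarrow> (complex \<times> real) set"
  where "link_of I D = (\<Union>i\<in>I. range (D i))"

text \<open>A diagram with one tube size for all strands. Injectivity in space is global up to
  periods; in the plane it holds only for nearby parameters, because strands cross there.\<close>

locale diag =
  fixes I :: "'i set" and D :: "'i \<Rightarrow> real \<Rightarrow> complex \<times> real" and nn :: "'i \<Rightarrow> real \<Rightarrow> complex" and b \<delta> :: real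
  assumes link: "link_diagram I D"
    and b: "b > 0" and \<delta>: "\<delta> > 0" "\<delta> \<le> 1/2"
    and nn_cont: "\<And>i. i \<in> I \<Longrightarrow> continuous_on UNIV (nn i)"
    and nn_per: "\<And>i s. i \<in> I \<Longrightarrow> nn i (s + 1) = nn i s"
    and nn_det: "\<And>i s. i \<in> I \<Longrightarrow> plane_det (plane_velocity D i s) (nn i s) > 0"
    and ptube_inj: "\<And>i q q'. i \<in> I \<Longrightarrow> \<bar>Re q - Re q'\<bar> < \<delta> \<Longrightarrow> \<bar>Im q\<bar> < b \<Longrightarrow> \<bar>Im q'\<bar> < b \<Longrightarrow>
         ptube D nn i q = ptube D nn i q' \<Longrightarrow> q = q'"
    and tube_inj: "\<And>i j p p'. i \<in> I \<Longrightarrow> j \<in> I \<Longrightarrow> \<bar>Im (fst p)\<bar> < b \<Longrightarrow> \<bar>snd p\<bar> < b \<Longrightarrow>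
         \<bar>Im (fst p')\<bar> < b \<Longrightarrow> \<bar>snd p'\<bar> < b \<Longrightarrow> tube D nn i p = tube D nn j p' \<Longrightarrow>
         i = j \<and> Re (fst p) - Re (fst p') \<in> \<int> \<and> Im (fst p) = Im (fst p') \<and> snd p = snd p'"

lemma link_diagramD:
  assumes "link_diagram I D"
  shows "finite I"
    and "i \<in> I \<Longrightarrow> D i (t + 1) = D i t"
    and "i \<in> I \<Longrightarrow> (D i has_vector_derivative vector_derivative (D i) (at t)) (at t)"
    and "i \<in> I \<Longrightarrow> continuous_on UNIV (D i)"
    and "i \<in> I \<Longrightarrow> ((\<lambda>t. fst (D i t)) has_vector_derivative plane_velocity D i t) (at t)"
    and "i \<in> I \<Longrightarrow> continuous_on UNIV (plane_velocity D i)"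
    and "i \<in> I \<Longrightarrow> plane_velocity D i t \<noteq> 0"
    and "i \<in> I \<Longrightarrow> j \<in> I \<Longrightarrow> D i s = D j t \<Longrightarrow> i = j"
    and "i \<in> I \<Longrightarrow> D i s = D i t \<Longrightarrow> s - t \<in> \<int>"
proof -
  show "finite I" using assms by (simp add: link_diagram_def)
  show "i \<in> I \<Longrightarrow> D i (t + 1) = D i t" using assms by (simp add: link_diagram_def)
  have C1: "i \<in> I \<Longrightarrow> D i C1_differentiable_on UNIV" using assms by (simp add: link_diagram_def)
  show d: "i \<in> I \<Longrightarrow> (D i has_vector_derivative vector_derivative (D i) (at t)) (at t)" for t
    using C1 by (simp add: C1_differentiable_on_eq vector_derivative_works)
  then show "i \<in> I \<Longrightarrow> continuous_on UNIV (D i)"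
    by (meson continuous_at_imp_continuous_on has_vector_derivative_continuous)
  show "i \<in> I \<Longrightarrow> ((\<lambda>t. fst (D i t)) has_vector_derivative plane_velocity D i t) (at t)"
    unfolding plane_velocity_def using bounded_linear.has_vector_derivative[OF bounded_linear_fst d[of t]] by simp
  show "i \<in> I \<Longrightarrow> continuous_on UNIV (plane_velocity D i)"
    unfolding plane_velocity_def using C1 by (intro continuous_on_fst) (simp add: C1_differentiable_on_eq)
  show "i \<in> I \<Longrightarrow> plane_velocity D i t \<noteq> 0" using assms by (simp add: link_diagram_def)
  show "i \<in> I \<Longrightarrow> j \<in> I \<Longrightarrow> D i s = D j t \<Longrightarrow> i = j" using assms unfolding link_diagram_def by blast
  show "i \<in> I \<Longrightarrow> D i s = D i t \<Longrightarrow> s - t \<in> \<int>" using assms unfolding link_diagram_def by blast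
qed

lemma finite_uniform_pos:
  fixes Q :: "'a \<Rightarrow> real \<Rightarrow> bool"
  assumes "finite A" and "\<And>x. x \<in> A \<Longrightarrow> \<exists>e>0. Q x e" and down: "\<And>x e e'. Q x e \<Longrightarrow> 0 < e' \<Longrightarrow> e' \<le> e \<Longrightarrow> Q x e'"
  shows "\<exists>e>0. \<forall>x\<in>A. Q x e"
  using assms(1,2)
proof (induction A rule: finite_induct)
  case empty
  then show ?case by (auto intro: exI[of _ 1])
next
  case (insert x A)
  then obtain e1 e2 where e: "e1 > 0" "Q x e1" "e2 > 0" "\<forall>x\<in>A. Q x e2" by (meson insertCI)
  have "Q y (min e1 e2)" if "y \<in> insert x A" for y
  proof (cases "y = x")
    case True
    show ?thesis by (rule down[of y e1]) (use e True in auto)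
  next
    case False
    show ?thesis by (rule down[of y e2]) (use e that False in auto)
  qed
  then show ?case using e by (intro exI[of _ "min e1 e2"]) auto
qed

text \<open>Parameter pairs on different strands, or at distance at least \<open>d\<close> modulo
  periods, form a compact set on which the curves keep a distance \<open>\<mu>\<close> in space;
  thin tubes cannot bridge it. The remaining pairs are settled by injectivity in the plane.\<close>

lemma tube_separation:
  assumes link: "link_diagram I D" and i: "i \<in> I" and j: "j \<in> I" and d: "d > 0"
    and nn: "\<And>i. i \<in> I \<Longrightarrow> continuous_on UNIV (nn i)" "\<And>i s. i \<in> I \<Longrightarrow> nn i (s + 1) = nn i s"
    and inj: "\<And>q q'. \<bar>Re q - Re q'\<bar> < d \<Longrightarrow> \<bar>Im q\<bar> < b1 \<Longrightarrow> \<bar>Im q'\<bar> < b1 \<Longrightarrow>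
         ptube D nn i q = ptube D nn i q' \<Longrightarrow> q = q'" and b1: "b1 > 0"
  shows "\<exists>b>0. \<forall>p p'. \<bar>Im (fst p)\<bar> < b \<longrightarrow> \<bar>snd p\<bar> < b \<longrightarrow>
         \<bar>Im (fst p')\<bar> < b \<longrightarrow> \<bar>snd p'\<bar> < b \<longrightarrow> tube D nn i p = tube D nn j p' \<longrightarrow>
         i = j \<and> Re (fst p) - Re (fst p') \<in> \<int> \<and> Im (fst p) = Im (fst p') \<and> snd p = snd p'"
proof -
  note L = link_diagramD[OF link]
  obtain N1 where N1: "N1 > 0" "\<And>t. norm (nn i t) \<le> N1" using periodic_bounded[OF nn(2)[OF i] nn(1)[OF i]] by blast
  obtain N2 where N2: "N2 > 0" "\<And>t. norm (nn j t) \<le> N2" using periodic_bounded[OF nn(2)[OF j] nn(1)[OF j]] by blast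
  \<comment> \<open>Periodicity allows the first parameter to be taken in the unit interval and the
    difference to be at most \<open>1/2\<close>, which puts the second one into
    \<open>{-1..2}\<close>.\<close>
  define K where "K = ({0..1} \<times> {-1..2}) \<inter> {x. i \<noteq> j \<or> (d \<le> \<bar>fst x - snd x\<bar> \<and> \<bar>fst x - snd x\<bar> \<le> 1/2)}"
  have "closed {x::real \<times> real. i \<noteq> j \<or> (d \<le> \<bar>fst x - snd x\<bar> \<and> \<bar>fst x - snd x\<bar> \<le> 1/2)}"
    by (intro closed_Collect_disj closed_Collect_conj closed_Collect_const closed_Collect_le continuous_intros)
  then have "compact K" unfolding K_def by (intro compact_Int_closed compact_Times) auto
  moreover have "continuous_on K (\<lambda>x. D i (fst x) - D j (snd x))"
    by (intro continuous_intros continuous_on_compose2[OF L(4)[OF i]] continuous_on_compose2[OF L(4)[OF j]]) auto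
  ultimately have "closed ((\<lambda>x. D i (fst x) - D j (snd x)) ` K)"
    by (intro compact_imp_closed compact_continuous_image)
  moreover have "0 \<notin> (\<lambda>x. D i (fst x) - D j (snd x)) ` K"
  proof
    assume "0 \<in> (\<lambda>x. D i (fst x) - D j (snd x)) ` K"
    then obtain x where x: "x \<in> K" "D i (fst x) = D j (snd x)" by auto
    then have ij: "i = j" using L(8) i j by blast
    with x have "fst x - snd x \<in> \<int>" using L(9) i by blast
    then obtain k where k: "fst x - snd x = of_int k" by (elim Ints_cases)
    have "d \<le> \<bar>fst x - snd x\<bar>" "\<bar>fst x - snd x\<bar> \<le> 1/2" using x ij by (auto simp: K_def)
    then have "k = 0" unfolding k by linarith
    then show False using k \<open>d \<le> \<bar>fst x - snd x\<bar>\<close> d by simp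
  qed
  ultimately obtain \<mu> where \<mu>: "\<mu> > 0" "\<And>x. x \<in> K \<Longrightarrow> \<mu> \<le> norm (D i (fst x) - D j (snd x))"
    using separate_point_closed by (metis (no_types, lifting) dist_0_norm imageI)
  define B where "B = min b1 (\<mu> / (2 * (N1 + N2 + 2)))"
  have B: "B > 0" "B \<le> b1" using b1 \<mu> N1 N2 by (auto simp: B_def)
  have Bmu: "B * (N1 + N2 + 2) < \<mu>"
  proof -
    have "B * (N1 + N2 + 2) \<le> \<mu> / (2 * (N1 + N2 + 2)) * (N1 + N2 + 2)"
      using N1 N2 by (intro mult_right_mono) (auto simp: B_def)
    also have "\<dots> = \<mu> / 2" using N1 N2 by (simp add: field_simps)
    finally show ?thesis using \<mu> by simp
  qed
  show ?thesis
  proof (intro exI[of _ B] conjI allI impI)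
    show "B > 0" by (rule B)
    fix p p' :: "complex \<times> real"
    assume p: "\<bar>Im (fst p)\<bar> < B" "\<bar>snd p\<bar> < B" "\<bar>Im (fst p')\<bar> < B" "\<bar>snd p'\<bar> < B"
      and eq: "tube D nn i p = tube D nn j p'"
    define s where "s = Re (fst p) + of_int (- \<lfloor>Re (fst p)\<rfloor>)"
    define l where "l = - round (Re (fst p') - s)"
    define s' where "s' = Re (fst p') + of_int l"
    have s01: "s \<in> {0..1}" unfolding s_def by (auto; linarith)
    have ss: "\<bar>s - s'\<bar> \<le> 1/2" unfolding s'_def l_def
      using of_int_round_abs_le[of "Re (fst p') - s"] by (simp add: abs_if split: if_splits)
    then have s'12: "s' \<in> {-1..2}" using s01 by (auto simp: abs_if split: if_splits)
    have Ds: "D i s = D i (Re (fst p))" "nn i s = nn i (Re (fst p))"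
      unfolding s_def using periodic_shift[of "D i", OF L(2)[OF i]] periodic_shift[of "nn i", OF nn(2)[OF i]] by blast+
    have Ds': "D j s' = D j (Re (fst p'))" "nn j s' = nn j (Re (fst p'))"
      unfolding s'_def using periodic_shift[of "D j", OF L(2)[OF j]] periodic_shift[of "nn j", OF nn(2)[OF j]] by blast+
    have diff: "D i s - D j s' = (of_real (Im (fst p')) * nn j s', snd p') - (of_real (Im (fst p)) * nn i s, snd p)"
      using eq unfolding tube_def ptube_def Ds Ds' by (auto simp: prod_eq_iff algebra_simps)
    have nb: "norm (of_real y * w, z) \<le> B * (N + 1)" if "\<bar>y\<bar> < B" "\<bar>z\<bar> < B" "norm w \<le> N" for y z :: real and w :: complex and N
    proof -
      have "norm (of_real y * w, z) \<le> norm (of_real y * w) + norm z" by (rule norm_Pair_le)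
      also have "\<dots> = \<bar>y\<bar> * norm w + \<bar>z\<bar>" by (simp add: norm_mult)
      also have "\<dots> \<le> B * N + B" using that B by (intro add_mono mult_mono) auto
      finally show ?thesis by (simp add: algebra_simps)
    qed
    have "norm (D i s - D j s') \<le> B * (N2 + 1) + B * (N1 + 1)"
      unfolding diff using p N1 N2
      by (intro order.trans[OF norm_triangle_ineq4] add_mono nb) auto
    also have "\<dots> = B * (N1 + N2 + 2)" by (simp add: algebra_simps)
    finally have "norm (D i s - D j s') < \<mu>" using Bmu by linarith
    then have "(s, s') \<notin> K" using \<mu>(2)[of "(s, s')"] by auto
    then have ij: "i = j" and ssd: "\<bar>s - s'\<bar> < d" using s01 s'12 ss unfolding K_def by auto
    have "fst (tube D nn i p) = fst (tube D nn j p')" using eq by simp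
    then have "ptube D nn i (Complex s (Im (fst p))) = ptube D nn i (Complex s' (Im (fst p')))"
      using Ds Ds' ij by (simp add: tube_def ptube_def)
    from inj[OF _ _ _ this] ssd p B have q: "s = s'" "Im (fst p) = Im (fst p')" by auto
    have "snd (tube D nn i p) = snd (tube D nn j p')" using eq by simp
    then have "snd p = snd p'" using Ds Ds' ij q by (simp add: tube_def)
    moreover have "Re (fst p) - Re (fst p') = of_int (\<lfloor>Re (fst p)\<rfloor> + l)" using q(1) by (simp add: s_def s'_def)
    ultimately show "i = j" "Re (fst p) - Re (fst p') \<in> \<int>" "Im (fst p) = Im (fst p')" "snd p = snd p'"
      using ij q by (auto simp del: of_int_add)
  qed
qed

lemma diag_exists:
  assumes link: "link_diagram I D"
  shows "\<exists>nn b \<delta>. diag I D nn b \<delta>"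
proof -
  note L = link_diagramD[OF link]
  define P where "P i x \<longleftrightarrow> (case x of (n, b, d) \<Rightarrow> b > 0 \<and> d > 0 \<and> continuous_on UNIV n \<and> (\<forall>t. n (t + 1) = n t) \<and>
      (\<forall>t. plane_det (plane_velocity D i t) (n t) > 0) \<and>
      (\<forall>s s' y y'. \<bar>s - s'\<bar> < d \<longrightarrow> \<bar>y\<bar> < b \<longrightarrow> \<bar>y'\<bar> < b \<longrightarrow>
        fst (D i s) + of_real y * n s = fst (D i s') + of_real y' * n s' \<longrightarrow> s = s' \<and> y = y'))"
    for i and x :: "(real \<Rightarrow> complex) \<times> real \<times> real"
  have "\<exists>x. P i x" if i: "i \<in> I" for i
  proof -
    have per: "fst (D i (t + 1)) = fst (D i t)" for t using L(2)[OF i] by simp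
    obtain n b d where "b > 0" "d > 0" "continuous_on UNIV n" "\<And>t. n (t + 1) = n t"
      "\<And>t. plane_det (plane_velocity D i t) (n t) > 0"
      "\<And>s s' y y'. \<bar>s - s'\<bar> < d \<Longrightarrow> \<bar>y\<bar> < b \<Longrightarrow> \<bar>y'\<bar> < b \<Longrightarrow>
        fst (D i s) + of_real y * n s = fst (D i s') + of_real y' * n s' \<Longrightarrow> s = s' \<and> y = y'"
      by (rule planar_tube[of "\<lambda>t. fst (D i t)" "plane_velocity D i", OF per L(5)[OF i] L(6)[OF i] L(7)[OF i]]) blast
    then have "P i (n, b, d)" unfolding P_def prod.case by (intro conjI allI impI) auto
    then show ?thesis by blast
  qed
  then obtain f where "\<And>i. i \<in> I \<Longrightarrow> P i (f i)" by metis
  moreover define nn b1 d1 where "nn i = fst (f i)" and "b1 i = fst (snd (f i))" and "d1 i = snd (snd (f i))" for i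
  ultimately have P: "P i (nn i, b1 i, d1 i)" if "i \<in> I" for i using that by simp
  have N: "\<And>i. i \<in> I \<Longrightarrow> b1 i > 0" "\<And>i. i \<in> I \<Longrightarrow> d1 i > 0" "\<And>i. i \<in> I \<Longrightarrow> continuous_on UNIV (nn i)"
    "\<And>i t. i \<in> I \<Longrightarrow> nn i (t + 1) = nn i t" "\<And>i t. i \<in> I \<Longrightarrow> plane_det (plane_velocity D i t) (nn i t) > 0"
    using P unfolding P_def by simp_all
  have inj: "s = s' \<and> y = y'" if "i \<in> I" "\<bar>s - s'\<bar> < d1 i" "\<bar>y\<bar> < b1 i" "\<bar>y'\<bar> < b1 i"
        "fst (D i s) + of_real y * nn i s = fst (D i s') + of_real y' * nn i s'" for i s s' y y'
    using P[OF that(1)] that(2-) unfolding P_def by simp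
  have min_pos: "\<exists>e>0. \<forall>i\<in>I. e \<le> f i" if "\<And>i. i \<in> I \<Longrightarrow> 0 < f i" for f :: "'a \<Rightarrow> real"
  proof (rule finite_uniform_pos[OF L(1)])
    show "\<exists>e>0. e \<le> f i" if "i \<in> I" for i using \<open>\<And>i. i \<in> I \<Longrightarrow> 0 < f i\<close>[OF that] by blast
  qed auto
  obtain e1 where e1: "e1 > 0" "\<And>i. i \<in> I \<Longrightarrow> e1 \<le> d1 i" using min_pos[of d1, OF N(2)] by blast
  obtain e2 where e2: "e2 > 0" "\<And>i. i \<in> I \<Longrightarrow> e2 \<le> b1 i" using min_pos[of b1, OF N(1)] by blast
  define d where "d = min e1 (1/2)"
  have pinj: "q = q'" if "i \<in> I" "\<bar>Re q - Re q'\<bar> < d" "\<bar>Im q\<bar> < e2" "\<bar>Im q'\<bar> < e2" "ptube D nn i q = ptube D nn i q'" for i q q'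
    using inj[of i "Re q" "Re q'" "Im q" "Im q'"] that e1(2)[of i] e2(2)[of i] by (auto simp: ptube_def d_def complex_eq_iff)
  have d: "d > 0" using e1 by (simp add: d_def)
  define Q where "Q x e \<longleftrightarrow> (\<forall>p p'. \<bar>Im (fst p)\<bar> < e \<longrightarrow> \<bar>snd p\<bar> < e \<longrightarrow>
         \<bar>Im (fst p')\<bar> < e \<longrightarrow> \<bar>snd p'\<bar> < e \<longrightarrow> tube D nn (fst x) p = tube D nn (snd x) p' \<longrightarrow>
         fst x = snd x \<and> Re (fst p) - Re (fst p') \<in> \<int> \<and> Im (fst p) = Im (fst p') \<and> snd p = snd p')" for x e
  have "\<exists>e>0. \<forall>x\<in>I \<times> I. Q x e"
  proof (rule finite_uniform_pos)
    show "finite (I \<times> I)" using L(1) by simp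
    show "\<exists>e>0. Q x e" if "x \<in> I \<times> I" for x
      unfolding Q_def using that by (intro tube_separation[OF link _ _ d N(3,4) pinj e2(1)]) auto
    show "Q x e'" if "Q x e" "0 < e'" "e' \<le> e" for x e e'
      unfolding Q_def
    proof (intro allI impI)
      fix p p'
      assume *: "\<bar>Im (fst p)\<bar> < e'" "\<bar>snd p\<bar> < e'" "\<bar>Im (fst p')\<bar> < e'" "\<bar>snd p'\<bar> < e'"
        "tube D nn (fst x) p = tube D nn (snd x) p'"
      show "fst x = snd x \<and> Re (fst p) - Re (fst p') \<in> \<int> \<and> Im (fst p) = Im (fst p') \<and> snd p = snd p'"
        by (rule that(1)[unfolded Q_def, rule_format]) (use * that in auto)
    qed
  qed
  then obtain e3 where e3: "e3 > 0" "\<And>x. x \<in> I \<times> I \<Longrightarrow> Q x e3" by blast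
  have "diag I D nn (min e2 e3) d"
  proof
    show "i = j \<and> Re (fst p) - Re (fst p') \<in> \<int> \<and> Im (fst p) = Im (fst p') \<and> snd p = snd p'"
      if "i \<in> I" "j \<in> I" "\<bar>Im (fst p)\<bar> < min e2 e3" "\<bar>snd p\<bar> < min e2 e3" "\<bar>Im (fst p')\<bar> < min e2 e3"
        "\<bar>snd p'\<bar> < min e2 e3" "tube D nn i p = tube D nn j p'" for i j p p'
    proof -
      have "Q (i, j) e3" using e3(2) that by simp
      from this[unfolded Q_def fst_conv snd_conv, rule_format, OF _ _ _ _ that(7)] that show ?thesis by simp
    qed
    show "q = q'" if "i \<in> I" "\<bar>Re q - Re q'\<bar> < d" "\<bar>Im q\<bar> < min e2 e3" "\<bar>Im q'\<bar> < min e2 e3"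
        "ptube D nn i q = ptube D nn i q'" for i q q'
      by (rule pinj[OF that(1,2)]) (use that in auto)
    show "0 < min e2 e3" using e2 e3 by simp
    show "d > 0" "d \<le> 1/2" using d by (simp_all add: d_def)
  qed (fact link N)+
  then show ?thesis by blast
qed

section \<open>Regions of the link complement\<close>

text \<open>What an eye at infinite height sees in front of \<open>C\<close>. For the whole link
  this is the domain of the reference section.\<close>

definition overhead :: "(complex \<times> real) set \<Rightarrow> (complex \<times> real) set"
  where "overhead C = {p. \<forall>q\<in>C. fst q = fst p \<longrightarrow> snd q < snd p}"

text \<open>The complement is the sum of \<open>C\<close> and a closed downward ray, compact plus
  closed.\<close>

lemma open_overhead:
  assumes "compact C"
  shows "open (overhead C)"
proof -
  have "closed (\<Union>x\<in>C. \<Union>y\<in>{0} \<times> {..0::real}. {x + y})"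
    using assms by (intro compact_closed_sums) (auto intro: closed_Times)
  moreover have "(\<Union>x\<in>C. \<Union>y\<in>{0} \<times> {..0::real}. {x + y}) = - overhead C"
  proof (intro equalityI subsetI)
    fix p assume "p \<in> - overhead C"
    then obtain q where q: "q \<in> C" "fst q = fst p" "snd p \<le> snd q" by (auto simp: overhead_def not_less)
    then have "p = q + (0, snd p - snd q)" by (simp add: prod_eq_iff)
    moreover have "(0, snd p - snd q) \<in> {0::complex} \<times> {..0}" using q by simp
    ultimately show "p \<in> (\<Union>x\<in>C. \<Union>y\<in>{0} \<times> {..0}. {x + y})" using q(1) by blast
  qed (force simp: overhead_def not_less)
  ultimately show ?thesis by (simp add: closed_open)
qed

text \<open>Moving vertically to the height \<open>h\<close>, which clears all of \<open>C\<close>,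
  never leaves the region, and at that height the region is a copy of \<open>U\<close>.\<close>

lemma contractible_overhead:
  assumes U: "contractible U" and J: "convex J" and h: "h \<in> J" and C: "\<And>q. q \<in> C \<Longrightarrow> snd q < h"
  shows "contractible (overhead C \<inter> (U \<times> J))"
proof -
  let ?S = "overhead C \<inter> (U \<times> J)"
  have lin: "homotopic_with_canon (\<lambda>x. True) ?S ?S id (\<lambda>p. (fst p, h))"
  proof (rule homotopic_with_linear)
    fix p assume p: "p \<in> ?S"
    show "closed_segment (id p) (fst p, h) \<subseteq> ?S"
    proof
      fix x assume "x \<in> closed_segment (id p) (fst p, h)"
      then obtain u where u: "0 \<le> u" "u \<le> 1" and x: "x = (1 - u) *\<^sub>R p + u *\<^sub>R (fst p, h)"
        by (auto simp: closed_segment_def)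
      have f: "fst x = fst p" unfolding x by (simp add: scaleR_conv_of_real algebra_simps)
      have s: "snd x = (1 - u) * snd p + u * h" unfolding x by simp
      have "snd x \<in> J" unfolding s using J h p u convexD[of J "snd p" h "1 - u" u] by auto
      moreover have "snd q < snd x" if "q \<in> C" "fst q = fst x" for q
      proof -
        have "snd q < snd p" "snd q < h" using that p f C by (auto simp: overhead_def)
        then show ?thesis unfolding s using u convex_bound_lt[of "- snd p" "- snd q" "- h" "1 - u" u] by simp
      qed
      ultimately show "x \<in> ?S" using p f by (auto simp: overhead_def mem_Times_iff)
    qed
  qed (intro continuous_intros)+
  obtain c where "homotopic_with_canon (\<lambda>x. True) ?S ?S ((\<lambda>w. (w, h)) \<circ> fst) (\<lambda>x. c)"
  proof (rule nullhomotopic_through_contractible[where T=U])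
    show "fst \<in> ?S \<rightarrow> U" by auto
    show "(\<lambda>w. (w, h)) \<in> U \<rightarrow> ?S" using h C by (auto simp: overhead_def)
    show "continuous_on ?S fst" "continuous_on U (\<lambda>w. (w, h))" by (intro continuous_intros)+
  qed (rule U)
  then have "homotopic_with_canon (\<lambda>x. True) ?S ?S (\<lambda>p. (fst p, h)) (\<lambda>x. c)" by (simp add: o_def)
  with lin have "homotopic_with_canon (\<lambda>x. True) ?S ?S id (\<lambda>x. c)" by (rule homotopic_with_trans)
  then show ?thesis unfolding contractible_def by blast
qed

section \<open>Boxes in tube coordinates and their two simply connected parts\<close>

definition bx :: "real \<Rightarrow> real \<Rightarrow> (complex \<times> real) set"
  where "bx s a = {p. \<bar>Re (fst p) - s\<bar> < a \<and> \<bar>Im (fst p)\<bar> < a \<and> \<bar>snd p\<bar> < a}"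

definition rect :: "real \<Rightarrow> real \<Rightarrow> complex set"
  where "rect s a = {q. \<bar>Re q - s\<bar> < a \<and> \<bar>Im q\<bar> < a}"

text \<open>In tube coordinates these are the complements of the curtains that hang down from the strand and
  stand up on it.\<close>

definition upper :: "(complex \<times> real) set"
  where "upper = {p. \<not> (Im (fst p) = 0 \<and> snd p \<le> 0)}"

definition lower :: "(complex \<times> real) set"
  where "lower = {p. \<not> (Im (fst p) = 0 \<and> snd p \<ge> 0)}"

lemma bx_mono: "\<bar>s' - s\<bar> + a' \<le> a \<Longrightarrow> bx s' a' \<subseteq> bx s a"
  by (auto simp: bx_def)

lemma open_bx: "open (bx s a)"
  unfolding bx_def by (intro open_Collect_conj open_Collect_less continuous_intros)

lemma open_rect: "open (rect s a)"
  unfolding rect_def by (intro open_Collect_conj open_Collect_less continuous_intros)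

lemma convex_abs_less:
  fixes f :: "'a::real_vector \<Rightarrow> real"
  assumes "linear f"
  shows "convex {x. \<bar>f x - s\<bar> < a}"
proof -
  have "convex (f -` {s - a<..<s + a})" by (intro convex_linear_vimage assms convex_real_interval)
  also have "f -` {s - a<..<s + a} = {x. \<bar>f x - s\<bar> < a}" by (auto simp: abs_less_iff)
  finally show ?thesis .
qed

lemma linear_coords: "linear (\<lambda>p::complex \<times> real. Re (fst p))" "linear (\<lambda>p::complex \<times> real. Im (fst p))"
  "linear (snd :: complex \<times> real \<Rightarrow> real)" "linear Re" "linear Im"
  by (auto intro!: linearI)

lemma convex_bx: "convex (bx s a)"
proof -
  have "bx s a = {p. \<bar>Re (fst p) - s\<bar> < a} \<inter> ({p. \<bar>Im (fst p) - 0\<bar> < a} \<inter> {p. \<bar>snd p - 0\<bar> < a})"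
    by (auto simp: bx_def)
  then show ?thesis by (simp only: convex_Int convex_abs_less linear_coords)
qed

lemma convex_rect: "convex (rect s a)"
proof -
  have "rect s a = {p. \<bar>Re p - s\<bar> < a} \<inter> {p. \<bar>Im p - 0\<bar> < a}" by (auto simp: rect_def)
  then show ?thesis by (simp only: convex_Int convex_abs_less linear_coords)
qed

lemma convex_half:
  fixes f :: "'a::real_vector \<Rightarrow> real"
  assumes "linear f"
  shows "convex {x. f x < 0}" "convex {x. 0 < f x}" 
  using convex_linear_vimage[OF assms, of "{..<0}"] convex_linear_vimage[OF assms, of "{0<..}"]
  by (auto simp: vimage_def)

lemma convex_bx_half: "convex (bx s a \<inter> {p. Im (fst p) < 0})" "convex (bx s a \<inter> {p. 0 < Im (fst p)})"
  by (intro convex_Int convex_bx convex_half linear_coords)+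

lemma convex_rect_half: "convex (rect s a \<inter> {p. Im p < 0})" "convex (rect s a \<inter> {p. 0 < Im p})"
  by (intro convex_Int convex_rect convex_half linear_coords)+

text \<open>The box without the hanging curtain is starlike about a point straight above the
  strand.\<close>

lemma contractible_bx_upper:
  assumes a: "a > 0" shows "contractible (bx s a \<inter> upper)"
proof (rule starlike_imp_contractible)
  let ?q = "(Complex s 0, a / 2)"
  have q: "?q \<in> bx s a" using a by (simp add: bx_def)
  show "starlike (bx s a \<inter> upper)" unfolding starlike_def
  proof (intro bexI[of _ ?q] ballI subsetI)
    show "?q \<in> bx s a \<inter> upper" using a q by (simp add: upper_def)
    fix p x assume p: "p \<in> bx s a \<inter> upper" and x: "x \<in> closed_segment ?q p"
    have "x \<in> bx s a" using x p q convex_bx[of s a] by (auto simp: convex_contains_segment)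
    moreover obtain u where u: "0 \<le> u" "u \<le> 1" and xu: "x = (1 - u) *\<^sub>R ?q + u *\<^sub>R p"
      using x by (auto simp: closed_segment_def)
    have "x \<in> upper"
    proof (cases "Im (fst p) = 0")
      case True
      then have "snd p > 0" using p by (auto simp: upper_def)
      then have "(1 - u) * (a / 2) + u * snd p > 0"
        using u a by (cases "u = 0") (auto intro: add_nonneg_pos)
      then show ?thesis unfolding xu upper_def by simp
    next
      case False
      then show ?thesis unfolding xu upper_def using a by simp
    qed
    ultimately show "x \<in> bx s a \<inter> upper" by simp
  qed
qed

lemma contractible_bx_lower:
  assumes a: "a > 0" shows "contractible (bx s a \<inter> lower)"
proof (rule starlike_imp_contractible)
  let ?q = "(Complex s 0, - a / 2)"
  have q: "?q \<in> bx s a" using a by (simp add: bx_def)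
  show "starlike (bx s a \<inter> lower)" unfolding starlike_def
  proof (intro bexI[of _ ?q] ballI subsetI)
    show "?q \<in> bx s a \<inter> lower" using a q by (simp add: lower_def)
    fix p x assume p: "p \<in> bx s a \<inter> lower" and x: "x \<in> closed_segment ?q p"
    have "x \<in> bx s a" using x p q convex_bx[of s a] by (auto simp: convex_contains_segment)
    moreover obtain u where u: "0 \<le> u" "u \<le> 1" and xu: "x = (1 - u) *\<^sub>R ?q + u *\<^sub>R p"
      using x by (auto simp: closed_segment_def)
    have "x \<in> lower"
    proof (cases "Im (fst p) = 0")
      case True
      then have sp: "- snd p > 0" using p by (auto simp: lower_def)
      have "(1 - u) * (a / 2) + u * (- snd p) > 0"
      proof (cases "u = 0")
        case False
        then have "u * (- snd p) > 0" "(1 - u) * (a / 2) \<ge> 0" using u sp a by (intro mult_pos_pos mult_nonneg_nonneg; simp)+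
        then show ?thesis by linarith
      qed (use a in simp)
      then show ?thesis unfolding xu lower_def by simp
    next
      case False
      then show ?thesis unfolding xu lower_def using a by simp
    qed
    ultimately show "x \<in> bx s a \<inter> lower" by simp
  qed
qed

text \<open>Invariance of domain stands in for the inverse function theorem, as the tube maps are
  only known to be continuous and injective.\<close>

lemma inverse_tendsto:
  fixes f :: "'a::euclidean_space \<Rightarrow> 'a"
  assumes "open S" "continuous_on S f" "inj_on f S" "x \<in> S"
    and c: "(c \<longlongrightarrow> f x) F" and e: "a > 0"
  obtains g where "(g \<longlongrightarrow> x) F" "\<forall>\<^sub>F t in F. g t \<in> S \<and> f (g t) = c t"
proof -
  obtain h where h: "homeomorphism S (f ` S) f h"
    using invariance_of_domain_homeomorphism[OF assms(1,2) _ assms(3)] by auto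
  have op: "open (f ` S)" using assms by (intro invariance_of_domain)
  have "isCont h (f x)"
    using h op assms(4) by (auto simp: homeomorphism_def continuous_on_eq_continuous_at)
  then have "((\<lambda>t. h (c t)) \<longlongrightarrow> h (f x)) F" using c isCont_tendsto_compose by blast
  moreover have "h (f x) = x" using h assms(4) by (simp add: homeomorphism_def)
  moreover have "\<forall>\<^sub>F t in F. c t \<in> f ` S" using topological_tendstoD[OF c op] assms(4) by blast
  then have "\<forall>\<^sub>F t in F. h (c t) \<in> S \<and> f (h (c t)) = c t"
    by eventually_elim (use h in \<open>auto simp: homeomorphism_def\<close>)
  ultimately show thesis using that[of "\<lambda>t. h (c t)"] by simp
qed

lemma tendsto_plane_det:
  "(f \<longlongrightarrow> u) F \<Longrightarrow> (g \<longlongrightarrow> v) F \<Longrightarrow> ((\<lambda>t. plane_det (f t) (g t)) \<longlongrightarrow> plane_det u v) F"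
  unfolding plane_det_def by (intro tendsto_intros)

lemma has_vector_derivative_quotient:
  assumes "(f has_vector_derivative v) (at s)"
  shows "((\<lambda>r. (f r - f s) /\<^sub>R (r - s)) \<longlongrightarrow> v) (at s)"
proof -
  have "((\<lambda>r. norm ((f r - f s) - (r - s) *\<^sub>R v) / norm (r - s)) \<longlongrightarrow> 0) (at s)"
    using assms unfolding has_vector_derivative_def has_derivative_iff_norm by blast
  moreover have "\<forall>\<^sub>F r in at s. norm ((f r - f s) - (r - s) *\<^sub>R v) / norm (r - s) = norm ((f r - f s) /\<^sub>R (r - s) - v)"
    unfolding eventually_at_filter
  proof (intro always_eventually allI impI)
    fix r assume r: "r \<noteq> s"
    have "(f r - f s) /\<^sub>R (r - s) - v = ((f r - f s) - (r - s) *\<^sub>R v) /\<^sub>R (r - s)"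
      using r by (simp add: scaleR_diff_right)
    then show "norm ((f r - f s) - (r - s) *\<^sub>R v) / norm (r - s) = norm ((f r - f s) /\<^sub>R (r - s) - v)"
      by (simp add: divide_inverse_commute)
  qed
  ultimately have "((\<lambda>r. norm ((f r - f s) /\<^sub>R (r - s) - v)) \<longlongrightarrow> 0) (at s)"
    by (rule Lim_transform_eventually)
  then show ?thesis using tendsto_norm_zero_iff LIM_zero_cancel by blast
qed

context diag
begin

definition L :: "(complex \<times> real) set" where "L = link_of I D"

text \<open>Half of \<open>\<delta>\<close>, because two points of one box may differ along the
  strand by almost twice its radius.\<close>

definition rad :: real where "rad = min (\<delta> / 2) b"

lemma rad: "rad > 0" "rad \<le> \<delta> / 2" "rad \<le> b" "rad \<le> 1/4"
  using \<delta> b by (auto simp: rad_def)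

lemmas LD = link_diagramD[OF link]

lemma in_L: "p \<in> L \<longleftrightarrow> (\<exists>i\<in>I. \<exists>t. p = D i t)"
  by (auto simp: L_def link_of_def)

lemma compact_L: "compact L"
proof -
  have "compact (range (D i))" if "i \<in> I" for i
    unfolding periodic_range[of "D i", OF LD(2)[OF that]]
    using LD(4)[OF that] by (intro compact_continuous_image) (auto intro: continuous_on_subset)
  then show ?thesis unfolding L_def link_of_def using LD(1) by (intro compact_UN) auto
qed

abbreviation "Tb \<equiv> tube D nn"
abbreviation "Pt \<equiv> ptube D nn"

lemma Tb_center: "Tb i (Complex s 0, 0) = D i s"
  by (simp add: tube_def ptube_def)

lemma fst_Tb: "fst (Tb i p) = Pt i (fst p)"
  by (simp add: tube_def)

lemma continuous_on_Pt: "i \<in> I \<Longrightarrow> continuous_on S (Pt i)"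
  unfolding ptube_def
  by (intro continuous_intros continuous_on_compose2[OF LD(4)] continuous_on_compose2[OF nn_cont]) auto

lemma continuous_on_Tb: "i \<in> I \<Longrightarrow> continuous_on S (Tb i)"
  unfolding tube_def
  by (intro continuous_intros continuous_on_compose2[OF continuous_on_Pt] continuous_on_compose2[OF LD(4)]) auto

lemma Tb_shift: "i \<in> I \<Longrightarrow> Tb i (q + of_int k, z) = Tb i (q, z)"
  using periodic_shift[of "D i", OF LD(2)] periodic_shift[of "nn i", OF nn_per]
  by (simp add: tube_def ptube_def)

lemma inj_on_Pt: "i \<in> I \<Longrightarrow> inj_on (Pt i) (rect s rad)"
proof (rule inj_onI)
  fix q q' assume i: "i \<in> I" and q: "q \<in> rect s rad" "q' \<in> rect s rad" and eq: "Pt i q = Pt i q'"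
  have "\<bar>Re q - Re q'\<bar> < \<delta>" "\<bar>Im q\<bar> < b" "\<bar>Im q'\<bar> < b" using q rad by (auto simp: rect_def)
  from ptube_inj[OF i this eq] show "q = q'" .
qed

lemma inj_on_Tb: "i \<in> I \<Longrightarrow> inj_on (Tb i) (bx s rad)"
proof (rule inj_onI)
  fix p p' assume i: "i \<in> I" and p: "p \<in> bx s rad" "p' \<in> bx s rad" and eq: "Tb i p = Tb i p'"
  have "Pt i (fst p) = Pt i (fst p')" using eq by (metis fst_Tb)
  then have "fst p = fst p'"
    using inj_on_Pt[OF i, of s] p by (auto simp: inj_on_def bx_def rect_def)
  then show "p = p'" using eq by (simp add: tube_def prod_eq_iff)
qed

lemma open_Tb: "i \<in> I \<Longrightarrow> open S \<Longrightarrow> S \<subseteq> bx s rad \<Longrightarrow> open (Tb i ` S)"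
  by (intro invariance_of_domain continuous_on_Tb inj_on_subset[OF inj_on_Tb])

lemma open_Pt: "i \<in> I \<Longrightarrow> open S \<Longrightarrow> S \<subseteq> rect s rad \<Longrightarrow> open (Pt i ` S)"
  by (intro invariance_of_domain continuous_on_Pt inj_on_subset[OF inj_on_Pt])

lemma contractible_Tb:
  assumes i: "i \<in> I" and S: "S \<subseteq> bx s rad" "contractible S"
  shows "contractible (Tb i ` S)"
proof -
  obtain g where g: "homeomorphism (bx s rad) (Tb i ` bx s rad) (Tb i) g"
    using invariance_of_domain_homeomorphism[OF open_bx continuous_on_Tb[OF i] _ inj_on_Tb[OF i]] by blast
  have "homeomorphism S (Tb i ` S) (Tb i) g"
    by (rule homeomorphism_of_subsets[OF g S(1)]) (use S in auto)
  then have "S homeomorphic Tb i ` S" unfolding homeomorphic_def by blast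
  then show ?thesis using S(2) homeomorphic_contractible by blast
qed

lemma contractible_Pt:
  assumes i: "i \<in> I" and S: "S \<subseteq> rect s rad" "contractible S"
  shows "contractible (Pt i ` S)"
proof -
  obtain g where g: "homeomorphism (rect s rad) (Pt i ` rect s rad) (Pt i) g"
    using invariance_of_domain_homeomorphism[OF open_rect continuous_on_Pt[OF i] _ inj_on_Pt[OF i]] by blast
  have "homeomorphism S (Pt i ` S) (Pt i) g"
    by (rule homeomorphism_of_subsets[OF g S(1)]) (use S in auto)
  then have "S homeomorphic Pt i ` S" unfolding homeomorphic_def by blast
  then show ?thesis using S(2) homeomorphic_contractible by blast
qed

text \<open>A point of the link is a core point of its own tube, and tubes are disjoint, so within a
  box the link consists of the core alone.\<close>

lemma L_in_Tb:
  assumes i: "i \<in> I" and j: "j \<in> I" and p: "p \<in> bx s rad" and eq: "D j t = Tb i p"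
  shows "i = j" "Re (fst p) - t \<in> \<int>" "Im (fst p) = 0" "snd p = 0" "D j t = D i (Re (fst p))"
proof -
  have "Tb i p = Tb j (Complex t 0, 0)" using eq by (simp add: Tb_center)
  from tube_inj[OF i j _ _ _ _ this] p rad b
  show *: "i = j" "Re (fst p) - t \<in> \<int>" "Im (fst p) = 0" "snd p = 0" by (auto simp: bx_def)
  then show "D j t = D i (Re (fst p))" using eq by (simp add: tube_def ptube_def prod_eq_iff)
qed

lemma box_in_open:
  assumes i: "i \<in> I" and N: "open N" "D i s \<in> N"
  obtains a where "a > 0" "a \<le> rad" "Tb i ` bx s a \<subseteq> N"
proof -
  have "open (Tb i -` N)" using continuous_on_Tb[OF i, of UNIV] N open_vimage by blast
  moreover have "(Complex s 0, 0) \<in> Tb i -` N" using N by (simp add: Tb_center)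
  ultimately obtain e where e: "e > 0" "ball (Complex s 0, 0) e \<subseteq> Tb i -` N" using open_contains_ball by blast
  show thesis
  proof (rule that[of "min rad (e / 3)"])
    show "Tb i ` bx s (min rad (e / 3)) \<subseteq> N"
    proof (rule image_subsetI)
      fix p assume p: "p \<in> bx s (min rad (e / 3))"
      obtain q z where qz: "p = (q, z)" by (cases p)
      have "(q, z) \<in> bx s (min rad (e / 3))" using p qz by simp
      then have *: "\<bar>Re q - s\<bar> < e / 3" "\<bar>Im q\<bar> < e / 3" "\<bar>z\<bar> < e / 3" by (auto simp: bx_def)
      have "norm (q - Complex s 0, z) \<le> norm (q - Complex s 0) + norm z" by (rule norm_Pair_le)
      also have "norm (q - Complex s 0) \<le> \<bar>Re q - s\<bar> + \<bar>Im q\<bar>"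
        using cmod_le[of "q - Complex s 0"] by simp
      finally have "norm ((q, z) - (Complex s 0, 0)) < e" using * by simp
      then have "dist (Complex s 0, 0) (q, z) < e" by (metis dist_norm dist_commute)
      then show "Tb i p \<in> N" using e(2) qz by auto
    qed
  qed (use e rad in auto)
qed

text \<open>The part of \<open>C\<close> away from \<open>D i s\<close> stays below a small box
  because \<open>overhead\<close> is open. The part nearby is the strand itself, and a point of
  \<open>upper\<close> is never on or under it.\<close>

lemma top_box:
  assumes i: "i \<in> I" and C: "compact C" "C \<subseteq> L"
    and top: "\<And>q. q \<in> C \<Longrightarrow> fst q = fst (D i s) \<Longrightarrow> snd q \<le> snd (D i s)" and N: "open N" "D i s \<in> N"
  obtains a where "a > 0" "a \<le> rad" "Tb i ` bx s a \<subseteq> N" "Tb i ` (bx s a \<inter> upper) \<subseteq> overhead C"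
proof -
  define N0 where "N0 = N \<inter> Tb i ` bx s rad"
  have N0: "open N0" unfolding N0_def using N by (intro open_Int open_Tb[OF i open_bx]) auto
  have c0: "(Complex s 0, 0) \<in> bx s rad" using rad by (simp add: bx_def)
  then have DN0: "D i s \<in> N0" unfolding N0_def using N by (metis IntI Tb_center imageI)
  have "compact (C - N0)" using C N0 by (simp add: compact_diff)
  then have oa: "open (overhead (C - N0))" by (rule open_overhead)
  have "D i s \<in> overhead (C - N0)"
    unfolding overhead_def
  proof (intro CollectI ballI impI)
    fix q assume q: "q \<in> C - N0" "fst q = fst (D i s)"
    then have "snd q \<noteq> snd (D i s)" using DN0 by (metis DiffD2 prod_eqI)
    then show "snd q < snd (D i s)" using top[of q] q by simp
  qed
  then obtain a where a: "a > 0" "a \<le> rad" "Tb i ` bx s a \<subseteq> N0 \<inter> overhead (C - N0)"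
    using box_in_open[OF i open_Int[OF N0 oa]] DN0 by blast
  have "Tb i p \<in> overhead C" if p: "p \<in> bx s a" "p \<in> upper" for p
    unfolding overhead_def
  proof (intro CollectI ballI impI)
    fix q assume q: "q \<in> C" "fst q = fst (Tb i p)"
    show "snd q < snd (Tb i p)"
    proof (cases "q \<in> N0")
      case False
      then show ?thesis using a(3) p q by (auto simp: overhead_def)
    next
      case True
      then obtain p' where p': "p' \<in> bx s rad" "q = Tb i p'" by (auto simp: N0_def)
      obtain j t where j: "j \<in> I" "q = D j t" using q(1) C(2) in_L by blast
      have I0: "Im (fst p') = 0" "snd p' = 0" using L_in_Tb[OF i j(1) p'(1)] j(2) p'(2) by auto
      have pr: "p \<in> bx s rad" using p(1) a bx_mono[of s s a rad] by auto
      have "Pt i (fst p) = Pt i (fst p')" using q(2) p'(2) by (simp add: fst_Tb)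
      then have "fst p = fst p'" using inj_on_Pt[OF i, of s] pr p'(1) by (auto simp: inj_on_def bx_def rect_def)
      then show ?thesis using p(2) I0 p'(2) by (auto simp: tube_def upper_def)
    qed
  qed
  then have "Tb i ` (bx s a \<inter> upper) \<subseteq> overhead C" by (intro image_subsetI) simp
  moreover have "Tb i ` bx s a \<subseteq> N" using a(3) by (simp add: N0_def)
  ultimately show thesis using that a by blast
qed

text \<open>A transverse curve moves to the side given by the sign of the determinant. The strip map
  need not be differentiable, so this is read off from secants and not from a derivative of its
  inverse.\<close>

lemma crossing_side:
  assumes i: "i \<in> I" and c: "(c has_vector_derivative w) (at t0)" "c t0 = fst (D i s)"
    and d: "plane_det (plane_velocity D i s) w \<noteq> 0" and a: "a > 0" "a \<le> rad"
  shows "\<forall>\<^sub>F t in at t0. \<exists>q\<in>rect s a. Pt i q = c t \<and> Im q * (t - t0) * plane_det (plane_velocity D i s) w > 0"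
proof -
  let ?v = "plane_velocity D i s"
  define \<gamma> where "\<gamma> = (\<lambda>t. fst (D i t))"
  have der: "(\<gamma> has_vector_derivative ?v) (at s)" unfolding \<gamma>_def by (rule LD(5)[OF i])
  have sub: "rect s a \<subseteq> rect s rad" using a by (auto simp: rect_def)
  have "isCont c t0" using c(1) has_vector_derivative_continuous by blast
  then have ct: "(c \<longlongrightarrow> Pt i (Complex s 0)) (at t0)" using c(2) by (simp add: isCont_def ptube_def)
  have cs: "Complex s 0 \<in> rect s a" using a by (simp add: rect_def)
  obtain q where q: "(q \<longlongrightarrow> Complex s 0) (at t0)" "\<forall>\<^sub>F t in at t0. q t \<in> rect s a \<and> Pt i (q t) = c t"
    using inverse_tendsto[OF open_rect continuous_on_Pt[OF i] inj_on_subset[OF inj_on_Pt[OF i] sub] cs ct a(1)] by blast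
  \<comment> \<open>The secant of the strand from \<open>s\<close>, completed by the velocity. It is
    parallel to the displacement along the strand, so in the determinant with
    \<open>c t - c t0\<close> only the transverse displacement survives.\<close>
  define u where "u r = (if r = s then ?v else (\<gamma> r - \<gamma> s) /\<^sub>R (r - s))" for r
  have "(u \<longlongrightarrow> ?v) (at s)"
  proof (rule Lim_transform_eventually[OF has_vector_derivative_quotient[OF der]])
    show "\<forall>\<^sub>F r in at s. (\<gamma> r - \<gamma> s) /\<^sub>R (r - s) = u r"
      unfolding eventually_at_filter by (intro always_eventually) (simp add: u_def)
  qed
  then have "isCont u s" by (simp add: isCont_def u_def)
  moreover have Rq: "((\<lambda>t. Re (q t)) \<longlongrightarrow> s) (at t0)" using tendsto_Re[OF q(1)] by simp
  ultimately have "((\<lambda>t. u (Re (q t))) \<longlongrightarrow> u s) (at t0)" by (rule isCont_tendsto_compose)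
  then have ut: "((\<lambda>t. u (Re (q t))) \<longlongrightarrow> ?v) (at t0)" by (simp add: u_def)
  have "isCont (nn i) s" using nn_cont[OF i] by (simp add: continuous_on_eq_continuous_at)
  then have nt: "((\<lambda>t. nn i (Re (q t))) \<longlongrightarrow> nn i s) (at t0)" using Rq by (rule isCont_tendsto_compose)
  have "((\<lambda>t. plane_det (u (Re (q t))) ((c t - c t0) /\<^sub>R (t - t0)) * plane_det ?v w) \<longlongrightarrow> plane_det ?v w * plane_det ?v w) (at t0)"
    by (intro tendsto_mult tendsto_const tendsto_plane_det ut has_vector_derivative_quotient c)
  moreover have "0 < plane_det ?v w * plane_det ?v w" using d by (simp add: zero_less_mult_iff) linarith
  ultimately have e1: "\<forall>\<^sub>F t in at t0. 0 < plane_det (u (Re (q t))) ((c t - c t0) /\<^sub>R (t - t0)) * plane_det ?v w"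
    by (rule order_tendstoD(1))
  have e2: "\<forall>\<^sub>F t in at t0. 0 < plane_det (u (Re (q t))) (nn i (Re (q t)))"
    by (rule order_tendstoD(1)[OF tendsto_plane_det[OF ut nt] nn_det[OF i]])
  have e3: "\<forall>\<^sub>F t in at t0. t \<noteq> t0" by (simp add: eventually_at_filter)
  show ?thesis
    using e1 e2 e3 q(2)
  proof eventually_elim
    case (elim t)
    let ?s = "Re (q t)" and ?d = "plane_det ?v w"
    have eq: "of_real (Im (q t)) * nn i ?s = (c t - c t0) - (\<gamma> ?s - \<gamma> s)"
      using elim c(2) by (auto simp: ptube_def \<gamma>_def algebra_simps)
    have z: "plane_det (u ?s) (\<gamma> ?s - \<gamma> s) = 0"
      by (auto simp: u_def plane_det_def)
    have "Im (q t) * plane_det (u ?s) (nn i ?s) = plane_det (u ?s) (of_real (Im (q t)) * nn i ?s)"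
      by (simp add: plane_det_def algebra_simps)
    also have "\<dots> = plane_det (u ?s) (c t - c t0)"
      unfolding eq using z by (simp add: plane_det_def algebra_simps)
    also have "\<dots> = plane_det (u ?s) ((t - t0) *\<^sub>R ((c t - c t0) /\<^sub>R (t - t0)))"
      using elim by simp
    also have "\<dots> = (t - t0) * plane_det (u ?s) ((c t - c t0) /\<^sub>R (t - t0))"
      unfolding plane_det_def by (simp only: scaleR_complex.sel right_diff_distrib mult.left_commute mult.assoc)
    finally have "Im (q t) * plane_det (u ?s) (nn i ?s) * (t - t0) * ?d =
        (t - t0)\<^sup>2 * (plane_det (u ?s) ((c t - c t0) /\<^sub>R (t - t0)) * ?d)"
      by (simp add: power2_eq_square)
    moreover have "\<dots> > 0" using elim by simp
    ultimately have "(Im (q t) * (t - t0) * ?d) * plane_det (u ?s) (nn i ?s) > 0" by (simp add: algebra_simps)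
    then have "Im (q t) * (t - t0) * ?d > 0" using elim(2) by (simp add: zero_less_mult_iff)
    then show ?case using elim by (intro bexI[of _ "q t"]) auto
  qed
qed

end

section \<open>Coverings of the link complement\<close>

definition section_on :: "(complex \<times> real \<Rightarrow> 'e::topological_space set) \<Rightarrow> (complex \<times> real) set \<Rightarrow> (complex \<times> real \<Rightarrow> 'e) \<Rightarrow> bool"
  where "section_on E W \<sigma> \<longleftrightarrow> continuous_on W \<sigma> \<and> (\<forall>p\<in>W. \<sigma> p \<in> E p)"

lemma section_on_subset: "section_on E W \<sigma> \<Longrightarrow> W' \<subseteq> W \<Longrightarrow> section_on E W' \<sigma>"
  by (auto simp: section_on_def intro: continuous_on_subset)

lemma section_on_cong: "section_on E W \<sigma> \<Longrightarrow> (\<And>p. p \<in> W \<Longrightarrow> \<tau> p = \<sigma> p) \<Longrightarrow> section_on E W \<tau>"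
  unfolding section_on_def using continuous_on_cong[of W W \<tau> \<sigma>] by simp

context diag
begin

definition top_at :: "'i \<Rightarrow> real \<Rightarrow> bool"
  where "top_at i s \<longleftrightarrow> (\<forall>q\<in>L. fst q = fst (D i s) \<longrightarrow> snd q \<le> snd (D i s))"

lemma top_at_iff:
  assumes "i \<in> I"
  shows "top_at i s \<longleftrightarrow> D i s \<notin> under_points I D"
proof
  assume t: "top_at i s"
  show "D i s \<notin> under_points I D"
  proof
    assume "D i s \<in> under_points I D"
    then obtain k r j t where *: "D i s = D j t" "crossing I D k r j t" unfolding under_points_def by blast
    then have "D k r \<in> L" "fst (D k r) = fst (D i s)" "snd (D i s) < snd (D k r)"
      by (auto simp: crossing_def in_L)
    then show False using t unfolding top_at_def by (meson not_less)
  qed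
next
  assume u: "D i s \<notin> under_points I D"
  show "top_at i s" unfolding top_at_def
  proof (intro ballI impI)
    fix q assume q: "q \<in> L" "fst q = fst (D i s)"
    obtain j t where jt: "j \<in> I" "q = D j t" using q(1) in_L by blast
    have "\<not> crossing I D j t i s" using u by (auto simp: under_points_def)
    then show "snd q \<le> snd (D i s)" using jt q assms by (auto simp: crossing_def)
  qed
qed

lemma Tb_avoids_L:
  assumes i: "i \<in> I"
  shows "Tb i ` (bx s rad \<inter> lower) \<inter> L = {}" "Tb i ` (bx s rad \<inter> upper) \<inter> L = {}"
proof -
  have "False" if p: "p \<in> bx s rad" "Tb i p \<in> L" "p \<in> lower \<or> p \<in> upper" for p
  proof -
    obtain j t where "j \<in> I" "D j t = Tb i p" using p(2) in_L by metis
    from L_in_Tb(3,4)[OF i this(1) p(1) this(2)] p(3) show False by (auto simp: lower_def upper_def)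
  qed
  then show "Tb i ` (bx s rad \<inter> lower) \<inter> L = {}" "Tb i ` (bx s rad \<inter> upper) \<inter> L = {}" by blast+
qed

lemma curve_in_box: "\<bar>s' - s\<bar> < a \<Longrightarrow> D i s' \<in> Tb i ` bx s a"
  by (rule image_eqI[of _ _ "(Complex s' 0, 0)"]) (auto simp: Tb_center bx_def)

lemma triple:
  assumes "crossing I D i s j t" "q \<in> L" "fst q = fst (D i s)"
  shows "q = D i s \<or> q = D j t"
proof -
  have "D i s \<in> (\<Union>i\<in>I. range (D i))" "D j t \<in> (\<Union>i\<in>I. range (D i))" "q \<in> (\<Union>i\<in>I. range (D i))"
    "fst (D i s) = fst (D j t)" "D i s \<noteq> D j t"
    using assms by (auto simp: crossing_def in_L)
  moreover have "\<forall>p\<in>(\<Union>i\<in>I. range (D i)). \<forall>q\<in>(\<Union>i\<in>I. range (D i)). \<forall>r\<in>(\<Union>i\<in>I. range (D i)).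
       fst p = fst q \<and> fst q = fst r \<longrightarrow> p = q \<or> q = r \<or> p = r"
    using link by (simp add: link_diagram_def)
  ultimately have "D i s = D j t \<or> D j t = q \<or> D i s = q" using assms(3) by (metis (no_types, lifting))
  then show ?thesis using \<open>D i s \<noteq> D j t\<close> by auto
qed

lemma crossing_top:
  assumes "crossing I D i s j t"
  shows "top_at i s"
  unfolding top_at_def
proof (intro ballI impI)
  fix q assume "q \<in> L" "fst q = fst (D i s)"
  then have "q = D i s \<or> q = D j t" using triple[OF assms] by blast
  then show "snd q \<le> snd (D i s)" using assms by (auto simp: crossing_def)
qed

lemma crossing_det:
  assumes "crossing I D i s j t"
  shows "plane_det (plane_velocity D i s) (plane_velocity D j t) \<noteq> 0"
proof -
  have "i \<in> I" "j \<in> I" "D i s \<noteq> D j t" "fst (D i s) = fst (D j t)" using assms by (auto simp: crossing_def)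
  then show ?thesis using link unfolding link_diagram_def by blast
qed

end

text \<open>A regular covering with fibres \<open>E p\<close> and deck group \<open>G\<close>, described by its sections over
  subsets of the link complement.\<close>

locale cover = diag I D nn b \<delta> for I :: "'i set" and D nn b \<delta> +
  fixes E :: "complex \<times> real \<Rightarrow> 'e::topological_space set" and G :: "('e \<Rightarrow> 'e) set"
  assumes comp_G: "\<And>g h. g \<in> G \<Longrightarrow> h \<in> G \<Longrightarrow> g \<circ> h \<in> G"
    and id_G: "id \<in> G"
    and inv_G: "\<And>g. g \<in> G \<Longrightarrow> \<exists>h\<in>G. h \<circ> g = id \<and> g \<circ> h = id"
    and cont_G: "\<And>g. g \<in> G \<Longrightarrow> continuous_on UNIV g"
    and act_G: "\<And>g p e. g \<in> G \<Longrightarrow> p \<notin> L \<Longrightarrow> e \<in> E p \<Longrightarrow> g e \<in> E p"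
    and free_G: "\<And>g h p e. g \<in> G \<Longrightarrow> h \<in> G \<Longrightarrow> p \<notin> L \<Longrightarrow> e \<in> E p \<Longrightarrow> g e = h e \<Longrightarrow> g = h"
    and section_ex: "\<And>W. contractible W \<Longrightarrow> W \<inter> L = {} \<Longrightarrow> \<exists>\<sigma>. section_on E W \<sigma>"
    and section_eq: "\<And>W \<sigma> \<tau>. connected W \<Longrightarrow> W \<inter> L = {} \<Longrightarrow> section_on E W \<sigma> \<Longrightarrow> section_on E W \<tau> \<Longrightarrow>
        \<exists>g\<in>G. \<forall>p\<in>W. \<tau> p = g (\<sigma> p)"
begin

lemma section_act:
  assumes g: "g \<in> G" and W: "W \<inter> L = {}" and \<sigma>: "section_on E W \<sigma>"
  shows "section_on E W (\<lambda>p. g (\<sigma> p))"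
  unfolding section_on_def
proof (intro conjI ballI)
  show "continuous_on W (\<lambda>p. g (\<sigma> p))"
    by (rule continuous_on_compose2[OF cont_G[OF g]]) (use \<sigma> in \<open>auto simp: section_on_def\<close>)
  show "g (\<sigma> p) \<in> E p" if "p \<in> W" for p
    by (rule act_G[OF g]) (use that W \<sigma> in \<open>auto simp: section_on_def\<close>)
qed

section \<open>The reference section and the monodromy around a strand\<close>

definition T :: "(complex \<times> real) set" where "T = overhead L"

lemma T_L: "T \<inter> L = {}"
  by (auto simp: T_def overhead_def)

lemma contractible_T: "contractible T"
proof -
  have "bounded (snd ` L)" using compact_L compact_continuous_image[OF continuous_on_snd[OF continuous_on_id]]
    by (intro compact_imp_bounded) auto
  then obtain h where h: "\<And>q. q \<in> L \<Longrightarrow> norm (snd q) \<le> h" unfolding bounded_iff by blast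
  have "contractible (overhead L \<inter> (UNIV \<times> UNIV))"
  proof (rule contractible_overhead)
    show "snd q < h + 1" if "q \<in> L" for q using h[OF that] by simp
  qed auto
  then show ?thesis by (simp add: T_def)
qed

definition \<sigma>T :: "complex \<times> real \<Rightarrow> 'e" where "\<sigma>T = (SOME \<sigma>. section_on E T \<sigma>)"

lemma section_\<sigma>T: "section_on E T \<sigma>T"
  unfolding \<sigma>T_def using someI_ex[OF section_ex[OF contractible_T T_L]] .

text \<open>\<open>mon \<sigma>0 i s g\<close>: continuing \<open>\<sigma>0\<close> from the right of the strand \<open>i\<close> to its left, passing below the
  point with parameter \<open>s\<close>, gives \<open>g \<circ> \<sigma>0\<close>.\<close>

definition mon :: "(complex \<times> real \<Rightarrow> 'e) \<Rightarrow> 'i \<Rightarrow> real \<Rightarrow> ('e \<Rightarrow> 'e) \<Rightarrow> bool"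
  where "mon \<sigma>0 i s g \<longleftrightarrow> g \<in> G \<and> (\<exists>a>0. a \<le> rad \<and> section_on E (Tb i ` (bx s a \<inter> upper)) \<sigma>0 \<and>
    (\<exists>\<sigma>. section_on E (Tb i ` (bx s a \<inter> lower)) \<sigma> \<and>
      (\<forall>p\<in>bx s a. Im (fst p) < 0 \<longrightarrow> \<sigma> (Tb i p) = \<sigma>0 (Tb i p)) \<and>
      (\<forall>p\<in>bx s a. 0 < Im (fst p) \<longrightarrow> \<sigma> (Tb i p) = g (\<sigma>0 (Tb i p)))))"

lemma mon_G: "mon \<sigma>0 i s g \<Longrightarrow> g \<in> G" by (simp add: mon_def)

lemma Tb_disj:
  assumes "i \<in> I" "a \<le> rad"
  shows "Tb i ` (bx s a \<inter> lower) \<inter> L = {}" "Tb i ` (bx s a \<inter> upper) \<inter> L = {}"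
proof -
  have "bx s a \<subseteq> bx s rad" using assms(2) by (intro bx_mono) simp
  then have "Tb i ` (bx s a \<inter> X) \<subseteq> Tb i ` (bx s rad \<inter> X)" for X by (intro image_mono) blast
  then show "Tb i ` (bx s a \<inter> lower) \<inter> L = {}" "Tb i ` (bx s a \<inter> upper) \<inter> L = {}"
    using Tb_avoids_L[OF assms(1), of s] by blast+
qed

text \<open>A section over the lower part of the box is normalised to agree with
  \<open>\<sigma>0\<close> on the right. The left half is connected, so there the two differ by a
  single deck transformation.\<close>

lemma mon_ex:
  assumes i: "i \<in> I" and a: "0 < a" "a \<le> rad" and \<sigma>0: "section_on E (Tb i ` (bx s a \<inter> upper)) \<sigma>0"
  shows "\<exists>g. mon \<sigma>0 i s g"
proof -
  let ?R = "bx s a \<inter> {p. Im (fst p) < 0}" and ?L = "bx s a \<inter> {p. 0 < Im (fst p)}"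
  have sub: "bx s a \<subseteq> bx s rad" using a by (intro bx_mono) simp
  have "contractible (Tb i ` (bx s a \<inter> lower))"
    using sub by (intro contractible_Tb[OF i] contractible_bx_lower a) auto
  then obtain \<sigma> where \<sigma>: "section_on E (Tb i ` (bx s a \<inter> lower)) \<sigma>"
    using section_ex Tb_disj[OF i a(2)] by blast
  have conn: "connected (Tb i ` ?R)" "connected (Tb i ` ?L)"
    by (intro connected_continuous_image continuous_on_Tb[OF i] convex_connected convex_bx_half)+
  have RL: "?R \<subseteq> bx s a \<inter> lower" "?L \<subseteq> bx s a \<inter> lower" "?R \<subseteq> bx s a \<inter> upper" "?L \<subseteq> bx s a \<inter> upper"
    by (auto simp: lower_def upper_def)
  have disj: "Tb i ` ?R \<inter> L = {}" "Tb i ` ?L \<inter> L = {}" using RL Tb_disj[OF i a(2), of s] by blast+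
  obtain k where k: "k \<in> G" "\<forall>p\<in>Tb i ` ?R. \<sigma>0 p = k (\<sigma> p)"
    using section_eq[OF conn(1) disj(1) section_on_subset[OF \<sigma> image_mono] section_on_subset[OF \<sigma>0 image_mono]] RL by blast
  have s2: "section_on E (Tb i ` (bx s a \<inter> lower)) (\<lambda>p. k (\<sigma> p))"
    using section_act[OF k(1) Tb_disj(1)[OF i a(2)] \<sigma>] .
  obtain g where g: "g \<in> G" "\<forall>p\<in>Tb i ` ?L. k (\<sigma> p) = g (\<sigma>0 p)"
    using section_eq[OF conn(2) disj(2) section_on_subset[OF \<sigma>0 image_mono] section_on_subset[OF s2 image_mono]] RL by blast
  have "mon \<sigma>0 i s g" unfolding mon_def
  proof (intro conjI g exI[of _ a] a \<sigma>0 exI[of _ "\<lambda>p. k (\<sigma> p)"] s2)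
    show "\<forall>p\<in>bx s a. Im (fst p) < 0 \<longrightarrow> k (\<sigma> (Tb i p)) = \<sigma>0 (Tb i p)" using k by auto
    show "\<forall>p\<in>bx s a. 0 < Im (fst p) \<longrightarrow> k (\<sigma> (Tb i p)) = g (\<sigma>0 (Tb i p))" using g by auto
  qed
  then show ?thesis by blast
qed

text \<open>Two normalised continuations differ by a deck transformation that fixes a value on the
  right; freeness makes it the identity.\<close>

lemma mon_unique:
  assumes i: "i \<in> I" and g: "mon \<sigma>0 i s g" and g': "mon \<sigma>0 i s g'"
  shows "g = g'"
proof -
  obtain a \<sigma> where a: "0 < a" "a \<le> rad" and \<sigma>0: "section_on E (Tb i ` (bx s a \<inter> upper)) \<sigma>0"
    and \<sigma>: "section_on E (Tb i ` (bx s a \<inter> lower)) \<sigma>"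
    "\<forall>p\<in>bx s a. Im (fst p) < 0 \<longrightarrow> \<sigma> (Tb i p) = \<sigma>0 (Tb i p)"
    "\<forall>p\<in>bx s a. 0 < Im (fst p) \<longrightarrow> \<sigma> (Tb i p) = g (\<sigma>0 (Tb i p))" and gG: "g \<in> G"
    using g unfolding mon_def by blast
  obtain a' \<sigma>' where a': "0 < a'" "a' \<le> rad"
    and \<sigma>': "section_on E (Tb i ` (bx s a' \<inter> lower)) \<sigma>'"
    "\<forall>p\<in>bx s a'. Im (fst p) < 0 \<longrightarrow> \<sigma>' (Tb i p) = \<sigma>0 (Tb i p)"
    "\<forall>p\<in>bx s a'. 0 < Im (fst p) \<longrightarrow> \<sigma>' (Tb i p) = g' (\<sigma>0 (Tb i p))" and gG': "g' \<in> G"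
    using g' unfolding mon_def by blast
  define c where "c = min a a'"
  have c: "c > 0" "c \<le> rad" and cs: "bx s c \<subseteq> bx s a" "bx s c \<subseteq> bx s a'"
    using a a' by (auto simp: c_def intro!: bx_mono)
  have conn: "connected (Tb i ` (bx s c \<inter> lower))"
    using c contractible_bx_lower[OF c(1), of s]
    by (intro connected_continuous_image continuous_on_Tb[OF i] contractible_imp_connected)
  obtain k where k: "k \<in> G" "\<forall>p\<in>Tb i ` (bx s c \<inter> lower). \<sigma>' p = k (\<sigma> p)"
    using section_eq[OF conn Tb_disj(1)[OF i c(2)] section_on_subset[OF \<sigma>(1)] section_on_subset[OF \<sigma>'(1)]] cs
    by (meson Int_mono image_mono order_refl)
  let ?p = "(Complex s (- c / 2), 0)" and ?q = "(Complex s (c / 2), 0)"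
  have p: "?p \<in> bx s c" "?p \<in> lower" "?p \<in> upper" and q: "?q \<in> bx s c" "?q \<in> lower" "?q \<in> upper"
    using c by (auto simp: bx_def lower_def upper_def)
  have out: "Tb i ?p \<notin> L" "Tb i ?q \<notin> L" using Tb_disj[OF i c(2), of s] p q by blast+
  have E: "\<sigma>0 (Tb i ?p) \<in> E (Tb i ?p)" "\<sigma>0 (Tb i ?q) \<in> E (Tb i ?q)"
    using \<sigma>0 p q cs unfolding section_on_def by blast+
  have pa: "?p \<in> bx s a" "?p \<in> bx s a'" "?q \<in> bx s a" "?q \<in> bx s a'" using p q cs by blast+
  have "k (\<sigma> (Tb i ?p)) = \<sigma>' (Tb i ?p)" "k (\<sigma> (Tb i ?q)) = \<sigma>' (Tb i ?q)" 
    using bspec[OF k(2), OF imageI, of ?p] bspec[OF k(2), OF imageI, of ?q] p q by simp_all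
  moreover have "\<sigma> (Tb i ?p) = \<sigma>0 (Tb i ?p)" "\<sigma>' (Tb i ?p) = \<sigma>0 (Tb i ?p)"
    using bspec[OF \<sigma>(2) pa(1)] bspec[OF \<sigma>'(2) pa(2)] c(1) by simp_all
  moreover have sq: "\<sigma> (Tb i ?q) = g (\<sigma>0 (Tb i ?q))" "\<sigma>' (Tb i ?q) = g' (\<sigma>0 (Tb i ?q))"
    using bspec[OF \<sigma>(3) pa(3)] bspec[OF \<sigma>'(3) pa(4)] c(1) by simp_all
  ultimately have kk: "k (\<sigma>0 (Tb i ?p)) = id (\<sigma>0 (Tb i ?p))" "k (g (\<sigma>0 (Tb i ?q))) = g' (\<sigma>0 (Tb i ?q))" by simp_all
  have "k = id" by (rule free_G[OF k(1) id_G out(1) E(1) kk(1)])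
  then have "g (\<sigma>0 (Tb i ?q)) = g' (\<sigma>0 (Tb i ?q))" using kk(2) by simp
  then show ?thesis using free_G[OF gG gG' out(2) E(2)] by simp
qed

lemma mon_near:
  assumes i: "i \<in> I" and g: "mon \<sigma>0 i s g"
  shows "\<exists>e>0. e \<le> rad \<and> (\<forall>s'. \<bar>s' - s\<bar> < e \<longrightarrow> mon \<sigma>0 i s' g)"
proof -
  obtain a \<sigma> where a: "0 < a" "a \<le> rad" and \<sigma>0: "section_on E (Tb i ` (bx s a \<inter> upper)) \<sigma>0"
    and \<sigma>: "section_on E (Tb i ` (bx s a \<inter> lower)) \<sigma>"
    "\<forall>p\<in>bx s a. Im (fst p) < 0 \<longrightarrow> \<sigma> (Tb i p) = \<sigma>0 (Tb i p)"
    "\<forall>p\<in>bx s a. 0 < Im (fst p) \<longrightarrow> \<sigma> (Tb i p) = g (\<sigma>0 (Tb i p))" and gG: "g \<in> G"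
    using g unfolding mon_def by blast
  have "mon \<sigma>0 i s' g" if s': "\<bar>s' - s\<bar> < a" for s'
  proof -
    let ?a = "a - \<bar>s' - s\<bar>"
    have sub: "bx s' ?a \<subseteq> bx s a" by (rule bx_mono) simp
    show ?thesis unfolding mon_def
    proof (intro conjI gG exI[of _ ?a] exI[of _ \<sigma>])
      show "section_on E (Tb i ` (bx s' ?a \<inter> upper)) \<sigma>0" by (rule section_on_subset[OF \<sigma>0]) (use sub in blast)
      show "section_on E (Tb i ` (bx s' ?a \<inter> lower)) \<sigma>" by (rule section_on_subset[OF \<sigma>(1)]) (use sub in blast)
      show "\<forall>p\<in>bx s' ?a. Im (fst p) < 0 \<longrightarrow> \<sigma> (Tb i p) = \<sigma>0 (Tb i p)" using \<sigma>(2) sub by blast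
      show "\<forall>p\<in>bx s' ?a. 0 < Im (fst p) \<longrightarrow> \<sigma> (Tb i p) = g (\<sigma>0 (Tb i p))" using \<sigma>(3) sub by blast
    qed (use a s' in auto)
  qed
  then show ?thesis using a by blast
qed

text \<open>Moving the continuation by \<open>h\<close> along with the reference section turns the
  jump \<open>g\<close> into its conjugate. This is the source of the conjugation in the Wirtinger
  relation.\<close>

lemma mon_cong:
  assumes i: "i \<in> I" and g: "mon \<sigma>0 i s g" and h: "h \<in> G" "k \<in> G" "k \<circ> h = id"
    and a1: "0 < a1" and eq: "\<And>p. p \<in> bx s a1 \<Longrightarrow> p \<in> upper \<Longrightarrow> \<sigma>1 (Tb i p) = h (\<sigma>0 (Tb i p))"
  shows "mon \<sigma>1 i s (h \<circ> g \<circ> k)"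
proof -
  obtain a \<sigma> where a: "0 < a" "a \<le> rad" and \<sigma>0: "section_on E (Tb i ` (bx s a \<inter> upper)) \<sigma>0"
    and \<sigma>: "section_on E (Tb i ` (bx s a \<inter> lower)) \<sigma>"
    "\<forall>p\<in>bx s a. Im (fst p) < 0 \<longrightarrow> \<sigma> (Tb i p) = \<sigma>0 (Tb i p)"
    "\<forall>p\<in>bx s a. 0 < Im (fst p) \<longrightarrow> \<sigma> (Tb i p) = g (\<sigma>0 (Tb i p))" and gG: "g \<in> G"
    using g unfolding mon_def by blast
  define c where "c = min a a1"
  have c: "0 < c" "c \<le> rad" and cs: "bx s c \<subseteq> bx s a" "bx s c \<subseteq> bx s a1"
    using a a1 by (auto simp: c_def intro!: bx_mono)
  have kh: "k (h e) = e" for e using h(3) by (metis comp_apply id_apply)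
  have up: "p \<in> upper" if "Im (fst p) \<noteq> 0" for p using that by (simp add: upper_def)
  show ?thesis unfolding mon_def
  proof (intro conjI exI[of _ c] exI[of _ "\<lambda>p. h (\<sigma> p)"])
    show "h \<circ> g \<circ> k \<in> G" by (intro comp_G h gG)
    have "section_on E (Tb i ` (bx s c \<inter> upper)) (\<lambda>p. h (\<sigma>0 p))"
      by (rule section_act[OF h(1) Tb_disj(2)[OF i c(2)] section_on_subset[OF \<sigma>0]]) (use cs in blast)
    then show "section_on E (Tb i ` (bx s c \<inter> upper)) \<sigma>1"
      by (rule section_on_cong) (use eq cs in blast)
    show "section_on E (Tb i ` (bx s c \<inter> lower)) (\<lambda>p. h (\<sigma> p))"
      by (rule section_act[OF h(1) Tb_disj(1)[OF i c(2)] section_on_subset[OF \<sigma>(1)]]) (use cs in blast)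
    show "\<forall>p\<in>bx s c. Im (fst p) < 0 \<longrightarrow> h (\<sigma> (Tb i p)) = \<sigma>1 (Tb i p)"
    proof (intro ballI impI)
      fix p assume p: "p \<in> bx s c" "Im (fst p) < 0"
      then have "p \<in> bx s a" "p \<in> bx s a1" "p \<in> upper" using cs up by auto
      then show "h (\<sigma> (Tb i p)) = \<sigma>1 (Tb i p)" using eq \<sigma>(2) p by simp
    qed
    show "\<forall>p\<in>bx s c. 0 < Im (fst p) \<longrightarrow> h (\<sigma> (Tb i p)) = (h \<circ> g \<circ> k) (\<sigma>1 (Tb i p))"
    proof (intro ballI impI)
      fix p assume p: "p \<in> bx s c" "0 < Im (fst p)"
      then have "p \<in> bx s a" "p \<in> bx s a1" "p \<in> upper" using cs up by auto
      then show "h (\<sigma> (Tb i p)) = (h \<circ> g \<circ> k) (\<sigma>1 (Tb i p))" using eq \<sigma>(3) p by (simp add: kh)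
    qed
  qed (use c in auto)
qed

lemma mon_shift:
  assumes i: "i \<in> I" and g: "mon \<sigma>0 i s g"
  shows "mon \<sigma>0 i (s + of_int k) g"
proof -
  obtain a \<sigma> where a: "0 < a" "a \<le> rad" and \<sigma>0: "section_on E (Tb i ` (bx s a \<inter> upper)) \<sigma>0"
    and \<sigma>: "section_on E (Tb i ` (bx s a \<inter> lower)) \<sigma>"
    "\<forall>p\<in>bx s a. Im (fst p) < 0 \<longrightarrow> \<sigma> (Tb i p) = \<sigma>0 (Tb i p)"
    "\<forall>p\<in>bx s a. 0 < Im (fst p) \<longrightarrow> \<sigma> (Tb i p) = g (\<sigma>0 (Tb i p))" and gG: "g \<in> G"
    using g unfolding mon_def by blast
  define f where "f p = (fst p + of_int (- k), snd p)" for p :: "complex \<times> real"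
  have Tf: "Tb i (f p) = Tb i p" for p
    using Tb_shift[OF i, of "fst p" "- k" "snd p"] by (simp add: f_def)
  have fb: "f p \<in> bx s a" "Im (fst (f p)) = Im (fst p)" "f p \<in> upper \<longleftrightarrow> p \<in> upper" "f p \<in> lower \<longleftrightarrow> p \<in> lower"
    if "p \<in> bx (s + of_int k) a" for p
    using that by (auto simp: f_def bx_def upper_def lower_def algebra_simps)
  have img: "Tb i ` (bx (s + of_int k) a \<inter> X) \<subseteq> Tb i ` (bx s a \<inter> X)" if "X = upper \<or> X = lower" for X
  proof (rule image_subsetI)
    fix p assume "p \<in> bx (s + of_int k) a \<inter> X"
    then have "f p \<in> bx s a \<inter> X" using fb[of p] that by auto
    then show "Tb i p \<in> Tb i ` (bx s a \<inter> X)" by (rule rev_image_eqI) (simp add: Tf)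
  qed
  show ?thesis unfolding mon_def
  proof (intro conjI gG exI[of _ a] exI[of _ \<sigma>] a)
    show "section_on E (Tb i ` (bx (s + of_int k) a \<inter> upper)) \<sigma>0"
      by (rule section_on_subset[OF \<sigma>0 img]) simp
    show "section_on E (Tb i ` (bx (s + of_int k) a \<inter> lower)) \<sigma>"
      by (rule section_on_subset[OF \<sigma>(1) img]) simp
    show "\<forall>p\<in>bx (s + of_int k) a. Im (fst p) < 0 \<longrightarrow> \<sigma> (Tb i p) = \<sigma>0 (Tb i p)"
      using \<sigma>(2) fb Tf by metis
    show "\<forall>p\<in>bx (s + of_int k) a. 0 < Im (fst p) \<longrightarrow> \<sigma> (Tb i p) = g (\<sigma>0 (Tb i p))"
      using \<sigma>(3) fb Tf by metis
  qed
qed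

lemma mon_top_ex:
  assumes i: "i \<in> I" and top: "top_at i s"
  shows "\<exists>g. mon \<sigma>T i s g"
proof -
  obtain a where a: "a > 0" "a \<le> rad" "Tb i ` (bx s a \<inter> upper) \<subseteq> overhead L"
  proof (rule top_box[OF i compact_L order_refl _ open_UNIV UNIV_I])
    show "snd q \<le> snd (D i s)" if "q \<in> L" "fst q = fst (D i s)" for q
      using top that unfolding top_at_def by blast
  qed blast
  show ?thesis
    by (rule mon_ex[OF i a(1,2) section_on_subset[OF section_\<sigma>T]]) (use a(3) in \<open>simp add: T_def\<close>)
qed

text \<open>An arc is connected and consists of points visible from above, where the monodromy of
  \<open>\<sigma>T\<close> is defined; by \<open>mon_near\<close> it is locally constant along the
  strand.\<close>

lemma arc_color:
  assumes x: "x \<in> arcs I D"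
  shows "\<exists>g\<in>G. \<forall>i\<in>I. \<forall>s. D i s \<in> x \<longrightarrow> mon \<sigma>T i s g"
proof -
  have xL: "x \<subseteq> L - under_points I D" and conn: "connected x" and ne: "x \<noteq> {}"
    using x in_components_subset in_components_connected in_components_nonempty
    unfolding arcs_def L_def link_of_def by blast+
  \<comment> \<open>Phrased for points of space, since an arc is a set of points; by
    \<open>mon_shift\<close> the choice of the parameter does not matter.\<close>
  define P where "P g p \<longleftrightarrow> (\<exists>i\<in>I. \<exists>s. p = D i s \<and> mon \<sigma>T i s g)" for g p
  have Peq: "P g (D i s) \<longleftrightarrow> mon \<sigma>T i s g" if i: "i \<in> I" for g i s
  proof
    assume "P g (D i s)"
    then obtain j t where j: "j \<in> I" "D i s = D j t" "mon \<sigma>T j t g" unfolding P_def by blast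
    have ij: "i = j" using LD(8) i j by blast
    then obtain k where "s - t = of_int k" using LD(9)[OF i] j(2) by (metis Ints_cases)
    then have "s = t + of_int k" by simp
    then show "mon \<sigma>T i s g" using mon_shift[OF j(1,3), of k] ij by simp
  qed (use i in \<open>auto simp: P_def\<close>)
  have curve: "\<exists>i\<in>I. \<exists>s. p = D i s \<and> top_at i s" if "p \<in> x" for p
  proof -
    have "p \<in> L" "p \<notin> under_points I D" using xL that by blast+
    then obtain i s where "i \<in> I" "p = D i s" unfolding in_L by blast
    then show ?thesis using top_at_iff \<open>p \<notin> under_points I D\<close> by blast
  qed
  obtain p0 where p0: "p0 \<in> x" using ne by blast
  obtain g where g: "P g p0" using curve[OF p0] mon_top_ex unfolding P_def by blast
  have "P g p" if p: "p \<in> x" for p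
  proof (rule connected_induction_simple[where P = "P g", OF conn p0 p g])
    fix q assume q: "q \<in> x"
    obtain i s where i: "i \<in> I" and qe: "q = D i s" and top: "top_at i s" using curve[OF q] by blast
    have qL: "y \<in> L" if "y \<in> x" for y using xL that by blast
    obtain g1 where g1: "mon \<sigma>T i s g1" using mon_top_ex[OF i top] by blast
    obtain e where e: "e > 0" "e \<le> rad" "\<And>s'. \<bar>s' - s\<bar> < e \<Longrightarrow> mon \<sigma>T i s' g1" using mon_near[OF i g1] by blast
    have sub: "bx s e \<subseteq> bx s rad" using e by (intro bx_mono) simp
    have only: "P g r \<longleftrightarrow> g = g1" if r: "r \<in> x \<inter> Tb i ` bx s e" for r
    proof -
      obtain p' where p': "p' \<in> bx s e" "r = Tb i p'" using r by blast
      have "r \<in> L" using r qL by blast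
      then obtain j t where j: "j \<in> I" "r = D j t" unfolding in_L by blast
      have "r = D i (Re (fst p'))" using L_in_Tb(5)[OF i j(1), of p' s t] p' j sub by auto
      moreover have "mon \<sigma>T i (Re (fst p')) g1" using e(3) p'(1) by (simp add: bx_def)
      ultimately show ?thesis using Peq[OF i] mon_unique[OF i] by blast
    qed
    show "\<exists>T. openin (top_of_set x) T \<and> q \<in> T \<and> (\<forall>y\<in>T. \<forall>z\<in>T. P g y \<longrightarrow> P g z)"
    proof (intro exI[of _ "x \<inter> Tb i ` bx s e"] conjI ballI impI)
      show "openin (top_of_set x) (x \<inter> Tb i ` bx s e)"
        by (intro openin_open_Int open_Tb[OF i open_bx sub])
      show "q \<in> x \<inter> Tb i ` bx s e" using q curve_in_box[of s s e i] e qe by simp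
      show "P g z" if "y \<in> x \<inter> Tb i ` bx s e" "z \<in> x \<inter> Tb i ` bx s e" "P g y" for y z
        using only that by blast
    qed
  qed
  then have "\<forall>i\<in>I. \<forall>s. D i s \<in> x \<longrightarrow> mon \<sigma>T i s g" using Peq by blast
  moreover have "g \<in> G" using g mon_G unfolding P_def by blast
  ultimately show ?thesis by blast
qed

end

section \<open>The passage beneath an over strand and the Wirtinger relation\<close>

context diag
begin

text \<open>The gap between an over strand and the strands under it. The heights
  \<open>zl < zm\<close> will be chosen strictly between them, so that only the strand
  \<open>i\<close> can still block the view from above.\<close>

definition below_region :: "'i \<Rightarrow> real \<Rightarrow> real \<Rightarrow> real \<Rightarrow> real \<Rightarrow> (complex \<times> real) set"
  where "below_region i s a zl zm = overhead (L \<inter> {q. snd q \<le> zl}) \<inter> (Pt i ` rect s a \<times> {..<zm})"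

lemma rect_mono: "\<bar>s' - s\<bar> + a' \<le> a \<Longrightarrow> rect s' a' \<subseteq> rect s a"
  by (auto simp: rect_def)

text \<open>The parts of the link that reach the height \<open>z2\<close> outside a small tube box
  form a compact set. Its shadow in the plane misses the point below \<open>D i s\<close>, hence a
  whole neighbourhood of that point.\<close>

lemma over_strand_isolated:
  assumes i: "i \<in> I" and z1: "z1 < z2" and hyp: "\<And>q. q \<in> L \<Longrightarrow> fst q = fst (D i s) \<Longrightarrow> q = D i s \<or> snd q \<le> z1"
    and N: "open N" "D i s \<in> N" and r: "0 < r"
  obtains a where "0 < a" "a \<le> rad" "a \<le> r" "\<And>s'. \<bar>s' - s\<bar> < a \<Longrightarrow> D i s' \<in> N"
    "\<And>q w. q \<in> L \<Longrightarrow> w \<in> rect s a \<Longrightarrow> fst q = Pt i w \<Longrightarrow>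
       snd q < z2 \<or> (\<exists>s'. \<bar>s' - s\<bar> < rad \<and> q = D i s' \<and> w = Complex s' 0)"
proof -
  obtain a1 where a1: "a1 > 0" "a1 \<le> rad" "Tb i ` bx s a1 \<subseteq> N" using box_in_open[OF i N] by blast
  have sub1: "bx s a1 \<subseteq> bx s rad" using a1 by (intro bx_mono) simp
  define C where "C = (L - Tb i ` bx s a1) \<inter> {q. z2 \<le> snd q}"
  have "open (Tb i ` bx s a1)" by (rule open_Tb[OF i open_bx sub1])
  then have "compact (L - Tb i ` bx s a1)" using compact_L by (simp add: compact_diff)
  moreover have "closed {q::complex \<times> real. z2 \<le> snd q}" by (intro closed_Collect_le continuous_intros)
  ultimately have "compact C" unfolding C_def by (intro compact_Int_closed)
  then have "compact (fst ` C)" by (intro compact_continuous_image continuous_on_fst continuous_on_id)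
  then have op: "open (fst -` (- (fst ` C)) :: (complex \<times> real) set)"
    by (intro open_vimage_fst) (simp add: compact_imp_closed open_Compl)
  have "fst (D i s) \<notin> fst ` C"
  proof
    assume "fst (D i s) \<in> fst ` C"
    then obtain q where q: "q \<in> C" "fst q = fst (D i s)" by auto
    then have "q = D i s" using hyp[of q] z1 by (auto simp: C_def)
    then show False using q(1) curve_in_box[of s s a1 i] a1 by (simp add: C_def)
  qed
  then have "D i s \<in> fst -` (- (fst ` C))" by simp
  then obtain a2 where a2: "a2 > 0" "a2 \<le> rad" "Tb i ` bx s a2 \<subseteq> fst -` (- (fst ` C))"
    using box_in_open[OF i op] by blast
  define a where "a = min r (min a1 a2)"
  have a: "0 < a" "a \<le> r" "a \<le> a1" "a \<le> a2" using a1 a2 r by (auto simp: a_def)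
  show thesis
  proof (rule that[of a])
    show "D i s' \<in> N" if "\<bar>s' - s\<bar> < a" for s'
      using curve_in_box[of s' s a1 i] a1(3) that a by auto
    fix q w assume q: "q \<in> L" and w: "w \<in> rect s a" and eq: "fst q = Pt i w"
    show "snd q < z2 \<or> (\<exists>s'. \<bar>s' - s\<bar> < rad \<and> q = D i s' \<and> w = Complex s' 0)"
    proof (cases "q \<in> Tb i ` bx s a1")
      case True
      then obtain p where p: "p \<in> bx s a1" "q = Tb i p" by blast
      obtain j t where j: "j \<in> I" "q = D j t" using q unfolding in_L by blast
      have pr: "p \<in> bx s rad" using p(1) sub1 by blast
      have P: "Im (fst p) = 0" "q = D i (Re (fst p))"
        using L_in_Tb(3,5)[OF i j(1) pr] p(2) j(2) by auto
      have "Pt i (fst p) = Pt i w" using eq p(2) by (simp add: fst_Tb)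
      moreover have "fst p \<in> rect s rad" "w \<in> rect s rad"
        using pr w a a1 by (auto simp: bx_def rect_def)
      ultimately have "fst p = w" using inj_on_Pt[OF i] by (meson inj_onD)
      then have "w = Complex (Re (fst p)) 0" using P(1) by (simp add: complex_eq_iff)
      moreover have "\<bar>Re (fst p) - s\<bar> < rad" using pr by (simp add: bx_def)
      ultimately show ?thesis using P(2) by blast
    next
      case False
      have "(w, 0) \<in> bx s a2" using w a by (auto simp: bx_def rect_def)
      then have "Tb i (w, 0) \<in> fst -` (- (fst ` C))" using a2(3) by blast
      then have "fst q \<notin> fst ` C" using eq by (simp add: fst_Tb)
      then show ?thesis using q False by (force simp: C_def)
    qed
  qed (use a a1 in auto)
qed

end

context cover
begin

text \<open>The passage is contractible, so it carries a section, and over either side of the strand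
  \<open>i\<close> it lies in \<open>T\<close>, where the section can be compared with
  \<open>\<sigma>T\<close>. The change from right to left equals the monodromy \<open>g\<close>
  measured inside the tube, because passage and tube overlap in a slab just under the
  strand.\<close>

lemma over_region:
  assumes i: "i \<in> I" and g: "mon \<sigma>T i s g" and z1: "z1 < snd (D i s)"
    and hyp: "\<And>q. q \<in> L \<Longrightarrow> fst q = fst (D i s) \<Longrightarrow> q = D i s \<or> snd q \<le> z1"
  obtains a zl zm \<sigma>W where "0 < a" "a \<le> rad" "z1 < zl" "zl < zm" "zm < snd (D i s)"
    "section_on E (below_region i s a zl zm) \<sigma>W"
    "below_region i s a zl zm \<inter> L = {}"
    "\<And>p q. p \<in> below_region i s a zl zm \<Longrightarrow> fst p = Pt i q \<Longrightarrow> q \<in> rect s a \<Longrightarrow> Im q \<noteq> 0 \<Longrightarrow> p \<in> T"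
    "\<And>p q. p \<in> below_region i s a zl zm \<Longrightarrow> fst p = Pt i q \<Longrightarrow> q \<in> rect s a \<Longrightarrow> Im q < 0 \<Longrightarrow> \<sigma>W p = \<sigma>T p"
    "\<And>p q. p \<in> below_region i s a zl zm \<Longrightarrow> fst p = Pt i q \<Longrightarrow> q \<in> rect s a \<Longrightarrow> 0 < Im q \<Longrightarrow> \<sigma>W p = g (\<sigma>T p)"
proof -
  obtain a0 \<sigma> where a0: "0 < a0" "a0 \<le> rad"
    and \<sigma>: "section_on E (Tb i ` (bx s a0 \<inter> lower)) \<sigma>"
    "\<forall>p\<in>bx s a0. Im (fst p) < 0 \<longrightarrow> \<sigma> (Tb i p) = \<sigma>T (Tb i p)"
    "\<forall>p\<in>bx s a0. 0 < Im (fst p) \<longrightarrow> \<sigma> (Tb i p) = g (\<sigma>T (Tb i p))" and gG: "g \<in> G"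
    using g unfolding mon_def by blast
  define z where "z = snd (D i s)"
  define d where "d = z - z1"
  define c1 where "c1 = min a0 (d / 2)"
  have d: "d > 0" using z1 by (simp add: d_def z_def)
  have c1: "c1 > 0" "c1 \<le> a0" "c1 \<le> d / 2" using d a0 by (auto simp: c1_def)
  \<comment> \<open>Over the rectangle the strand stays within \<open>c1 / 4\<close> of the height
    \<open>z\<close>. Points at tube heights between \<open>- c1\<close> and
    \<open>- (3/4) * c1\<close> are then below \<open>zm\<close>, and above \<open>zl\<close>
    because \<open>c1\<close> is at most \<open>d / 2\<close>.\<close>
  define zl zm where "zl = z1 + d / 4" and "zm = z - c1 / 2"
  have z12: "z1 < zl" "zl < zm" "zm < z" "zl = z - 3 * d / 4" 
  proof -
    have zz: "z = z1 + d" by (simp add: d_def)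
    show "z1 < zl" "zl < zm" "zm < z" "zl = z - 3 * d / 4"
      unfolding zl_def zm_def zz using d c1 by linarith+
  qed
  define N where "N = {p::complex \<times> real. \<bar>snd p - z\<bar> < c1 / 4}"
  have N: "open N" "D i s \<in> N" unfolding N_def using c1
    by (auto intro!: open_Collect_less continuous_intros simp: z_def)
  obtain a where a: "0 < a" "a \<le> rad" "a \<le> a0" and aN: "\<And>s'. \<bar>s' - s\<bar> < a \<Longrightarrow> D i s' \<in> N"
    and iso: "\<And>q w. q \<in> L \<Longrightarrow> w \<in> rect s a \<Longrightarrow> fst q = Pt i w \<Longrightarrow>
       snd q < zl \<or> (\<exists>s'. \<bar>s' - s\<bar> < rad \<and> q = D i s' \<and> w = Complex s' 0)"
  proof (rule over_strand_isolated[OF i z12(1) _ N a0(1)])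
    show "q = D i s \<or> snd q \<le> z1" if "q \<in> L" "fst q = fst (D i s)" for q by (rule hyp[OF that])
  qed (rule that)
  have sub: "rect s a \<subseteq> rect s rad" using a by (intro rect_mono) simp
  define C where "C = L \<inter> {q. snd q \<le> zl}"
  let ?W = "below_region i s a zl zm"
  have W: "p \<in> ?W \<longleftrightarrow> p \<in> overhead C \<and> fst p \<in> Pt i ` rect s a \<and> snd p < zm" for p
    by (auto simp: below_region_def C_def mem_Times_iff)
  have WL: "?W \<inter> L = {}"
  proof -
    have False if p: "p \<in> ?W" "p \<in> L" for p
    proof -
      obtain w where w: "w \<in> rect s a" "fst p = Pt i w" using p W by auto
      from iso[OF p(2) w] consider "snd p < zl" | s' where "p = D i s'" "w = Complex s' 0" by blast
      then show False
      proof cases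
        case 1
        then have "p \<in> C" using p by (simp add: C_def)
        then show False using p(1) by (auto simp: W overhead_def)
      next
        case 2
        then have "D i s' \<in> N" using aN w(1) by (simp add: rect_def)
          then have "\<bar>snd p - z\<bar> < c1 / 4" unfolding 2(1) N_def by blast
          then have "snd p > z - c1 / 4" by linarith
        moreover have "snd p < zm" using p(1) W by blast
        ultimately show False unfolding zm_def using c1 by linarith
      qed
    qed
    then show ?thesis by blast
  qed
  have WT: "p \<in> T" if p: "p \<in> ?W" "fst p = Pt i w" "w \<in> rect s a" "Im w \<noteq> 0" for p w
    unfolding T_def overhead_def
  proof (intro CollectI ballI impI)
    fix q assume q: "q \<in> L" "fst q = fst p"
    have "snd q < zl" using iso[OF q(1) p(3)] q(2) p(2,4) by auto
    then have "q \<in> C" using q by (simp add: C_def)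
    then show "snd q < snd p" using p(1) q(2) by (auto simp: W overhead_def)
  qed
  have contr: "contractible (overhead C \<inter> (Pt i ` U \<times> {..<zm}))" if "U \<subseteq> rect s a" "convex U" for U
  proof (rule contractible_overhead[where h = "(zl + zm) / 2"])
    show "contractible (Pt i ` U)"
      using that sub by (intro contractible_Pt[OF i] convex_imp_contractible) auto
    show "snd q < (zl + zm) / 2" if "q \<in> C" for q using that z12 by (auto simp: C_def)
  qed (use z12 in auto)
  have "contractible ?W" using contr[OF order_refl convex_rect] by (simp add: below_region_def C_def)
  then obtain \<sigma>0 where \<sigma>0: "section_on E ?W \<sigma>0" using section_ex WL by blast
  define WR WL' where "WR = overhead C \<inter> (Pt i ` (rect s a \<inter> {p. Im p < 0}) \<times> {..<zm})"
    and "WL' = overhead C \<inter> (Pt i ` (rect s a \<inter> {p. 0 < Im p}) \<times> {..<zm})"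
  have conn: "connected WR" "connected WL'"
    unfolding WR_def WL'_def by (intro contractible_imp_connected contr convex_rect_half; blast)+
  have subW: "WR \<subseteq> ?W" "WL' \<subseteq> ?W" by (auto simp: WR_def WL'_def W)
  have subT: "WR \<subseteq> T" "WL' \<subseteq> T"
  proof -
    show "WR \<subseteq> T"
    proof
      fix p assume p: "p \<in> WR"
      then obtain w where "w \<in> rect s a" "Im w < 0" "fst p = Pt i w" by (auto simp: WR_def mem_Times_iff)
      then show "p \<in> T" using WT[of p w] p subW by auto
    qed
    show "WL' \<subseteq> T"
    proof
      fix p assume p: "p \<in> WL'"
      then obtain w where "w \<in> rect s a" "0 < Im w" "fst p = Pt i w" by (auto simp: WL'_def mem_Times_iff)
      then show "p \<in> T" using WT[of p w] p subW by auto
    qed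
  qed
  have disj: "WR \<inter> L = {}" "WL' \<inter> L = {}" using subW WL by blast+
  obtain k where k: "k \<in> G" "\<forall>p\<in>WR. \<sigma>T p = k (\<sigma>0 p)"
    using section_eq[OF conn(1) disj(1) section_on_subset[OF \<sigma>0 subW(1)] section_on_subset[OF section_\<sigma>T subT(1)]] by blast
  define \<sigma>W where "\<sigma>W p = k (\<sigma>0 p)" for p
  have \<sigma>W: "section_on E ?W \<sigma>W" unfolding \<sigma>W_def by (rule section_act[OF k(1) WL \<sigma>0])
  have R: "\<sigma>W p = \<sigma>T p" if "p \<in> WR" for p using k that by (simp add: \<sigma>W_def)
  obtain m where m: "m \<in> G" "\<forall>p\<in>WL'. \<sigma>W p = m (\<sigma>T p)"
    using section_eq[OF conn(2) disj(2) section_on_subset[OF section_\<sigma>T subT(2)] section_on_subset[OF \<sigma>W subW(2)]] by blast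
  have "m = g"
  proof -
    \<comment> \<open>A connected slab that meets both sides of the strand and lies in the lower
      part of the tube box as well as in the passage. One deck transformation compares the two
      sections over it, and the values on the right identify it as the identity.\<close>
    define O' where "O' = {p. \<bar>Re (fst p) - s\<bar> < a \<and> \<bar>Im (fst p)\<bar> < a \<and> \<bar>snd p - (- (7/8) * c1)\<bar> < c1 / 8}"
    have "O' = {p. \<bar>Re (fst p) - s\<bar> < a} \<inter> ({p. \<bar>Im (fst p) - 0\<bar> < a} \<inter> {p. \<bar>snd p - (- (7/8) * c1)\<bar> < c1 / 8})"
      by (auto simp: O'_def)
    then have "convex O'" by (simp only: convex_Int convex_abs_less linear_coords)
    then have cO: "connected (Tb i ` O')"
      by (intro connected_continuous_image continuous_on_Tb[OF i] convex_connected)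
    have O'z: "- c1 < snd p \<and> snd p < - (3/4) * c1" if "p \<in> O'" for p usingthat
    proof -
      have "\<bar>snd p - (- (7/8) * c1)\<bar> < c1 / 8" using that unfolding O'_def by blast
      then show ?thesis by linarith
    qed
    have OL: "O' \<subseteq> bx s a0 \<inter> lower"
    proof
      fix p assume p: "p \<in> O'"
      from O'z[OF p] have "\<bar>snd p\<bar> < a0" "snd p < 0" using c1 by auto
      then show "p \<in> bx s a0 \<inter> lower" using p a by (auto simp: O'_def bx_def lower_def)
    qed
    have OW: "Tb i p \<in> ?W" if p: "p \<in> O'" for p
    proof -
      have r: "fst p \<in> rect s a" using p by (auto simp: O'_def rect_def)
      have "D i (Re (fst p)) \<in> N" using aN p by (simp add: O'_def)
      then have "\<bar>snd (D i (Re (fst p))) - z\<bar> < c1 / 4" unfolding N_def by blast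
      then have *: "z - c1 / 4 < snd (D i (Re (fst p)))" "snd (D i (Re (fst p))) < z + c1 / 4"
        by linarith+
      then have h: "snd (Tb i p) < zm" "zl < snd (Tb i p)"
        using O'z[OF p] z12(4) c1 d unfolding tube_def zm_def snd_conv by linarith+
      then have "Tb i p \<in> overhead C" by (auto simp: overhead_def C_def)
      then show ?thesis using r h by (simp add: W fst_Tb)
    qed
    have dO: "Tb i ` O' \<inter> L = {}" using OW WL by blast
    obtain k' where k': "k' \<in> G" "\<forall>p\<in>Tb i ` O'. \<sigma>W p = k' (\<sigma> p)"
      using section_eq[OF cO dO section_on_subset[OF \<sigma>(1) image_mono[OF OL]] section_on_subset[OF \<sigma>W]] OW by blast
    let ?p = "(Complex s (- a / 2), - (7/8) * c1)" and ?q = "(Complex s (a / 2), - (7/8) * c1)"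
    have p: "?p \<in> O'" and q: "?q \<in> O'" using a c1 by (auto simp: O'_def)
    have pb: "?p \<in> bx s a0" "?q \<in> bx s a0" using OL p q by blast+
    have "Tb i ?p \<in> WR"
      using OW[OF p] a by (auto simp: W WR_def mem_Times_iff fst_Tb rect_def intro!: imageI)
    moreover have "Tb i ?q \<in> WL'"
      using OW[OF q] a by (auto simp: W WL'_def mem_Times_iff fst_Tb rect_def intro!: imageI)
    ultimately have e: "\<sigma>W (Tb i ?p) = \<sigma>T (Tb i ?p)" "\<sigma>W (Tb i ?q) = m (\<sigma>T (Tb i ?q))"
      using R m(2) by blast+
    have e2: "\<sigma> (Tb i ?p) = \<sigma>T (Tb i ?p)" "\<sigma> (Tb i ?q) = g (\<sigma>T (Tb i ?q))"
      using bspec[OF \<sigma>(2) pb(1)] bspec[OF \<sigma>(3) pb(2)] a by simp_all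
    have e3: "\<sigma>W (Tb i ?p) = k' (\<sigma> (Tb i ?p))" "\<sigma>W (Tb i ?q) = k' (\<sigma> (Tb i ?q))"
      using bspec[OF k'(2) imageI[OF p]] bspec[OF k'(2) imageI[OF q]] by blast+
    have nl: "Tb i ?p \<notin> L" "Tb i ?q \<notin> L" using dO p q by blast+
    have TE: "\<sigma>T (Tb i ?p) \<in> E (Tb i ?p)" "\<sigma>T (Tb i ?q) \<in> E (Tb i ?q)"
      using section_\<sigma>T \<open>Tb i ?p \<in> WR\<close> \<open>Tb i ?q \<in> WL'\<close> subT unfolding section_on_def by blast+
    have "k' (\<sigma>T (Tb i ?p)) = id (\<sigma>T (Tb i ?p))" using e(1) e2(1) e3(1) by simp
    then have "k' = id" by (rule free_G[OF k'(1) id_G nl(1) TE(1)])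
    then have "m (\<sigma>T (Tb i ?q)) = g (\<sigma>T (Tb i ?q))" using e(2) e2(2) e3(2) by simp
    then show ?thesis by (rule free_G[OF m(1) gG nl(2) TE(2)])
  qed
  show thesis
  proof (rule that[OF a(1,2) z12(1,2) _ \<sigma>W WL WT])
    show "zm < snd (D i s)" using z12 by (simp add: z_def)
    fix p q assume p: "p \<in> ?W" "fst p = Pt i q" "q \<in> rect s a"
    show "\<sigma>W p = \<sigma>T p" if "Im q < 0"
    proof (rule R)
      show "p \<in> WR" using p that by (auto simp: W WR_def mem_Times_iff)
    qed
    show "\<sigma>W p = g (\<sigma>T p)" if "0 < Im q"
    proof -
      have "p \<in> WL'" using p that by (auto simp: W WL'_def mem_Times_iff)
      then show ?thesis using m(2) \<open>m = g\<close> by blast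
    qed
  qed
qed

text \<open>Beneath the over strand, the monodromy \<open>m\<close> of the under strand relative to
  \<open>\<sigma>W\<close> is the same on both sides of the crossing. On the right
  \<open>\<sigma>W\<close> is \<open>\<sigma>T\<close>; on the left it is \<open>g\<close> after
  \<open>\<sigma>T\<close>, which conjugates \<open>m\<close> into \<open>m'\<close>. Visibility of
  the under strand near the crossing is included because it later shows that every component has an
  arc.\<close>

lemma wirtinger:
  assumes c: "crossing I D i s j t" and g: "mon \<sigma>T i s g"
  shows "\<exists>m m'. m \<in> G \<and> m' \<in> G \<and> m \<circ> g = g \<circ> m' \<and>
    (\<forall>\<^sub>F t' in at t. top_at j t' \<and>
       (plane_det (plane_velocity D i s) (plane_velocity D j t) * (t' - t) < 0 \<longrightarrow> mon \<sigma>T j t' m) \<and>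
       (plane_det (plane_velocity D i s) (plane_velocity D j t) * (t' - t) > 0 \<longrightarrow> mon \<sigma>T j t' m'))"
proof -
  let ?d = "plane_det (plane_velocity D i s) (plane_velocity D j t)"
  have i: "i \<in> I" and j: "j \<in> I" and eq: "fst (D i s) = fst (D j t)" and lt: "snd (D j t) < snd (D i s)"
    using c by (auto simp: crossing_def)
  have hyp: "q = D i s \<or> snd q \<le> snd (D j t)" if "q \<in> L" "fst q = fst (D i s)" for q
    using triple[OF c that] by auto
  obtain a zl zm \<sigma>W where a: "0 < a" "a \<le> rad" and z: "snd (D j t) < zl" "zl < zm" "zm < snd (D i s)"
    and \<sigma>W: "section_on E (below_region i s a zl zm) \<sigma>W"
    and WdL: "below_region i s a zl zm \<inter> L = {}"
    and WT: "\<And>p q. p \<in> below_region i s a zl zm \<Longrightarrow> fst p = Pt i q \<Longrightarrow> q \<in> rect s a \<Longrightarrow> Im q \<noteq> 0 \<Longrightarrow> p \<in> T"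
    and WR: "\<And>p q. p \<in> below_region i s a zl zm \<Longrightarrow> fst p = Pt i q \<Longrightarrow> q \<in> rect s a \<Longrightarrow> Im q < 0 \<Longrightarrow> \<sigma>W p = \<sigma>T p"
    and WL: "\<And>p q. p \<in> below_region i s a zl zm \<Longrightarrow> fst p = Pt i q \<Longrightarrow> q \<in> rect s a \<Longrightarrow> 0 < Im q \<Longrightarrow> \<sigma>W p = g (\<sigma>T p)"
  proof (rule over_region[OF i g lt])
    show "q = D i s \<or> snd q \<le> snd (D j t)" if "q \<in> L" "fst q = fst (D i s)" for q by (rule hyp[OF that])
  qed (rule that)
  let ?W = "below_region i s a zl zm"
  have gG: "g \<in> G" using mon_G[OF g] .
  obtain h where h: "h \<in> G" "h \<circ> g = id" "g \<circ> h = id" using inv_G[OF gG] by blast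
  have sub: "rect s a \<subseteq> rect s rad" using a by (intro rect_mono) simp
  define Nu where "Nu U = {p::complex \<times> real. fst p \<in> Pt i ` U \<and> snd p < zm}" for U
  have Nu_open: "open (Nu U)" if "open U" "U \<subseteq> rect s a" for U
  proof -
    have "open (Pt i ` U)" using that sub by (intro open_Pt[OF i]) auto
    moreover have "Nu U = Pt i ` U \<times> {..<zm}" by (auto simp: Nu_def)
    ultimately show ?thesis by (simp add: open_Times)
  qed
  have PN: "D j t \<in> Nu (rect s a)"
  proof -
    have "fst (D j t) = Pt i (Complex s 0)" using eq by (simp add: ptube_def)
    moreover have "Complex s 0 \<in> rect s a" using a by (simp add: rect_def)
    ultimately show ?thesis using z by (auto simp: Nu_def)
  qed
  define C where "C = L \<inter> {q. snd q \<le> zl}"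
  have "closed {q::complex \<times> real. snd q \<le> zl}" by (intro closed_Collect_le continuous_intros)
  then have C: "compact C" "C \<subseteq> L" unfolding C_def using compact_L by (auto intro: compact_Int_closed)
  obtain a' where a': "a' > 0" "a' \<le> rad" "Tb j ` bx t a' \<subseteq> Nu (rect s a)" "Tb j ` (bx t a' \<inter> upper) \<subseteq> overhead C"
  proof (rule top_box[OF j C _ Nu_open[OF open_rect order_refl] PN])
    show "snd q \<le> snd (D j t)" if "q \<in> C" "fst q = fst (D j t)" for q
      using hyp[of q] that eq z by (auto simp: C_def)
  qed blast
  have inW: "Tb j p \<in> ?W" if p: "p \<in> bx t a'" "p \<in> upper" for p
  proof -
    have "Tb j p \<in> Nu (rect s a)" "Tb j p \<in> overhead C" using a'(3,4) p by blast+
    then show ?thesis by (auto simp: below_region_def C_def Nu_def mem_Times_iff)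
  qed
  have "section_on E (Tb j ` (bx t a' \<inter> upper)) \<sigma>W" by (rule section_on_subset[OF \<sigma>W]) (use inW in blast)
  then obtain m where m: "mon \<sigma>W j t m" using mon_ex[OF j a'(1,2)] by blast
  obtain e where e: "e > 0" "\<And>t'. \<bar>t' - t\<bar> < e \<Longrightarrow> mon \<sigma>W j t' m" using mon_near[OF j m] by blast
  have vel: "((\<lambda>t. fst (D j t)) has_vector_derivative plane_velocity D j t) (at t)" by (rule LD(5)[OF j])
  have ev1: "\<forall>\<^sub>F t' in at t. \<exists>q\<in>rect s a. Pt i q = fst (D j t') \<and> Im q * (t' - t) * ?d > 0"
    by (rule crossing_side[OF i vel eq[symmetric] crossing_det[OF c] a])
  have ev2: "\<forall>\<^sub>F t' in at t. \<bar>t' - t\<bar> < min e a'"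
    unfolding eventually_at using e(1) a'(1) by (intro exI[of _ "min e a'"]) (simp add: dist_real_def)
  have mG: "m \<in> G" using mon_G[OF m] .
  show ?thesis
  proof (rule exI[of _ m], rule exI[of _ "h \<circ> m \<circ> g"], intro conjI)
    show "m \<in> G" "h \<circ> m \<circ> g \<in> G" using mG h gG by (auto intro: comp_G)
    have gh: "g (h x) = x" for x using h(3) by (metis comp_apply id_apply)
    show "m \<circ> g = g \<circ> (h \<circ> m \<circ> g)" by (rule ext) (simp add: gh)
    show "\<forall>\<^sub>F t' in at t. top_at j t' \<and> (?d * (t' - t) < 0 \<longrightarrow> mon \<sigma>T j t' m) \<and>
       (?d * (t' - t) > 0 \<longrightarrow> mon \<sigma>T j t' (h \<circ> m \<circ> g))"
      using ev1 ev2
    proof eventually_elim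
      case (elim t')
      then obtain q where q: "q \<in> rect s a" "Pt i q = fst (D j t')" "Im q * (t' - t) * ?d > 0" by blast
      have t': "\<bar>t' - t\<bar> < e" "\<bar>t' - t\<bar> < a'" using elim(2) by auto
      \<comment> \<open>The side of the over strand on which \<open>D j t'\<close> lies. It is open,
        so a whole box around \<open>D j t'\<close> projects into it.\<close>
      define U where "U = (if Im q < 0 then rect s a \<inter> {p. Im p < 0} else rect s a \<inter> {p. 0 < Im p})"
      have Im0: "Im q \<noteq> 0" using q(3) by auto
      have U: "open U" "U \<subseteq> rect s a" unfolding U_def
        by (auto intro!: open_Int open_rect open_Collect_less continuous_intros)
      have "D j t' \<in> Nu (rect s a)" using a'(3) curve_in_box[OF t'(2), of j] by blast
      then have "snd (D j t') < zm" by (simp add: Nu_def)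
      moreover have "q \<in> U" using q(1) Im0 by (simp add: U_def)
      ultimately have PU: "D j t' \<in> Nu U" unfolding Nu_def using q(2) by (metis (mono_tags, lifting) imageI mem_Collect_eq)
      obtain a2 where a2: "a2 > 0" "a2 \<le> rad" "Tb j ` bx t' a2 \<subseteq> Nu U"
        using box_in_open[OF j Nu_open[OF U] PU] by blast
      define a3 where "a3 = min a2 (a' - \<bar>t' - t\<bar>)"
      have a3: "a3 > 0" and s3: "bx t' a3 \<subseteq> bx t' a2" "bx t' a3 \<subseteq> bx t a'"
        using a2 t' by (auto simp: a3_def intro!: bx_mono)
      have near: "Tb j p \<in> T \<and> (Im q < 0 \<longrightarrow> \<sigma>W (Tb j p) = \<sigma>T (Tb j p)) \<and> (0 < Im q \<longrightarrow> \<sigma>W (Tb j p) = g (\<sigma>T (Tb j p)))"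
        if p: "p \<in> bx t' a3" "p \<in> upper" for p
      proof -
        have "Tb j p \<in> Nu U" using p s3 a2 by blast
        then obtain w where w: "w \<in> U" "fst (Tb j p) = Pt i w" by (auto simp: Nu_def)
        have wr: "w \<in> rect s a" "Im w \<noteq> 0" "Im q < 0 \<Longrightarrow> Im w < 0" "0 < Im q \<Longrightarrow> 0 < Im w"
          using w(1) Im0 by (auto simp: U_def split: if_splits)
        have pW: "Tb j p \<in> ?W" using inW p s3 by blast
        show ?thesis using WT[OF pW w(2) wr(1,2)] WR[OF pW w(2) wr(1)] WL[OF pW w(2) wr(1)] wr(3,4) by blast
      qed
      have top: "top_at j t'" unfolding top_at_def
      proof (intro ballI impI)
        fix r assume r: "r \<in> L" "fst r = fst (D j t')"
        show "snd r \<le> snd (D j t')"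
        proof (rule ccontr)
          assume "\<not> snd r \<le> snd (D j t')"
          \<comment> \<open>If \<open>r\<close> were over \<open>D j t'\<close>, a point slightly
            above \<open>D j t'\<close> and not above \<open>r\<close> would belong to
            \<open>T\<close>, which \<open>r\<close> forbids.\<close>
          define y where "y = min (a3 / 2) (snd r - snd (D j t'))"
          have y: "y > 0" "y < a3" "y \<le> snd r - snd (D j t')" using a3 \<open>\<not> snd r \<le> snd (D j t')\<close> by (auto simp: y_def)
          let ?p = "(Complex t' 0, y)"
          have "?p \<in> bx t' a3" "?p \<in> upper" using y by (auto simp: bx_def upper_def)
          then have "Tb j ?p \<in> T" using near by blast
          moreover have "fst (Tb j ?p) = fst r" "snd (Tb j ?p) = snd (D j t') + y" using r(2) by (auto simp: tube_def ptube_def)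
          ultimately have "snd r < snd (D j t') + y" using r(1) unfolding T_def overhead_def by auto
          then show False using y by simp
        qed
      qed
      have 1: "mon \<sigma>T j t' m" if "?d * (t' - t) < 0"
      proof -
        have "Im q < 0" using q(3) that by (simp add: zero_less_mult_iff mult_less_0_iff) argo
        then have "mon \<sigma>T j t' (id \<circ> m \<circ> id)"
          using near by (intro mon_cong[OF j e(2)[OF t'(1)] id_G id_G _ a3]) auto
        then show ?thesis by simp
      qed
      have 2: "mon \<sigma>T j t' (h \<circ> m \<circ> g)" if "?d * (t' - t) > 0"
      proof -
        have Imq: "0 < Im q" using q(3) that by (simp add: zero_less_mult_iff mult_less_0_iff) argo
        show ?thesis
        proof (rule mon_cong[OF j e(2)[OF t'(1)] h(1) gG h(3) a3])
          fix p assume "p \<in> bx t' a3" "p \<in> upper"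
          then have "\<sigma>W (Tb j p) = g (\<sigma>T (Tb j p))" using near Imq by blast
          then show "\<sigma>T (Tb j p) = h (\<sigma>W (Tb j p))" using h(2) by (metis comp_apply id_apply)
        qed
      qed
      show ?case using top 1 2 by blast
    qed
  qed
qed

end

section \<open>Winding numbers as counts of crossings\<close>

text \<open>The coordinate in the normal plane, with left as the real and up as the imaginary
  direction.\<close>

definition transv :: "complex \<times> real \<Rightarrow> complex"
  where "transv p = Complex (Im (fst p)) (snd p)"

text \<open>\<open>log_lower\<close> is cut along the upward and \<open>log_upper\<close> along the
  downward imaginary axis, so they are continuous along paths that pass below, respectively above,
  the strand. They agree on the left of it and differ by one period on the right.\<close>

definition log_lower :: "complex \<Rightarrow> complex" where "log_lower w = Ln (\<i> * w) - \<i> * (pi / 2)"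
definition log_upper :: "complex \<Rightarrow> complex" where "log_upper w = Ln (- \<i> * w) + \<i> * (pi / 2)"

lemma exp_log_lower: "w \<noteq> 0 \<Longrightarrow> exp (log_lower w) = w"
proof -
  have "exp (\<i> * (pi / 2)) = \<i>" by (metis cis_conv_exp cis_pi_half of_real_numeral of_real_divide)
  then show "w \<noteq> 0 \<Longrightarrow> exp (log_lower w) = w" by (simp add: log_lower_def exp_diff)
qed

lemma exp_log_upper: "w \<noteq> 0 \<Longrightarrow> exp (log_upper w) = w"
proof -
  have "exp (\<i> * (pi / 2)) = \<i>" by (metis cis_conv_exp cis_pi_half of_real_numeral of_real_divide)
  then show "w \<noteq> 0 \<Longrightarrow> exp (log_upper w) = w" by (simp add: log_upper_def exp_add algebra_simps)
qed

lemma log_upper_eq: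
  assumes "Re w \<noteq> 0"
  shows "log_upper w = log_lower w + (if Re w < 0 then 2 * pi * \<i> else 0)"
proof -
  have w: "w \<noteq> 0" "- w \<noteq> 0" using assms by auto
  have "Ln (- \<i> * w) = Ln (\<i> * (- w))" by simp
  also have "\<dots> = (if 0 \<le> Re (- w) | Im (- w) < 0 then Ln (- w) + \<i> * (pi / 2) else Ln (- w) - \<i> * (3 * pi / 2))"
    using Ln_times_ii[OF w(2)] by (simp add: algebra_simps)
  finally show ?thesis
    unfolding log_upper_def log_lower_def Ln_times_ii[OF w(1)] Ln_minus[OF w(1)] using assms
    by (auto simp: algebra_simps complex_eq_iff)
qed

lemma continuous_on_log_transv:
  "continuous_on lower (\<lambda>p. log_lower (transv p))" "continuous_on upper (\<lambda>p. log_upper (transv p))"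
proof -
  have t: "continuous_on S transv" for S
    unfolding transv_def Complex_eq by (intro continuous_intros)
  have 1: "\<i> * transv p \<notin> \<real>\<^sub>\<le>\<^sub>0" if "p \<in> lower" for p
    using that by (auto simp: lower_def transv_def complex_nonpos_Reals_iff)
  have 2: "- \<i> * transv p \<notin> \<real>\<^sub>\<le>\<^sub>0" if "p \<in> upper" for p
    using that by (auto simp: upper_def transv_def complex_nonpos_Reals_iff)
  show "continuous_on lower (\<lambda>p. log_lower (transv p))"
    unfolding log_lower_def by (intro continuous_intros t 1)
  show "continuous_on upper (\<lambda>p. log_upper (transv p))"
    unfolding log_upper_def by (intro continuous_intros t 2)
qed

text \<open>The difference takes its values in a discrete set, so connectedness makes it
  constant.\<close>

lemma logs_differ:
  fixes f g :: "'a::topological_space \<Rightarrow> complex"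
  assumes S: "connected S" and f: "continuous_on S f" and g: "continuous_on S g"
    and eq: "\<And>x. x \<in> S \<Longrightarrow> exp (f x) = exp (g x)"
  shows "\<exists>k::int. \<forall>x\<in>S. f x = g x + 2 * pi * \<i> * k"
proof -
  have ex: "\<exists>k::int. f x - g x = 2 * pi * \<i> * k" if "x \<in> S" for x
    using eq[OF that] unfolding exp_eq by (auto simp: algebra_simps)
  have "(\<lambda>x. f x - g x) constant_on S"
  proof (rule continuous_discrete_range_constant[OF S])
    show "continuous_on S (\<lambda>x. f x - g x)" by (intro continuous_intros f g)
    fix x assume x: "x \<in> S"
    have "2 * pi \<le> norm ((f y - g y) - (f x - g x))" if y: "y \<in> S" "f y - g y \<noteq> f x - g x" for y
    proof -
      obtain k l :: int where kl: "f x - g x = 2 * pi * \<i> * k" "f y - g y = 2 * pi * \<i> * l"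
        using ex x y(1) by meson
      then have "(f y - g y) - (f x - g x) = (2 * pi) *\<^sub>R (\<i> * of_int (l - k))"
        by (simp add: algebra_simps scaleR_conv_of_real)
      moreover have "l \<noteq> k" using kl y(2) by auto
      then have "1 \<le> \<bar>l - k\<bar>" by simp
      then have "1 \<le> \<bar>real_of_int (l - k)\<bar>" by linarith
      ultimately show ?thesis by (simp add: norm_mult flip: of_int_diff)
    qed
    then show "\<exists>e>0. \<forall>y. y \<in> S \<and> f y - g y \<noteq> f x - g x \<longrightarrow> e \<le> norm ((f y - g y) - (f x - g x))"
      by (intro exI[of _ "2 * pi"]) auto
  qed
  then obtain c where c: "\<And>x. x \<in> S \<Longrightarrow> f x - g x = c" unfolding constant_on_def by blast
  show ?thesis
  proof (cases "S = {}")
    case False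
    then obtain x0 where "x0 \<in> S" by blast
    then obtain k :: int where "c = 2 * pi * \<i> * k" using ex c by metis
    then show ?thesis using c by (metis diff_add_cancel add.commute)
  qed simp
qed

text \<open>The factor \<open>H\<close> has a logarithm on the convex box. Up to it and to constant
  periods the two continuations are \<open>log_lower\<close> and \<open>log_upper\<close>; agreement
  on the right makes the constants differ by one period, and on the left, where the branches
  coincide, this becomes visible.\<close>

lemma local_degree:
  fixes \<Lambda>d \<Lambda>u H :: "complex \<times> real \<Rightarrow> complex"
  assumes a: "0 < a" and d: "continuous_on (bx s a \<inter> lower) \<Lambda>d" and u: "continuous_on (bx s a \<inter> upper) \<Lambda>u"
    and H: "continuous_on (bx s a) H" "\<And>p. p \<in> bx s a \<Longrightarrow> H p \<noteq> 0"
    and ed: "\<And>p. p \<in> bx s a \<Longrightarrow> p \<in> lower \<Longrightarrow> exp (\<Lambda>d p) = transv p * H p"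
    and eu: "\<And>p. p \<in> bx s a \<Longrightarrow> p \<in> upper \<Longrightarrow> exp (\<Lambda>u p) = transv p * H p"
    and right: "\<And>p. p \<in> bx s a \<Longrightarrow> Im (fst p) < 0 \<Longrightarrow> \<Lambda>d p = \<Lambda>u p"
    and p: "p \<in> bx s a" "0 < Im (fst p)"
  shows "\<Lambda>d p = \<Lambda>u p + 2 * pi * \<i>"
proof -
  obtain \<eta> where \<eta>: "continuous_on (bx s a) \<eta>" "\<And>p. p \<in> bx s a \<Longrightarrow> H p = exp (\<eta> p)"
    using continuous_logarithm_on_contractible[OF H(1) convex_imp_contractible[OF convex_bx] H(2)] by blast
  have nz: "transv p \<noteq> 0" if "p \<in> lower \<or> p \<in> upper" for p
    using that by (auto simp: transv_def lower_def upper_def complex_eq_iff)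
  have "\<exists>k::int. \<forall>p\<in>bx s a \<inter> lower. \<Lambda>d p = (\<eta> p + log_lower (transv p)) + 2 * pi * \<i> * k"
  proof (rule logs_differ[OF _ d])
    show "connected (bx s a \<inter> lower)" by (intro contractible_imp_connected contractible_bx_lower a)
    show "continuous_on (bx s a \<inter> lower) (\<lambda>p. \<eta> p + log_lower (transv p))"
      by (intro continuous_on_add continuous_on_subset[OF \<eta>(1)] continuous_on_subset[OF continuous_on_log_transv(1)]) auto
    show "exp (\<Lambda>d x) = exp (\<eta> x + log_lower (transv x))" if "x \<in> bx s a \<inter> lower" for x
      using that ed \<eta>(2) nz by (simp add: exp_add exp_log_lower)
  qed
  then obtain k1 :: int where k1: "\<And>p. p \<in> bx s a \<Longrightarrow> p \<in> lower \<Longrightarrow> \<Lambda>d p = (\<eta> p + log_lower (transv p)) + 2 * pi * \<i> * k1" by blast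
  have "\<exists>k::int. \<forall>p\<in>bx s a \<inter> upper. \<Lambda>u p = (\<eta> p + log_upper (transv p)) + 2 * pi * \<i> * k"
  proof (rule logs_differ[OF _ u])
    show "connected (bx s a \<inter> upper)" by (intro contractible_imp_connected contractible_bx_upper a)
    show "continuous_on (bx s a \<inter> upper) (\<lambda>p. \<eta> p + log_upper (transv p))"
      by (intro continuous_on_add continuous_on_subset[OF \<eta>(1)] continuous_on_subset[OF continuous_on_log_transv(2)]) auto
    show "exp (\<Lambda>u x) = exp (\<eta> x + log_upper (transv x))" if "x \<in> bx s a \<inter> upper" for x
      using that eu \<eta>(2) nz by (simp add: exp_add exp_log_upper)
  qed
  then obtain k2 :: int where k2: "\<And>p. p \<in> bx s a \<Longrightarrow> p \<in> upper \<Longrightarrow> \<Lambda>u p = (\<eta> p + log_upper (transv p)) + 2 * pi * \<i> * k2" by blast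
  let ?q = "(Complex s (- a / 2), 0)"
  have q: "?q \<in> bx s a" "?q \<in> lower" "?q \<in> upper" "Im (fst ?q) < 0" "Re (transv ?q) < 0"
    using a by (auto simp: bx_def lower_def upper_def transv_def)
  have "log_lower (transv ?q) + 2 * pi * \<i> * k1 = log_lower (transv ?q) + 2 * pi * \<i> + 2 * pi * \<i> * k2"
    using right[OF q(1,4)] k1[OF q(1,2)] k2[OF q(1,3)] log_upper_eq[of "transv ?q"] q(5)
    by (simp add: algebra_simps)
  then have "2 * pi * \<i> * k1 = 2 * pi * \<i> + 2 * pi * \<i> * k2" by simp
  moreover have "p \<in> lower" "p \<in> upper" "Re (transv p) > 0" using p by (auto simp: lower_def upper_def transv_def)
  ultimately show ?thesis using k1[OF p(1)] k2[OF p(1)] log_upper_eq[of "transv p"] by (simp add: algebra_simps)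
qed

text \<open>The winding count below takes place in the complement of a single component; the sublink
  keeps the tubes of the whole link.\<close>

lemma diag_subset:
  assumes "diag I D nn b \<delta>" "J \<subseteq> I"
  shows "diag J D nn b \<delta>"
proof -
  interpret diag I D nn b \<delta> by (rule assms)
  have J: "i \<in> I" if "i \<in> J" for i using that assms(2) by blast
  have U: "(\<Union>i\<in>J. range (D i)) \<subseteq> (\<Union>i\<in>I. range (D i))" using J by blast
  have "link_diagram J D" unfolding link_diagram_def
  proof (intro conjI)
    show "finite J" using LD(1) assms(2) finite_subset by blast
    show "\<forall>i\<in>J. (\<forall>t. D i (t + 1) = D i t) \<and> D i C1_differentiable_on UNIV \<and> (\<forall>t. plane_velocity D i t \<noteq> 0)"
      using link J unfolding link_diagram_def by simp
    show "\<forall>i\<in>J. \<forall>j\<in>J. \<forall>s t. D i s = D j t\<longrightarrow> i = j \<and> s - t \<in> \<int>"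
    proof (intro ballI allI impI)
      fix i j s t assume ij: "i \<in> J" "j \<in> J" "D i s = D j t"
      then have "i = j" using LD(8)[OF J J] by blast
      then show "i = j \<and> s - t \<in> \<int>" using LD(9)[OF J[OF ij(1)]] ij(3) by simp
    qed
    have "\<forall>i\<in>I. \<forall>j\<in>I. \<forall>s t. D i s \<noteq> D j t \<and> fst (D i s) = fst (D j t) \<longrightarrow>
       plane_det (plane_velocity D i s) (plane_velocity D j t) \<noteq> 0"
      using link unfolding link_diagram_def by simp
then show "\<forall>i\<in>J. \<forall>j\<in>J. \<forall>s t. D i s \<noteq> D j t \<and> fst (D i s) = fst (D j t) \<longrightarrow>
       plane_det (plane_velocity D i s)(plane_velocity D j t) \<noteq> 0"
      using J by simp
    have "\<forall>p\<in>(\<Union>i\<in>I. range (D i)). \<forall>q\<in>(\<Union>i\<in>I. range (D i)). \<forall>r\<in>(\<Union>i\<in>I. range (D i)).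
       fst p = fst q \<and> fst q = fst r \<longrightarrow> p = q \<or> q = r \<or> p = r"
      using link unfolding link_diagram_def by simp
    then show "\<forall>p\<in>(\<Union>i\<in>J. range (D i)). \<forall>q\<in>(\<Union>i\<in>J. range (D i)). \<forall>r\<in>(\<Union>i\<in>J. range (D i)).
       fst p = fst q \<and> fst q = fst r \<longrightarrow> p = q \<or> q = r \<or> p = r"
      using U by (meson subsetD)
  qed
  then show ?thesis
    by (rule diag.intro) (fact b \<delta> | (erule J[THEN nn_cont]) | (erule J[THEN nn_per]) | (erule J[THEN nn_det])
      | (rule ptube_inj[OF J]; assumption) | (rule tube_inj[OF J J]; assumption))+
qed

section \<open>The covering by the logarithms of a function, and the count of crossings\<close>

definition period_shifts :: "(complex \<Rightarrow> complex) set"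
  where "period_shifts = range (\<lambda>(k::int) z. z + 2 * pi * \<i> * k)"

lemma log_cover:
  assumes "diag I D nn b \<delta>" and F: "continuous_on (- link_of I D) F" "\<And>p. p \<notin> link_of I D \<Longrightarrow> F p \<noteq> 0"
  shows "cover I D nn b \<delta> (\<lambda>p. {z. exp z = F p}) period_shifts"
proof -
  interpret diag I D nn b \<delta> by (rule assms)
  show ?thesis
  proof
    show "g \<circ> h \<in> period_shifts" if gh: "g \<in> period_shifts" "h \<in> period_shifts" for g h
    proof -
      obtain k l :: int where "g = (\<lambda>z. z + 2 * pi * \<i> * k)" "h = (\<lambda>z. z + 2 * pi * \<i> * l)"
        using gh unfolding period_shifts_def by blast
      then have "g \<circ> h = (\<lambda>z. z + 2 * pi * \<i> * of_int (k + l))" by (auto simp: fun_eq_iff algebra_simps)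
      then show ?thesis unfolding period_shifts_def by blast
    qed
    show "id \<in> period_shifts" unfolding period_shifts_def by (intro image_eqI[of _ _ 0]) (auto simp: fun_eq_iff)
    show "\<exists>h\<in>period_shifts. h \<circ> g = id \<and> g \<circ> h = id" if "g \<in> period_shifts" for g
    proof -
      obtain k :: int where "g = (\<lambda>z. z + 2 * pi * \<i> * k)" using \<open>g \<in> period_shifts\<close> unfolding period_shifts_def by blast
      moreover have "(\<lambda>z. z + 2 * pi * \<i> * of_int (- k)) \<in> period_shifts" unfolding period_shifts_def by (rule rangeI)
      ultimately show ?thesis by (intro bexI[of _ "\<lambda>z. z + 2 * pi * \<i> * of_int (- k)"]) (auto simp: fun_eq_iff)
    qed
    show "continuous_on UNIV g" if "g \<in> period_shifts" for g
      using that unfolding period_shifts_def by (auto intro!: continuous_intros)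
    show "g e \<in> {z. exp z = F p}" if "g \<in> period_shifts" "e \<in> {z. exp z = F p}" for g p e
    proof -
      obtain k :: int where "g = (\<lambda>z. z + 2 * pi * \<i> * k)" using \<open>g \<in> period_shifts\<close> unfolding period_shifts_def by blast
      then have "exp (g e) = exp e" unfolding exp_eq by auto
      then show ?thesis using that by simp
    qed
    show "g = h" if gh: "g \<in> period_shifts" "h \<in> period_shifts" "g e = h e" for g h e
    proof -
      obtain k l :: int where "g = (\<lambda>z. z + 2 * pi * \<i> * k)" "h = (\<lambda>z. z + 2 * pi * \<i> * l)"
        using gh unfolding period_shifts_def by blast
      then show ?thesis using gh(3) by simp
    qed
    show "\<exists>\<sigma>. section_on (\<lambda>p. {z. exp z = F p}) W \<sigma>" if W: "contractible W" "W \<inter> L = {}" for W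
    proof -
      have sub: "W \<subseteq> - link_of I D" using W(2) unfolding L_def by blast
      obtain g where "continuous_on W g" "\<And>x. x \<in> W \<Longrightarrow> F x = exp (g x)"
        using continuous_logarithm_on_contractible[OF continuous_on_subset[OF F(1) sub] W(1)] F(2) sub by blast
      then show ?thesis unfolding section_on_def by (intro exI[of _ g]) auto
    qed
    show "\<exists>g\<in>period_shifts. \<forall>p\<in>W. \<tau> p = g (\<sigma> p)"
      if W: "connected W" and "section_on (\<lambda>p. {z. exp z = F p}) W \<sigma>" "section_on (\<lambda>p. {z. exp z = F p}) W \<tau>" for W \<sigma> \<tau>
    proof -
      have "\<exists>k::int. \<forall>x\<in>W. \<tau> x = \<sigma> x + 2 * pi * \<i> * k"
        using that unfolding section_on_def by (intro logs_differ) auto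
      then obtain k :: int where k: "\<And>x. x \<in> W \<Longrightarrow> \<tau> x = \<sigma> x + 2 * pi * \<i> * k" by blast
      have "(\<lambda>z. z + 2 * pi * \<i> * k) \<in> period_shifts" unfolding period_shifts_def by (rule rangeI)
      then show ?thesis using k by (intro bexI[of _ "\<lambda>z. z + 2 * pi * \<i> * k"]) auto
    qed
  qed
qed

text \<open>Winding number one around every meridian, phrased as a factorisation because this is
  what \<open>divisor_on\<close> delivers and \<open>local_degree\<close> consumes.\<close>

definition has_degree_one :: "('i \<Rightarrow> real \<Rightarrow> complex \<times> real) \<Rightarrow> ('i \<Rightarrow> real \<Rightarrow> complex) \<Rightarrow> 'i \<Rightarrow> (complex \<times> real \<Rightarrow> complex) \<Rightarrow> bool"
  where "has_degree_one D nn i F \<longleftrightarrow> (\<exists>c>0. \<exists>H. continuous_on {p. \<bar>Im (fst p)\<bar> < c \<and> \<bar>snd p\<bar> < c} H \<and>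
     (\<forall>p. \<bar>Im (fst p)\<bar> < c \<and> \<bar>snd p\<bar> < c \<longrightarrow> H p \<noteq> 0 \<and> F (tube D nn i p) = transv p * H p))"

lemma (in diag) degree_one_jump:
  assumes i: "i \<in> I" and F: "has_degree_one D nn i F" and a: "0 < a"
    and d: "continuous_on (bx s a \<inter> lower) \<Lambda>d" and u: "continuous_on (bx s a \<inter> upper) \<Lambda>u"
    and ed: "\<And>p. p \<in> bx s a \<Longrightarrow> p \<in> lower \<Longrightarrow> exp (\<Lambda>d p) = F (Tb i p)"
    and eu: "\<And>p. p \<in> bx s a \<Longrightarrow> p \<in> upper \<Longrightarrow> exp (\<Lambda>u p) = F (Tb i p)"
    and right: "\<And>p. p \<in> bx s a \<Longrightarrow> Im (fst p) < 0 \<Longrightarrow> \<Lambda>d p = \<Lambda>u p"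
  shows "\<exists>p\<in>bx s a. 0 < Im (fst p) \<and> \<Lambda>d p = \<Lambda>u p + 2 * pi * \<i>"
proof -
  obtain c H where c: "c > 0" "continuous_on {p. \<bar>Im (fst p)\<bar> < c \<and> \<bar>snd p\<bar> < c} H"
    "\<And>p. \<bar>Im (fst p)\<bar> < c \<Longrightarrow> \<bar>snd p\<bar> < c \<Longrightarrow> H p \<noteq> 0"
    "\<And>p. \<bar>Im (fst p)\<bar> < c \<Longrightarrow> \<bar>snd p\<bar> < c \<Longrightarrow> F (Tb i p) = transv p * H p"
    using F unfolding has_degree_one_def by blast
  define a' where "a' = min a c"
  have a': "a' > 0" and sub: "bx s a' \<subseteq> bx s a" and sub2: "bx s a' \<subseteq> {p. \<bar>Im (fst p)\<bar> < c \<and> \<bar>snd p\<bar> < c}"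
    using a c(1) by (auto simp: a'_def bx_def)
  let ?q = "(Complex s (a' / 2), 0)"
  have q: "?q \<in> bx s a'" "0 < Im (fst ?q)" using a' by (auto simp: bx_def)
  have "\<Lambda>d ?q = \<Lambda>u ?q + 2 * pi * \<i>"
  proof (rule local_degree[where H = H, OF a' _ _ _ _ _ _ _ q])
    show "continuous_on (bx s a' \<inter> lower) \<Lambda>d" "continuous_on (bx s a' \<inter> upper) \<Lambda>u"
      using d u sub by (auto elim!: continuous_on_subset)
    show "continuous_on (bx s a') H" by (rule continuous_on_subset[OF c(2) sub2])
    fix p assume p: "p \<in> bx s a'"
    then have pa: "p \<in> bx s a" "\<bar>Im (fst p)\<bar> < c" "\<bar>snd p\<bar> < c" using sub sub2 by blast+
    show "H p \<noteq> 0" using c(3) pa by blast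
    show "exp (\<Lambda>d p) = transv p * H p" if "p \<in> lower" using ed[OF pa(1) that] c(4)[OF pa(2,3)] by simp
    show "exp (\<Lambda>u p) = transv p * H p" if "p \<in> upper" using eu[OF pa(1) that] c(4)[OF pa(2,3)] by simp
    show "\<Lambda>d p = \<Lambda>u p" if "Im (fst p) < 0" using right[OF pa(1) that] .
  qed
  then show ?thesis using q sub by blast
qed

lemma (in diag) open_below_region:
  assumes "i \<in> I" "a \<le> rad"
  shows "open (below_region i s a zl zm)"
proof -
  have "closed {q::complex \<times> real. snd q \<le> zl}" by (intro closed_Collect_le continuous_intros)
  then have "compact (L \<inter> {q. snd q \<le> zl})" using compact_L by (rule compact_Int_closed[rotated])
  moreover have "rect s a \<subseteq> rect s rad" using assms by (intro rect_mono) simp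
  then have "open (Pt i ` rect s a)" using assms by (intro open_Pt open_rect)
  ultimately show ?thesis unfolding below_region_def by (intro open_Int open_overhead open_Times) auto
qed

lemma (in diag) mon_degree_one:
  assumes C: "cover {i} D nn b \<delta> (\<lambda>p. {z. exp z = F p}) period_shifts"
    and i: "i \<in> I" and F: "has_degree_one D nn i F"
    and g: "cover.mon D nn b \<delta> (\<lambda>p. {z. exp z = F p}) period_shifts \<sigma>0 i s g"
  shows "g = (\<lambda>z. z + 2 * pi * \<i>)"
proof -
  interpret C: cover "{i}" D nn b \<delta> "\<lambda>p. {z. exp z = F p}" period_shifts by (rule C)
  obtain a \<sigma> where a: "0 < a"
    and \<sigma>0: "section_on (\<lambda>p. {z. exp z = F p}) (Tb i ` (bx s a \<inter> upper)) \<sigma>0"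
    and \<sigma>: "section_on (\<lambda>p. {z. exp z = F p}) (Tb i ` (bx s a \<inter> lower)) \<sigma>"
    "\<forall>p\<in>bx s a. Im (fst p) < 0 \<longrightarrow> \<sigma> (Tb i p) = \<sigma>0 (Tb i p)"
    "\<forall>p\<in>bx s a. 0 < Im (fst p) \<longrightarrow> \<sigma> (Tb i p) = g (\<sigma>0 (Tb i p))" and gG: "g \<in> period_shifts"
    using g unfolding C.mon_def by blast
  have "\<exists>p\<in>bx s a. 0 < Im (fst p) \<and> \<sigma> (Tb i p) = \<sigma>0 (Tb i p) + 2 * pi * \<i>"
  proof (rule degree_one_jump[OF i F a])
    show "continuous_on (bx s a \<inter> lower) (\<lambda>p. \<sigma> (Tb i p))"
      using \<sigma>(1) unfolding section_on_def by (intro continuous_on_compose2[OF _ continuous_on_Tb[OF i]]) auto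
    show "continuous_on (bx s a \<inter> upper) (\<lambda>p. \<sigma>0 (Tb i p))"
      using \<sigma>0 unfolding section_on_def by (intro continuous_on_compose2[OF _ continuous_on_Tb[OF i]]) auto
    show "exp (\<sigma> (Tb i p)) = F (Tb i p)" if "p \<in> bx s a" "p \<in> lower" for p
      using \<sigma>(1) that unfolding section_on_def by simp
    show "exp (\<sigma>0 (Tb i p)) = F (Tb i p)" if "p \<in> bx s a" "p \<in> upper" for p
      using \<sigma>0 that unfolding section_on_def by simp
    show "\<sigma> (Tb i p) = \<sigma>0 (Tb i p)" if "p \<in> bx s a" "Im (fst p) < 0" for p using \<sigma>(2) that by blast
  qed
  then obtain p where p: "p \<in> bx s a" "0 < Im (fst p)" "\<sigma> (Tb i p) = \<sigma>0 (Tb i p) + 2 * pi * \<i>" by blast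
  obtain k :: int where k: "g = (\<lambda>z. z + 2 * pi * \<i> * k)" using gG unfolding period_shifts_def by blast
  have "\<sigma> (Tb i p) = g (\<sigma>0 (Tb i p))" using \<sigma>(3) p by blast
  then have "2 * pi * \<i> * k = 2 * pi * \<i>" using p(3) k by simp
  then have "k = 1" by simp
  then show ?thesis using k by simp
qed

text \<open>Only the component \<open>i\<close> is removed from space, so \<open>C.\<sigma>T\<close>
  is a logarithm of \<open>F\<close> on the region over that component. Its difference
  \<open>u\<close> from \<open>l\<close> along \<open>j\<close> is locally constant except where
  \<open>j\<close> passes under \<open>i\<close>; there it jumps by one period, with the sign of the
  crossing. After one turn of \<open>j\<close> the values of \<open>C.\<sigma>T\<close> return, so
  the change of \<open>l\<close> is the sum of the jumps.\<close>

lemma (in diag) winding_count: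
  assumes i: "i \<in> I" and j: "j \<in> I" and ij: "i \<noteq> j"
    and F: "continuous_on (- range (D i)) F" "\<And>p. p \<notin> range (D i) \<Longrightarrow> F p \<noteq> 0" "has_degree_one D nn i F"
    and l: "continuous_on UNIV l" "\<And>t. exp (l t) = F (D j t)"
  shows "l 1 - l 0 = 2 * pi * \<i> * of_int (signed_crossings I D i j)"
proof -
  let ?E = "\<lambda>p. {z. exp z = F p}"
  have Di: "link_of {i} D = range (D i)" by (simp add: link_of_def)
  have cov: "cover {i} D nn b \<delta> ?E period_shifts"
    by (rule log_cover) (use diag_subset[OF diag_axioms, of "{i}"] i F Di in auto)
  interpret C: cover "{i}" D nn b \<delta> ?E period_shifts by (rule cov)
  have CL: "C.L = range (D i)" by (simp add: C.L_def Di)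
  have ne: "D i s \<noteq> D j t" for s t using LD(8)[OF i j] ij by blast
  define X where "X = {t. \<exists>s. crossing I D i s j t}"
  have XT: "t \<in> X \<longleftrightarrow> D j t \<notin> C.T" for t
  proof -
    have "snd (D j t) < snd (D i s) \<longleftrightarrow> snd (D j t) \<le> snd (D i s)" if "fst (D i s) = fst (D j t)" for s
      using ne[of s t] that by (auto simp: less_le prod_eq_iff)
    then show ?thesis using i j unfolding X_def C.T_def CL overhead_def crossing_def by (auto simp: not_less)
  qed
  define sX where "sX t = (SOME s. s \<in> {0..<1} \<and> crossing I D i s j t)" for t
  have sX: "sX t \<in> {0..<1}" "crossing I D i (sX t) j t" if "t \<in> X" for t
  proof -
    obtain s where s: "crossing I D i s j t" using \<open>t \<in> X\<close> unfolding X_def by blast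
    have "D i (s + of_int (- \<lfloor>s\<rfloor>)) = D i s" by (rule periodic_shift[of "D i", OF LD(2)[OF i]])
    then have "crossing I D i (s + of_int (- \<lfloor>s\<rfloor>)) j t" using s unfolding crossing_def by simp
    moreover have "s + of_int (- \<lfloor>s\<rfloor>) \<in> {0..<1}" by simp linarith
    ultimately have "\<exists>s. s \<in> {0..<1} \<and> crossing I D i s j t" by blast
    from someI_ex[OF this] show "sX t \<in> {0..<1}" "crossing I D i (sX t) j t" unfolding sX_def by auto
  qed
  define jmp :: "real \<Rightarrow> int" where
    "jmp t = (if t \<notin> X then 0 else if crossing_positive D i (sX t) j t then 1 else - 1)" for t
  define u where "u t = l t - C.\<sigma>T (D j t)" for t
  have contD: "continuous_on S (D j)" for S using LD(4)[OF j] continuous_on_subset by blast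
  have const: "\<exists>\<kappa>. \<forall>t. \<bar>t - x\<bar> < e \<longrightarrow> l t - \<sigma> (D j t) = \<kappa>"
    if W: "section_on ?E W \<sigma>" and e: "\<And>t. \<bar>t - x\<bar> < e \<Longrightarrow> D j t \<in> W" for W \<sigma> x e
  proof -
    have "\<exists>k::int. \<forall>t\<in>{t. \<bar>t - x\<bar> < e}. l t = \<sigma> (D j t) + 2 * pi * \<i> * k"
    proof (rule logs_differ)
      have "convex {t. \<bar>(\<lambda>t. t) t - x\<bar> < e}" by (rule convex_abs_less) (simp add: linear_iff)
      then show "connected {t. \<bar>t - x\<bar> < e}" by (simp add: convex_connected)
      show "continuous_on {t. \<bar>t - x\<bar> < e} l" using l(1) continuous_on_subset by blast
      show "continuous_on {t. \<bar>t - x\<bar> < e} (\<lambda>t. \<sigma> (D j t))"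
        using W e unfolding section_on_def by (intro continuous_on_compose2[OF _ contD]) auto
      show "exp (l t) = exp (\<sigma> (D j t))" if "t \<in> {t. \<bar>t - x\<bar> < e}" for t
        using W e[of t] l(2)[of t] that unfolding section_on_def by simp
    qed
    then obtain k :: int where "\<forall>t\<in>{t. \<bar>t - x\<bar> < e}. l t = \<sigma> (D j t) + 2 * pi * \<i> * k" by blast
    then show ?thesis by (intro exI[of _ "2 * pi * \<i> * k"]) auto
  qed
  have nbhd: "\<exists>e>0. \<forall>t. \<bar>t - x\<bar> < e \<longrightarrow> D j t \<in> W" if W: "open W" "D j x \<in> W" for W x
  proof -
    have "open (D j -` W)"using contD[of UNIV] W(1) open_vimage by blast
    then obtain e where "e > 0" "ball x e \<subseteq> D j -` W"using W(2) open_contains_ball by (metis vimageI)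
    then show ?thesis by (intro exI[of _ e]) (auto simp: subset_iff dist_real_def abs_minus_commute)
  qed
  have local: "\<exists>e>0. \<exists>\<kappa>. (\<forall>t. t \<noteq> x \<and> \<bar>t - x\<bar> < e \<longrightarrow> t \<notin> X) \<and>
      (\<forall>t. x - e < t \<and> t < x \<longrightarrow> u t = \<kappa>) \<and> (\<forall>t. x < t \<and> t < x + e \<longrightarrow> u t = \<kappa> + 2 * pi * \<i> * jmp x)" for x
  proof (cases "x \<in> X")
    case False
    have "open C.T" unfolding C.T_def by (rule open_overhead[OF C.compact_L])
    moreover have "D j x \<in> C.T" using False XT by blast
    ultimately obtain e where e: "e > 0" "\<And>t. \<bar>t - x\<bar> < e \<Longrightarrow> D j t \<in> C.T" using nbhd by blast
    obtain \<kappa> where "\<And>t. \<bar>t - x\<bar> < e \<Longrightarrow> l t - C.\<sigma>T (D j t) = \<kappa>" using const[OF C.section_\<sigma>T e(2)] by blast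
    then have \<kappa>: "u t = \<kappa>" if "\<bar>t - x\<bar> < e" for t using that by (simp add: u_def)
    have "jmp x = 0" using False by (simp add: jmp_def)
    then show ?thesis using e \<kappa> XT by (intro exI[of _ e] conjI exI[of _ \<kappa>]) auto
  next
    case True
    define s where "s = sX x"
    have cr: "crossing I D i s j x" using sX[OF True] by (simp add: s_def)
    let ?d = "plane_det (plane_velocity D i s) (plane_velocity D j x)"
    have eq: "fst (D j x) = fst (D i s)" and lt: "snd (D j x) < snd (D i s)" using cr by (auto simp: crossing_def)
    have only: "q = D i s" if "q \<in> C.L" "fst q = fst (D i s)" for q
    proof -
      have "q \<in> L" using that(1) i unfolding CL in_L by blast
      moreover have "q \<noteq> D j x" using that(1) ne unfolding CL by force
      ultimately show ?thesis using triple[OF cr _ that(2)] by blast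
    qed
    have "C.top_at i s" unfolding C.top_at_def using only by (metis order_refl)
    then obtain g where g: "C.mon C.\<sigma>T i s g" using C.mon_top_ex by blast
    have gs: "g = (\<lambda>z. z + 2 * pi * \<i>)" by (rule mon_degree_one[OF cov i F(3) g])
    obtain a zl zm \<sigma>W where a: "0 < a" "a \<le> C.rad" and z: "snd (D j x) < zl" "zl < zm" "zm < snd (D i s)"
      and \<sigma>W: "section_on ?E (C.below_region i s a zl zm) \<sigma>W"
      and WdL: "C.below_region i s a zl zm \<inter> C.L = {}"
      and WT: "\<And>p q. p \<in> C.below_region i s a zl zm \<Longrightarrow> fst p = Pt i q \<Longrightarrow> q \<in> rect s a \<Longrightarrow> Im q \<noteq> 0 \<Longrightarrow> p \<in> C.T"
      and WR: "\<And>p q. p \<in> C.below_region i s a zl zm \<Longrightarrow> fst p = Pt i q \<Longrightarrow> q \<in> rect s a \<Longrightarrow> Im q < 0 \<Longrightarrow> \<sigma>W p = C.\<sigma>T p"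
      and WL: "\<And>p q. p \<in> C.below_region i s a zl zm \<Longrightarrow> fst p = Pt i q \<Longrightarrow> q \<in> rect s a \<Longrightarrow> 0 < Im q \<Longrightarrow> \<sigma>W p = g (C.\<sigma>T p)"
    proof (rule C.over_region[OF _ g lt])
      show "q = D i s \<or> snd q \<le> snd (D j x)" if "q \<in> C.L" "fst q = fst (D i s)" for q using only[OF that] by simp
    qed (simp, rule that)
    let ?W = "C.below_region i s a zl zm"
    have rr: "C.rad = rad" unfolding C.rad_def rad_def ..
    have xW: "D j x \<in> ?W"
    proof -
      have "D j x \<in> overhead (C.L \<inter> {q. snd q \<le> zl})"
        unfolding overhead_def
      proof (intro CollectI ballI impI)
        fix q assume q: "q \<in> C.L \<inter> {q. snd q \<le> zl}" "fst q = fst (D j x)"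
        then have "q = D i s" using only eq by simp
        then show "snd q < snd (D j x)" using q(1) z by simp
      qed
      moreover have "fst (D j x) = Pt i (Complex s 0)" using eq by (simp add: ptube_def)
      moreover have "Complex s 0 \<in> rect s a" using a by (simp add: rect_def)
      ultimately show ?thesis using z by (auto simp: C.below_region_def mem_Times_iff)
    qed
    obtain e1 where e1: "e1 > 0" "\<And>t. \<bar>t - x\<bar> < e1 \<Longrightarrow> D j t \<in> ?W"
      using nbhd[OF C.open_below_region xW] a by auto
    have vel: "((\<lambda>t. fst (D j t)) has_vector_derivative plane_velocity D j x) (at x)" by (rule LD(5)[OF j])
    define Q where "Q t \<longleftrightarrow> (\<exists>q\<in>rect s a. Pt i q = fst (D j t) \<and> Im q * (t - x) * ?d > 0)" for t
    have "a \<le> rad" using a(2) rr by simp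
    then have "\<forall>\<^sub>F t in at x. Q t" unfolding Q_def
      by (intro crossing_side[OF i vel eq crossing_det[OF cr] a(1)])
    then obtain e2 where e2: "e2 > 0" "\<And>t. t \<noteq> x \<Longrightarrow> \<bar>t - x\<bar> < e2 \<Longrightarrow> Q t"
      unfolding eventually_at dist_real_def by blast
    define e where "e = min e1 e2"
    have e: "e > 0" "e \<le> e1" "e \<le> e2" using e1 e2 by (auto simp: e_def)
    obtain \<kappa>0 where \<kappa>0: "\<And>t. \<bar>t - x\<bar> < e1 \<Longrightarrow> l t - \<sigma>W (D j t) = \<kappa>0" using const[OF \<sigma>W e1(2)] by blast
    \<comment> \<open>The section \<open>\<sigma>W\<close> is defined across the crossing, so
      \<open>l\<close> differs from it by a constant. Expressed by \<open>C.\<sigma>T\<close>, a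
      period is added exactly on the left of the over strand.\<close>
    have side: "t \<notin> X \<and> u t = \<kappa>0 + (if (t - x) * ?d > 0 then 2 * pi * \<i> else 0)"
      if t: "t \<noteq> x" "\<bar>t - x\<bar> < e" for t
    proof -
      obtain q where q: "q \<in> rect s a" "Pt i q = fst (D j t)" "Im q * ((t - x) * ?d) > 0"
      proof -
        have "Q t" using e2(2)[OF t(1)] t(2) e by simp
        then show thesis unfolding Q_def using that by (metis mult.assoc)
      qed
      have tW: "D j t \<in> ?W" using e1(2) t(2) e by auto
      have \<kappa>: "l t = \<kappa>0 + \<sigma>W (D j t)" using \<kappa>0[of t] t(2) e by (auto simp: algebra_simps)
      have "Im q \<noteq> 0" using q(3) by auto
      then have "t \<notin> X" using WT[OF tW q(2)[symmetric] q(1)] XT by blast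
      moreover have "u t = \<kappa>0 + (if (t - x) * ?d > 0 then 2 * pi * \<i> else 0)"
      proof (cases "(t - x) * ?d > 0")
        case True
        have "0 < Im q" by (rule zero_less_mult_pos2[OF q(3) True])
        then show ?thesis using True WL[OF tW q(2)[symmetric] q(1)] \<kappa> gs by (simp add: u_def)
      next
        case False
        have "Im q < 0" using q(3) False zero_less_mult_iff[of "Im q" "(t - x) * ?d"] by blast
        then show ?thesis using False WR[OF tW q(2)[symmetric] q(1)] \<kappa> by (simp add: u_def)
      qed
      ultimately show ?thesis ..
    qed
    have d0: "?d \<noteq> 0" by (rule crossing_det[OF cr])
    show ?thesis
    proof (cases "?d > 0")
      case True
      then have "jmp x = 1" using \<open>x \<in> X\<close> by (simp add: jmp_def crossing_positive_def s_def)
      then show ?thesis using side True e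
        by (intro exI[of _ e] conjI exI[of _ \<kappa>0]) (auto simp: zero_less_mult_iff)
    next
      case False
      then have "jmp x = - 1" using \<open>x \<in> X\<close> by (simp add: jmp_def crossing_positive_def s_def)
      then show ?thesis using side False e d0
        by (intro exI[of _ e] conjI exI[of _ "\<kappa>0 + 2 * pi * \<i>"]) (auto simp: zero_less_mult_iff)
    qed
  qed
  \<comment> \<open>At a crossing the value of \<open>u\<close> means nothing, as
    \<open>C.\<sigma>T\<close> is not controlled outside \<open>C.T\<close>. Left limits also fit
    the half-open intervals over which crossings are counted.\<close>
  define v where "v t = (THE \<kappa>. \<exists>e>0. \<forall>r. t - e < r \<and> r < t \<longrightarrow> u r = \<kappa>)" for t
  have v: "v t = \<kappa>" if e: "e > 0" "\<And>r. t - e < r \<Longrightarrow> r < t \<Longrightarrow> u r = \<kappa>" for t e \<kappa>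
    unfolding v_def
  proof (rule the_equality)
    show "\<exists>e>0. \<forall>r. t - e < r \<and> r < t \<longrightarrow> u r = \<kappa>" using e by blast
    fix \<kappa>' assume "\<exists>e>0. \<forall>r. t - e < r \<and> r < t \<longrightarrow> u r = \<kappa>'"
    then obtain e' where e': "e' > 0" "\<And>r. t - e' < r \<Longrightarrow> r < t \<Longrightarrow> u r = \<kappa>'" by blast
    show "\<kappa>' = \<kappa>" using e(2)[of "t - min e e' / 2"] e'(2)[of "t - min e e' / 2"] e(1) e'(1) by auto
  qed
  \<comment> \<open>Bisection adds up the local jumps and yields the finiteness of the set of
    crossings along with them.\<close>
  have P: "finite (X \<inter> {0..<1}) \<and> v 1 - v 0 = 2 * pi * \<i> * of_int (\<Sum>t\<in>X \<inter> {0..<1}. jmp t)"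
  proof (rule Bolzano[of 0 1 "\<lambda>a b. finite (X \<inter> {a..<b}) \<and> v b - v a = 2 * pi * \<i> * of_int (\<Sum>t\<in>X \<inter> {a..<b}. jmp t)"])
    fix a b c :: real
    assume 1: "finite (X \<inter> {a..<b}) \<and> v b - v a = 2 * pi * \<i> * of_int (\<Sum>t\<in>X \<inter> {a..<b}. jmp t)"
      and 2: "finite (X \<inter> {b..<c}) \<and> v c - v b = 2 * pi * \<i> * of_int (\<Sum>t\<in>X \<inter> {b..<c}. jmp t)"
      and abc: "a \<le> b" "b \<le> c"
    have un: "X \<inter> {a..<c} = (X \<inter> {a..<b}) \<union> (X \<inter> {b..<c})" using abc by auto
    have "(\<Sum>t\<in>X \<inter> {a..<c}. jmp t) = (\<Sum>t\<in>X \<inter> {a..<b}. jmp t) + (\<Sum>t\<in>X \<inter> {b..<c}. jmp t)"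
      unfolding un using 1 2 by (intro sum.union_disjoint) auto
    moreover have "v c - v a = (v b - v a) + (v c - v b)" by simp
    ultimately show "finite (X \<inter> {a..<c}) \<and> v c - v a = 2 * pi * \<i> * of_int (\<Sum>t\<in>X \<inter> {a..<c}. jmp t)"
      using 1 2 un by (simp add: algebra_simps)
  next
    fix x :: real
    obtain e \<kappa> where e: "e > 0" "\<And>t. t \<noteq> x \<Longrightarrow> \<bar>t - x\<bar> < e \<Longrightarrow> t \<notin> X"
      "\<And>t. x - e < t \<Longrightarrow> t < x \<Longrightarrow> u t = \<kappa>" "\<And>t. x < t \<Longrightarrow> t < x + e \<Longrightarrow> u t = \<kappa> + 2 * pi * \<i> * jmp x"
      using local[of x] by blast
    have vl: "v t = \<kappa>" if "x - e < t" "t \<le> x" for t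
      by (rule v[of "t - (x - e)"]) (use that e(3) in auto)
    have vr: "v t = \<kappa> + 2 * pi * \<i> * jmp x" if "x < t" "t < x + e" for t
      by (rule v[of "t - x"]) (use that e(4) in auto)
    show "\<exists>d>0. \<forall>a b. a \<le> x \<and> x \<le> b \<and> b - a < d \<longrightarrow>
        finite (X \<inter> {a..<b}) \<and> v b - v a = 2 * pi * \<i> * of_int (\<Sum>t\<in>X \<inter> {a..<b}. jmp t)"
    proof (intro exI[of _ e] conjI allI impI e(1))
      fix a b assume ab: "a \<le> x \<and> x \<le> b \<and> b - a < e"
      have sub: "X \<inter> {a..<b} \<subseteq> {x}"
      proof
        fix t assume t: "t \<in> X \<inter> {a..<b}"
        then have "\<bar>t - x\<bar> < e" using ab by (auto simp: abs_less_iff)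
        then show "t \<in> {x}" using e(2)[of t] t by auto
      qed
      then show "finite (X \<inter> {a..<b})" by (rule finite_subset) simp
      have va: "v a = \<kappa>" using ab by (intro vl) auto
      show "v b - v a = 2 * pi * \<i> * of_int (\<Sum>t\<in>X \<inter> {a..<b}. jmp t)"
      proof (cases "b = x")
        case True
        then have "X \<inter> {a..<b} = {}" using sub by auto
        moreover have "v b = \<kappa>" using True e(1) by (intro vl) auto
        ultimately show ?thesis using va by simp
      next
        case False
        have "v b = \<kappa> + 2 * pi * \<i> * jmp x" using ab False by (intro vr) auto
        moreover have "(\<Sum>t\<in>X \<inter> {a..<b}. jmp t) = jmp x"
        proof (cases "x \<in> X")
          case True
          then have "X \<inter> {a..<b} = {x}" using sub ab False by auto
          then show ?thesis by simp
        next
          case xX: False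
          then have "X \<inter> {a..<b} = {}" using sub by blast
          then show ?thesis using xX by (simp add: jmp_def)
        qed
        ultimately show ?thesis using va by simp
      qed
    qed
  qed simp
  have "\<exists>k::int. \<forall>t\<in>UNIV. l (t + 1) = l t + 2 * pi * \<i> * k"
  proof (rule logs_differ)
    show "continuous_on UNIV (\<lambda>t. l (t + 1))" by (intro continuous_on_compose2[OF l(1)] continuous_intros) auto
    show "exp (l (t + 1)) = exp (l t)" for t using l(2) LD(2)[OF j] by simp
  qed (use l in auto)
  then obtain k :: int where k: "\<And>t. l (t + 1) = l t + 2 * pi * \<i> * k" by auto
  have uk: "u (t + 1) = u t + 2 * pi * \<i> * k" for t using k[of t] LD(2)[OF j] by (simp add: u_def)
  have "v 1 = v 0 + 2 * pi * \<i> * k"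
  proof -
    obtain e \<kappa> where e: "e > 0" "\<And>t. 0 - e < t \<Longrightarrow> t < 0 \<Longrightarrow> u t = \<kappa>" using local[of 0] by blast
    have "v 0 = \<kappa>" by (rule v[OF e(1)]) (use e(2) in auto)
    moreover have "v 1 = \<kappa> + 2 * pi * \<i> * k"
    proof (rule v[OF e(1)])
      fix r assume "1 - e < r" "r < 1"
      then show "u r = \<kappa> + 2 * pi * \<i> * k" using uk[of "r - 1"] e(2)[of "r - 1"] by simp
    qed
    ultimately show ?thesis by simp
  qed
  \<comment> \<open>\<open>C.\<sigma>T (D j t)\<close> is periodic in \<open>t\<close>, so
    \<open>l\<close> and the left limits change by the same period.\<close>
  then have "l 1 - l 0 = v 1 - v 0" using k[of 0] by simp
  also have "\<dots> = 2 * pi * \<i> * of_int (\<Sum>t\<in>X \<inter> {0..<1}. jmp t)" using P by simp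
  also have "(\<Sum>t\<in>X \<inter> {0..<1}. jmp t) = signed_crossings I D i j"
  proof -
    let ?S = "{(s, t). s \<in> {0..<1} \<and> t \<in> {0..<1} \<and> crossing I D i s j t}"
    \<comment> \<open>Without triple points an under point determines the over parameter modulo
      periods, so the pairs can be counted by \<open>t\<close> alone.\<close>
    have uniq: "s = sX t" if "s \<in> {0..<1}" "crossing I D i s j t" for s t
    proof -
      have tX: "t \<in> X" using that(2) unfolding X_def by blast
      have "D i s \<in> L" using i in_L by blast
      moreover have "fst (D i s) = fst (D i (sX t))" using that(2) sX(2)[OF tX] by (simp add: crossing_def)
      ultimately have "D i s = D i (sX t)" using triple[OF sX(2)[OF tX]] ne by blast
      then obtain m where m: "s - sX t = of_int m" using LD(9)[OF i] by (metis Ints_cases)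
      then have "\<bar>of_int m :: real\<bar> < 1" using that(1) sX(1)[OF tX] by (auto simp: abs_less_iff)
      then have "m = 0" by linarith
      then show ?thesis using m by simp
    qed
    have S: "?S = (\<lambda>t. (sX t, t)) ` (X \<inter> {0..<1})"
    proof (intro equalityI subsetI)
      fix p assume "p \<in> ?S"
      then obtain s t where p: "p = (s, t)" "s \<in> {0..<1}" "t \<in> {0..<1}" "crossing I D i s j t" by auto
      then have "s = sX t" "t \<in> X" using uniq X_def by auto
      then show "p \<in> (\<lambda>t. (sX t, t)) ` (X \<inter> {0..<1})" using p by blast
    next
      fix p assume "p \<in> (\<lambda>t. (sX t, t)) ` (X \<inter> {0..<1})"
      then obtain t where "p = (sX t, t)" "t \<in> X" "t \<in> {0..<1}" by blast
      then show "p \<in> ?S" using sX by simp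
    qed
    have "signed_crossings I D i j = (\<Sum>t\<in>X \<inter> {0..<1}. if crossing_positive D i (sX t) j t then 1 else - 1)"
      unfolding signed_crossings_def S by (subst sum.reindex) (auto simp: inj_on_def)
    also have "\<dots> = (\<Sum>t\<in>X \<inter> {0..<1}. jmp t)" by (intro sum.cong) (auto simp: jmp_def)
    finally show ?thesis by simp
  qed
  finally show ?thesis .
qed

section \<open>Reflection in the plane of projection\<close>

definition mirror :: "complex \<times> real \<Rightarrow> complex \<times> real" where "mirror p = (fst p, - snd p)"

lemma mirror_simps [simp]: "fst (mirror p) = fst p" "snd (mirror p) = - snd p" "mirror (mirror p) = p"
  by (simp_all add: mirror_def)

lemma bounded_linear_mirror: "bounded_linear mirror"
  unfolding mirror_def by (intro bounded_linear_Pair bounded_linear_fst bounded_linear_minus bounded_linear_snd)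

lemma mirror_eq_iff: "mirror p = mirror q \<longleftrightarrow> p = q"
  by (metis mirror_simps(3))

lemma plane_det_swap: "plane_det v u = - plane_det u v"
  by (simp add: plane_det_def algebra_simps)

context diag
begin

lemma velocity_mirror: "i \<in> I \<Longrightarrow> plane_velocity (\<lambda>i t. mirror (D i t)) i t = plane_velocity D i t"
  using vector_derivative_at[OF bounded_linear.has_vector_derivative[OF bounded_linear_mirror LD(3)], of i t]
  by (simp add: plane_velocity_def)

lemma tube_mirror: "tube (\<lambda>i t. mirror (D i t)) nn i p = mirror (tube D nn i (mirror p))"
  by (simp add: tube_def ptube_def prod_eq_iff)

lemma diag_mirror: "diag I (\<lambda>i t. mirror (D i t)) nn b \<delta>"
proof
  let ?D = "\<lambda>i t. mirror (D i t)"
  show "link_diagram I ?D" unfolding link_diagram_def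
  proof (intro conjI)
    show "finite I" by (rule LD(1))
    show "\<forall>i\<in>I. (\<forall>t. ?D i (t + 1) = ?D i t) \<and> ?D i C1_differentiable_on UNIV \<and> (\<forall>t. plane_velocity ?D i t \<noteq> 0)"
    proof (intro ballI conjI allI)
      fix i t assume i: "i \<in> I"
      show "?D i (t + 1) = ?D i t" using LD(2)[OF i] by simp
      show "plane_velocity ?D i t \<noteq> 0" unfolding velocity_mirror[OF i] by (rule LD(7)[OF i])
      have "D i C1_differentiable_on UNIV" using link i by (simp add: link_diagram_def)
      then obtain d where d: "\<And>t. (D i has_vector_derivative d t) (at t)" "continuous_on UNIV d"
        unfolding C1_differentiable_on_def by blast
      show "?D i C1_differentiable_on UNIV" unfolding C1_differentiable_on_def
      proof (intro exI[of _ "\<lambda>t. mirror (d t)"] conjI ballI)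
        show "(?D i has_vector_derivative mirror (d t)) (at t)" for t
          by (rule bounded_linear.has_vector_derivative[OF bounded_linear_mirror d(1)])
        show "continuous_on UNIV (\<lambda>t. mirror (d t))"
          by (rule bounded_linear.continuous_on[OF bounded_linear_mirror d(2)])
      qed
    qed
    show "\<forall>i\<in>I. \<forall>j\<in>I. \<forall>s t. ?D i s = ?D j t \<longrightarrow> i = j \<and> s - t \<in> \<int>"
    proof (intro ballI allI impI)
      fix i j s t assume ij: "i \<in> I" "j \<in> I" "?D i s = ?D j t"
      then have eq: "D i s = D j t" by (simp add: mirror_eq_iff)
      then have "i = j" using LD(8) ij by blast
      then show "i = j \<and> s - t \<in> \<int>" using LD(9)[OF ij(1)] eq by simp
    qed
    have "\<forall>i\<in>I. \<forall>j\<in>I. \<forall>s t. D i s \<noteq> D j t \<and> fst (D i s) = fst (D j t) \<longrightarrow>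
       plane_det (plane_velocity D i s) (plane_velocity D j t) \<noteq> 0"
      using link unfolding link_diagram_def by simp
    then show "\<forall>i\<in>I. \<forall>j\<in>I. \<forall>s t. ?D i s \<noteq> ?D j t \<and> fst (?D i s) = fst (?D j t) \<longrightarrow>
       plane_det (plane_velocity ?D i s) (plane_velocity ?D j t) \<noteq> 0"
      by (simp add: mirror_eq_iff velocity_mirror)
    have "\<forall>p\<in>(\<Union>i\<in>I. range (D i)). \<forall>q\<in>(\<Union>i\<in>I. range (D i)). \<forall>r\<in>(\<Union>i\<in>I. range (D i)).
       fst p = fst q \<and> fst q = fst r \<longrightarrow> p = q \<or> q = r \<or> p = r"
      using link unfolding link_diagram_def by simp
    then show "\<forall>p\<in>(\<Union>i\<in>I. range (?D i)). \<forall>q\<in>(\<Union>i\<in>I. range (?D i)). \<forall>r\<in>(\<Union>i\<in>I. range (?D i)).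
       fst p = fst q \<and> fst q = fst r \<longrightarrow> p = q \<or> q = r \<or> p = r"
      by (simp add: mirror_eq_iff)
  qed
  show "plane_det (plane_velocity ?D i s) (nn i s) > 0" if "i \<in> I" for i s
    using nn_det[OF that] by (simp add: velocity_mirror that)
  show "q = q'" if "i \<in> I" "\<bar>Re q - Re q'\<bar> < \<delta>" "\<bar>Im q\<bar> < b" "\<bar>Im q'\<bar> < b" "ptube ?D nn i q = ptube ?D nn i q'" for i q q'
    using ptube_inj[OF that(1-4)] that(5) by (simp add: ptube_def)
  show "i = j \<and> Re (fst p) - Re (fst p') \<in> \<int> \<and> Im (fst p) = Im (fst p') \<and> snd p = snd p'"
    if "i \<in> I" "j \<in> I" "\<bar>Im (fst p)\<bar> < b" "\<bar>snd p\<bar> < b" "\<bar>Im (fst p')\<bar> < b" "\<bar>snd p'\<bar> < b"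
      "tube ?D nn i p = tube ?D nn j p'" for i j p p'
  proof -
    have "tube D nn i (mirror p) = tube D nn j (mirror p')"
      using that(7) by (simp add: tube_mirror mirror_eq_iff)
    from tube_inj[OF that(1,2) _ _ _ _ this] that show ?thesis by simp
  qed
qed (use b \<delta> nn_cont nn_per in auto)

text \<open>Over and under strand exchange their roles while the plane picture stays; this swaps the
  arguments of the determinant and reverses its sign.\<close>

lemma signed_crossings_mirror:
  assumes "i \<in> I" "j \<in> I"
  shows "signed_crossings I (\<lambda>i t. mirror (D i t)) i j = - signed_crossings I D j i"
proof -
  let ?D = "\<lambda>i t. mirror (D i t)"
  have c: "crossing I ?D i s j t \<longleftrightarrow> crossing I D j t i s" for s t
    by (auto simp: crossing_def)
  have p: "(if crossing_positive ?D i s j t then 1 else - 1) = - (if crossing_positive D j t i s then 1 else - 1 :: int)"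
    if "crossing I D j t i s" for s t
    using crossing_det[OF that] plane_det_swap[of "plane_velocity D i s" "plane_velocity D j t"]
    by (auto simp: crossing_positive_def velocity_mirror assms)
  have S: "{(s, t). s \<in> {0..<1} \<and> t \<in> {0..<1} \<and> crossing I ?D i s j t} =
      prod.swap ` {(t, s). t \<in> {0..<1} \<and> s \<in> {0..<1} \<and> crossing I D j t i s}"
    by (auto simp: c image_iff)
  have "signed_crossings I ?D i j = (\<Sum>(t, s)\<in>{(t, s). t \<in> {0..<1} \<and> s \<in> {0..<1} \<and> crossing I D j t i s}.
       if crossing_positive ?D i s j t then 1 else - 1)"
    unfolding signed_crossings_def S by (subst sum.reindex) (auto simp: split_beta)
  also have "\<dots> = (\<Sum>(t, s)\<in>{(t, s). t \<in> {0..<1} \<and> s \<in> {0..<1} \<and> crossing I D j t i s}.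
       - (if crossing_positive D j t i s then 1 else - 1))"
    by (intro sum.cong refl) (auto simp: p simp del: if_split)
  also have "\<dots> = - signed_crossings I D j i"
    unfolding signed_crossings_def by (simp add: sum_negf split_beta)
  finally show ?thesis .
qed

text \<open>The reflected function winds backwards around the strand, and complex conjugation
  restores degree one. The sign from the conjugated period cancels the one from
  \<open>signed_crossings_mirror\<close>.\<close>

lemma winding_count_mirror:
  assumes i: "i \<in> I" and j: "j \<in> I" and ij: "i \<noteq> j"
    and F: "continuous_on (- range (D i)) F" "\<And>p. p \<notin> range (D i) \<Longrightarrow> F p \<noteq> 0" "has_degree_one D nn i F"
    and l: "continuous_on UNIV l" "\<And>t. exp (l t) = F (D j t)"
  shows "l 1 - l 0 = 2 * pi * \<i> * of_int (signed_crossings I D j i)"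
proof -
  let ?D = "\<lambda>i t. mirror (D i t)"
  interpret M: diag I ?D nn b \<delta> by (rule diag_mirror)
  have cm: "continuous_on S mirror" for S
    by (intro bounded_linear.continuous_on[OF bounded_linear_mirror] continuous_on_id)
  have r: "mirror p \<in> range (D i) \<longleftrightarrow> p \<in> range (?D i)" for p
  proof
    assume "mirror p \<in> range (D i)"
    then obtain t where "mirror p = D i t" by blast
    then have "p = ?D i t" by (metis mirror_simps(3))
    then show "p \<in> range (?D i)" by blast
  next
    assume "p \<in> range (?D i)"
    then obtain t where "p = ?D i t" by blast
    then have "mirror p = D i t" by simp
    then show "mirror p \<in> range (D i)" by blast
  qed
  have "cnj (l 1) - cnj (l 0) = 2 * pi * \<i> * of_int (signed_crossings I ?D i j)"
  proof (rule M.winding_count[where F = "\<lambda>p. cnj (F (mirror p))" and l = "\<lambda>t. cnj (l t)", OF i j ij])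
    show "continuous_on (- range (?D i)) (\<lambda>p. cnj (F (mirror p)))"
    proof (intro continuous_on_cnj continuous_on_compose2[OF F(1) cm] image_subsetI)
      show "mirror p \<in> - range (D i)" if "p \<in> - range (?D i)" for p using that r[of p] by simp
    qed
    show "cnj (F (mirror p)) \<noteq> 0" if "p \<notin> range (?D i)" for p using F(2)[of "mirror p"] that r by simp
    show "continuous_on UNIV (\<lambda>t. cnj (l t))" by (intro continuous_on_cnj l)
    show "exp (cnj (l t)) = cnj (F (mirror (?D j t)))" for t      using l(2)[of t] by (simp flip: exp_cnj)
    obtain c H where c: "c > 0" "continuous_on {p. \<bar>Im (fst p)\<bar> < c \<and> \<bar>snd p\<bar> < c} H"
      "\<And>p. \<bar>Im (fst p)\<bar> < c \<Longrightarrow> \<bar>snd p\<bar> < c \<Longrightarrow> H p \<noteq> 0"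
      "\<And>p. \<bar>Im (fst p)\<bar> < c \<Longrightarrow> \<bar>snd p\<bar> < c \<Longrightarrow> F (Tb i p) = transv p * H p"
      using F(3) unfolding has_degree_one_def by blast
    show "has_degree_one ?D nn i (\<lambda>p. cnj (F (mirror p)))"
      unfolding has_degree_one_def
    proof (intro exI[of _ c] exI[of _ "\<lambda>p. cnj (H (mirror p))"] conjI allI impI)
      show "continuous_on {p. \<bar>Im (fst p)\<bar> < c \<and> \<bar>snd p\<bar> < c} (\<lambda>p. cnj (H (mirror p)))"
        by (intro continuous_on_cnj continuous_on_compose2[OF c(2) cm]) auto
      fix p :: "complex \<times> real" assume p: "\<bar>Im (fst p)\<bar> < c \<and> \<bar>snd p\<bar> < c"
      show "cnj (H (mirror p)) \<noteq> 0" using c(3)[of "mirror p"] p by simp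
      have "transv p = cnj (transv (mirror p))" by (simp add: transv_def complex_eq_iff)
      then show "cnj (F (mirror (tube ?D nn i p))) = transv p * cnj (H (mirror p))"
        using c(4)[of "mirror p"] p by (simp add: tube_mirror)
    qed (rule c(1))
  qed
  then have "cnj (cnj (l 1) - cnj (l 0)) = cnj (2 * pi * \<i> * of_int (signed_crossings I ?D i j))" by simp
  then show ?thesis by (simp add: signed_crossings_mirror[OF i j])
qed

text \<open>Two tube coordinates of the same point differ by a period along the strand, which
  \<open>transv\<close> ignores. So the normal coordinate is a well-defined function on the union of
  the tubes, a local equation of the sublink.\<close>

lemma tube_coordinate:
  assumes J: "J \<subseteq> I"
  obtains V A where "open V" "bounded V" "continuous_on V A" "link_of J D \<subseteq> V" "V \<inter> link_of (I - J) D = {}"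
    "\<And>q. q \<in> V \<Longrightarrow> A q = 0 \<longleftrightarrow> q \<in> link_of J D"
    "\<And>i p. i \<in> J \<Longrightarrow> \<bar>Im (fst p)\<bar> < rad \<Longrightarrow> \<bar>snd p\<bar> < rad \<Longrightarrow> Tb i p \<in> V \<and> A (Tb i p) = transv p"
proof -
  have JI: "i \<in> I" if "i \<in> J" for i using that J by blast
  define S where "S = {p::complex \<times> real. \<bar>Im (fst p)\<bar> < rad \<and> \<bar>snd p\<bar> < rad}"
  define V where "V = (\<Union>i\<in>J. Tb i ` S)"
  define A where "A q = transv (SOME p. p \<in> S \<and> (\<exists>i\<in>J. Tb i p = q))" for q
  have A: "A (Tb i p) = transv p" if i: "i \<in> J" and p: "p \<in> S" for i p
  proof -
    define p' where "p' = (SOME p'. p' \<in> S \<and> (\<exists>j\<in>J. Tb j p' = Tb i p))"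
    have "p' \<in> S \<and> (\<exists>j\<in>J. Tb j p' = Tb i p)" unfolding p'_def by (rule someI[of _ p]) (use i p in blast)
    then obtain j where j: "j \<in> J" "Tb j p' = Tb i p" "p' \<in> S" by blast
    from tube_inj[OF JI[OF j(1)] JI[OF i] _ _ _ _ j(2)] j(3) p rad
    have "Im (fst p') = Im (fst p)" "snd p' = snd p" by (auto simp: S_def)
    then show ?thesis unfolding A_def p'_def[symmetric] by (simp add: transv_def)
  qed
  have S_UN: "S = (\<Union>s. bx s rad)" 
  proof (intro equalityI subsetI)
    fix p assume "p \<in> S"
    then have "p \<in> bx (Re (fst p)) rad" using rad by (simp add: S_def bx_def)
    then show "p \<in> (\<Union>s. bx s rad)" by blast
  qed (auto simp: S_def bx_def)
  have V_UN: "V = (\<Union>x\<in>J \<times> UNIV. Tb (fst x) ` bx (snd x) rad)" unfolding V_def S_UN image_UN by force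
  have opn: "open (Tb (fst x) ` bx (snd x) rad)" if "x \<in> J \<times> UNIV" for x
    using that JI open_Tb[OF _ open_bx order_refl, of "fst x" "snd x"] by auto
  have oV: "open V" unfolding V_UN using opn by blast
  have cA: "continuous_on V A" unfolding V_UN
  proof (rule continuous_on_open_UN)
    fix x assume x: "x \<in> J \<times> (UNIV :: real set)"
    then have i: "fst x \<in> J" "fst x \<in> I" using JI by auto
    let ?B = "bx (snd x) rad"
    obtain g where g: "homeomorphism ?B (Tb (fst x) ` ?B) (Tb (fst x)) g"
      using invariance_of_domain_homeomorphism[OF open_bx continuous_on_Tb[OF i(2)] _ inj_on_Tb[OF i(2)]] by blast
    have "continuous_on (Tb (fst x) ` ?B) (\<lambda>q. transv (g q))"
      using g unfolding homeomorphism_def transv_def Complex_eq by (auto intro!: continuous_intros)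
    then show "continuous_on (Tb (fst x) ` ?B) A"
    proof (rule continuous_on_eq)
      fix q assume "q \<in> Tb (fst x) ` ?B"
      then obtain p where p: "p \<in> ?B" "q = Tb (fst x) p" by blast
      then have "g q = p" using g by (simp add: homeomorphism_def)
      moreover have "p \<in> S" using p(1) S_UN by blast
      ultimately show "transv (g q) = A q" using A[OF i(1)] p(2) by simp
    qed
  qed (use opn in blast)
  have bV: "bounded V"
  proof -
    have "bounded (Tb i ` S)" if i: "i \<in> J" for i
    proof -
      let ?K = "{p::complex \<times> real. 0 \<le> Re (fst p) \<and> Re (fst p) \<le> 1 \<and> - rad \<le> Im (fst p) \<and> Im (fst p) \<le> rad \<and> - rad \<le> snd p \<and> snd p \<le> rad}"
      have "?K = cbox (Complex 0 (- rad), - rad) (Complex 1 rad, rad)"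
        by (auto simp: mem_box Basis_prod_def Basis_complex_def inner_complex_def ball_Un)
      then have "compact ?K" by (simp only: compact_cbox)
      then have "compact (Tb i ` ?K)" by (intro compact_continuous_image continuous_on_Tb JI i)
      moreover have "Tb i ` S \<subseteq> Tb i ` ?K"
      proof (rule image_subsetI)
        fix p assume p: "p \<in> S"
        let ?p = "(fst p + of_int (- \<lfloor>Re (fst p)\<rfloor>), snd p)"
        have "Tb i ?p = Tb i p"          using Tb_shift[OF JI[OF i], of "fst p" "- \<lfloor>Re (fst p)\<rfloor>" "snd p"] by (simp only: prod.collapse)
        moreover have "?p \<in> ?K"
        proof -
          have "0 \<le> Re (fst p) - of_int \<lfloor>Re (fst p)\<rfloor>" "Re (fst p) - of_int \<lfloor>Re (fst p)\<rfloor> \<le> 1" by linarith+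
          then show ?thesis using p by (auto simp: S_def abs_less_iff)
        qed
        ultimately show "Tb i p \<in> Tb i ` ?K" by (metis (no_types, lifting) imageI)
      qed
      ultimately show ?thesis using compact_imp_bounded bounded_subset by blast
    qed
    then show ?thesis unfolding V_def using LD(1) J by (intro bounded_UN) (auto intro: finite_subset)
  qed
  have center: "(Complex t 0, 0) \<in> S" for t using rad by (simp add: S_def)
  have LV: "link_of J D \<subseteq> V"
  proof
    fix q assume "q \<in> link_of J D"
    then obtain i t where "i \<in> J" "q = Tb i (Complex t 0, 0)" unfolding link_of_def Tb_center by blast
    then show "q \<in> V" unfolding V_def using center by blast
  qed
  have on: "j \<in> J \<and> transv p = 0 \<and> q \<in> link_of J D" if q: "q = Tb i p" "i \<in> J" "p \<in> S" "q = D j t" "j \<in> I" for q i p j t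
  proof -
    have "Tb i p = Tb j (Complex t 0, 0)" using q by (simp add: Tb_center)
    from tube_inj[OF JI[OF q(2)] q(5) _ _ _ _ this] q(3) rad b have *: "i = j" "Im (fst p) = 0" "snd p = 0" by (auto simp: S_def)
    have "D i t \<in> link_of J D" using q(2) unfolding link_of_def by blast
    then have "q \<in> link_of J D" using q(4) *(1) by simp
    then show ?thesis using * q(2) by (simp add: transv_def complex_eq_iff)
  qed
  have dV: "V \<inter> link_of (I - J) D = {}"
  proof -
    have False if qV: "q \<in> V" and qL: "q \<in> link_of (I - J) D" for q
    proof -
      obtain i p where ip: "i \<in> J" "p \<in> S" "q = Tb i p" using qV unfolding V_def by blast
      obtain j t where "j \<in> I" "j \<notin> J" "q = D j t" using qL unfolding link_of_def by blast
      then show False using on[OF ip(3,1,2)] by blast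
    qed
    then show ?thesis by blast
  qed
  have zA: "A q = 0 \<longleftrightarrow> q \<in> link_of J D" if qV: "q \<in> V" for q
  proof -
    obtain i p where ip: "i \<in> J" "p \<in> S" "q = Tb i p" using qV unfolding V_def by blast
    show ?thesis
    proof
      assume "A q = 0"
      then have "transv p = 0" using A[OF ip(1,2)] ip(3) by simp
      then have "Im (fst p) = 0" "snd p = 0" by (auto simp: transv_def complex_eq_iff)
      then have "q = D i (Re (fst p))" using ip(3) by (simp add: tube_def ptube_def prod_eq_iff)
      then show "q \<in> link_of J D" using ip(1) unfolding link_of_def by blast
    next
      assume "q \<in> link_of J D"
      then obtain j t where "j \<in> J" "q = D j t" by (auto simp: link_of_def)
      then have "transv p = 0" using on[OF ip(3,1,2)] JI by blast
      then show "A q = 0" using A[OF ip(1,2)] ip(3) by simp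
    qed
  qed
  have tA: "Tb i p \<in> V \<and> A (Tb i p) = transv p" if "i \<in> J" "\<bar>Im (fst p)\<bar> < rad" "\<bar>snd p\<bar> < rad" for i p
    using A[OF that(1), of p] that unfolding V_def S_def by auto
  show thesis by (rule that[OF oV bV cA LV dV zA tA])
qed

end

section \<open>The complement of the unknotted component\<close>

definition stereo :: "complex \<times> complex \<Rightarrow> complex \<times> real"
  where "stereo x = (fst x /\<^sub>R (1 - Im (snd x)), Re (snd x) / (1 - Im (snd x)))"

lemma S3_iff: "x \<in> S3 \<longleftrightarrow> (norm (fst x))\<^sup>2 + (Re (snd x))\<^sup>2 + (Im (snd x))\<^sup>2 = 1"
proof -
  have "(norm x)\<^sup>2 = (norm (fst x))\<^sup>2 + (norm (snd x))\<^sup>2" by (cases x) (simp add: norm_Pair)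
  moreover have "(norm (snd x))\<^sup>2 = (Re (snd x))\<^sup>2 + (Im (snd x))\<^sup>2" by (simp add: cmod_power2)
  moreover have "x \<in> S3 \<longleftrightarrow> (norm x)\<^sup>2 = 1"
    unfolding S3_def by (simp add: abs_square_eq_1)
  ultimately show ?thesis by (simp add: add.assoc)
qed

lemma norm_sq_prod: "(norm p)\<^sup>2 = (norm (fst p))\<^sup>2 + (snd p)\<^sup>2" for p :: "complex \<times> real"
  by (cases p) (simp add: norm_Pair)

lemma Im_inv_stereo: "1 - Im (snd (inv_stereo p)) = 2 / ((norm p)\<^sup>2 + 1)"
proof -
  have "(norm p)\<^sup>2 + 1 \<noteq> 0" by (smt (verit) zero_le_power2)
  then show ?thesis by (simp add: inv_stereo_def field_simps)
qed

lemma stereo_inv_stereo: "stereo (inv_stereo p) = p"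
proof -
  define e where "e = 2 / ((norm p)\<^sup>2 + 1)"
  have "(norm p)\<^sup>2 + 1 \<noteq> 0" by (smt (verit) zero_le_power2)
  then have e: "e \<noteq> 0" by (simp add: e_def)
  have "stereo (inv_stereo p) = ((e *\<^sub>R fst p) /\<^sub>R e, (e * snd p) / e)"
    unfolding stereo_def Im_inv_stereo unfolding inv_stereo_def by (simp add: e_def)
  then show ?thesis using e by simp
qed

lemma norm_stereo:
  assumes x: "x \<in> S3" and m: "Im (snd x) \<noteq> 1"
  shows "(norm (stereo x))\<^sup>2 * (1 - Im (snd x)) = 1 + Im (snd x)"
proof -
  define m where "m = Im (snd x)"
  have "(norm (stereo x))\<^sup>2 = ((norm (fst x))\<^sup>2 + (Re (snd x))\<^sup>2) / (1 - m)\<^sup>2"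
    unfolding norm_sq_prod stereo_def m_def[symmetric]
    by (simp add: power_mult_distrib power_inverse divide_inverse algebra_simps)
  also have "(norm (fst x))\<^sup>2 + (Re (snd x))\<^sup>2 = (1 + m) * (1 - m)"
    using x unfolding S3_iff m_def[symmetric] by (simp add: algebra_simps power2_eq_square)
  finally show ?thesis using m unfolding m_def[symmetric] by (simp add: power2_eq_square)
qed

lemma inv_stereo_stereo:
  assumes x: "x \<in> S3" and m: "Im (snd x) \<noteq> 1"
  shows "inv_stereo (stereo x) = x"
proof -
  define m where "m = Im (snd x)"
  have m1: "1 - m \<noteq> 0" using m by (simp add: m_def)
  have "(norm (stereo x))\<^sup>2 = (1 + m) / (1 - m)"
    using norm_stereo[OF x m] m1 unfolding m_def[symmetric] by (simp add: field_simps)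
  then have n: "(norm (stereo x))\<^sup>2 + 1 = 2 / (1 - m)" "(norm (stereo x))\<^sup>2 - 1 = 2 * m / (1 - m)"
    using m1 by (auto simp: field_simps)
  have "fst (inv_stereo (stereo x)) = fst x"
  proof -
    have "fst (inv_stereo (stereo x)) = (2 / (2 / (1 - m))) *\<^sub>R (fst x /\<^sub>R (1 - m))"
      unfolding inv_stereo_def fst_conv n(1) by (simp only: stereo_def fst_conv m_def)
    also have "2 / (2 / (1 - m)) = 1 - m" by simp
    finally show ?thesis using m1 by simp
  qed
  moreover have "Re (snd (inv_stereo (stereo x))) = Re (snd x)" "Im (snd (inv_stereo (stereo x))) = Im (snd x)"
    unfolding inv_stereo_def snd_conv n complex.sel using m1 by (simp_all add: stereo_def m_def)
  ultimately show ?thesis by (simp add: prod_eq_iff complex_eq_iff)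
qed

lemma continuous_on_inv_stereo: "continuous_on S inv_stereo"
proof -
  have n: "(norm p)\<^sup>2 + 1 \<noteq> 0" for p :: "complex \<times> real" by (smt (verit) zero_le_power2)
  show ?thesis unfolding inv_stereo_def Complex_eq using n by (intro continuous_intros) auto
qed

lemma continuous_on_stereo: "(\<And>x. x \<in> S \<Longrightarrow> Im (snd x) \<noteq> 1) \<Longrightarrow> continuous_on S stereo"
  unfolding stereo_def by (intro continuous_intros) auto

lemma inv_stereo_Im_neq_1: "Im (snd (inv_stereo p)) \<noteq> 1"
  using Im_inv_stereo[of p] by (smt (verit) divide_eq_0_iff zero_le_power2)

lemma inv_stereo_eq_iff: "inv_stereo p = inv_stereo q \<longleftrightarrow> p = q"
  by (metis stereo_inv_stereo)

text \<open>On a ball the function comes from \<open>divisor_on_cbox\<close>. On the bounding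
  2-sphere it has a logarithm by simple connectedness, and Tietze extends this logarithm over the
  cap around the point at infinity. The extension to the 3-sphere is needed because the unknotting
  homeomorphism need not fix that point.\<close>

lemma (in diag) knot_function:
  assumes i: "i \<in> I"
  obtains Fs where "continuous_on S3 Fs" "\<And>x. x \<in> S3 \<Longrightarrow> Fs x = 0 \<longleftrightarrow> x \<in> inv_stereo ` range (D i)"
    "has_degree_one D nn i (\<lambda>p. Fs (inv_stereo p))"
proof -
  obtain V A where V: "open V" "bounded V" "continuous_on V A" "link_of {i} D \<subseteq> V"
    "\<And>q. q \<in> V \<Longrightarrow> A q = 0 \<longleftrightarrow> q \<in> link_of {i} D"
    "\<And>p. \<bar>Im (fst p)\<bar> < rad \<Longrightarrow> \<bar>snd p\<bar> < rad \<Longrightarrow> Tb i p \<in> V \<and> A (Tb i p) = transv p"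
    using tube_coordinate[of "{i}"] i by (metis empty_subsetI insert_subset singletonI)
  have Li: "link_of {i} D = range (D i)" by (simp add: link_of_def)
  have "compact (range (D i))"
    unfolding periodic_range[of "D i", OF LD(2)[OF i]]
    using LD(4)[OF i] by (intro compact_continuous_image) (auto intro: continuous_on_subset)
  then have cl: "closed (range (D i))" by (rule compact_imp_closed)
  obtain R where R: "R > 0" "V \<subseteq> ball 0 R" using bounded_subset_ballD[OF V(2), of 0] by blast
  obtain c :: "complex \<times> real" where c: "cball 0 R \<subseteq> cbox (- c) c"
    using bounded_subset_cbox_symmetric[OF bounded_cball] by blast
  have "divisor_on V A (range (D i)) (cball 0 R)"
    by (rule divisor_on_subset[OF divisor_on_cbox c]) (use V cl Li in auto)
  then obtain F0 G where F0: "continuous_on (cball 0 R) F0" "\<And>x. x \<in> cball 0 R \<Longrightarrow> F0 x = 0 \<longleftrightarrow> x \<in> range (D i)"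
    and G: "continuous_on (cball 0 R \<inter> V) G" "\<And>x. x \<in> cball 0 R \<inter> V \<Longrightarrow> G x \<noteq> 0 \<and> F0 x = A x * G x"
    unfolding divisor_on_def by blast
  have KR: "D i t \<in> ball 0 R" for t using V(4) R(2) Li by blast
  have DIM: "3 \<le> DIM(complex \<times> real)" by simp
  have sph: "F0 x \<noteq> 0" if x: "x \<in> sphere 0 R" for x
  proof -
    have "x \<notin> range (D i)" using KR x by auto
    then show ?thesis using F0(2)[of x] x by auto
  qed
  obtain r where r: "continuous_on (sphere 0 R) r" "\<And>x. x \<in> sphere 0 R \<Longrightarrow> F0 x = exp (r x)"
    using continuous_logarithm_on_simply_connected[OF continuous_on_subset[OF F0(1)] simply_connected_sphere[OF DIM] locally_path_connected_sphere, of 0 R] sph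
    by (metis sphere_cball)
  \<comment> \<open>The value of \<open>Im (snd x)\<close> on the image of the sphere of radius
    \<open>R\<close>; it separates the ball from the cap.\<close>
  define h where "h = (R\<^sup>2 - 1) / (R\<^sup>2 + 1)"
  have R1: "R\<^sup>2 + 1 > 0" by (smt (verit) zero_le_power2)
  have h1: "h < 1" using R1 by (simp add: h_def field_simps)
  have Rh: "R\<^sup>2 * (1 - h) = 1 + h" using R1 by (simp add: h_def field_simps)
  have cmp: "(norm (stereo x) \<le> R \<longleftrightarrow> Im (snd x) \<le> h) \<and> (R \<le> norm (stereo x) \<longleftrightarrow> h \<le> Im (snd x))"
    if x: "x \<in> S3" "Im (snd x) \<noteq> 1" for x
  proof -
    define m where "m = Im (snd x)"
    define N where "N = (norm (stereo x))\<^sup>2"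
    have "m\<^sup>2 \<le> 1" using x(1) unfolding S3_iff m_def by (smt (verit) zero_le_power2)
    then have m: "m < 1" using x(2) by (simp add: abs_square_le_1 m_def)
    have N: "N * (1 - m) = 1 + m" using norm_stereo[OF x] by (simp add: N_def m_def)
    have "(N - R\<^sup>2) * ((1 - m) * (1 - h)) = 2 * (m - h)"
    proof -
      have "(N - R\<^sup>2) * ((1 - m) * (1 - h)) = (N * (1 - m)) * (1 - h) - (R\<^sup>2 * (1 - h)) * (1 - m)" by (simp add: algebra_simps)
      also have "\<dots> = 2 * (m - h)" unfolding N Rh by (simp add: algebra_simps)
      finally show ?thesis .
    qed
    moreover have "(1 - m) * (1 - h) > 0" using m h1 by simp
    ultimately have "N \<le> R\<^sup>2 \<longleftrightarrow> m \<le> h" "R\<^sup>2 \<le> N \<longleftrightarrow> h \<le> m"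
      by (smt (verit) mult_nonneg_nonneg mult_pos_pos mult_neg_pos mult_nonpos_nonneg)+
    moreover have "norm (stereo x) \<le> R \<longleftrightarrow> N \<le> R\<^sup>2" "R \<le> norm (stereo x) \<longleftrightarrow> R\<^sup>2 \<le> N"
      unfolding N_def using R(1) by (auto simp: abs_le_square_iff[symmetric])
    ultimately show ?thesis by (simp add: m_def)
  qed
  define A1 A2 where "A1 = {x \<in> S3. Im (snd x) \<le> h}" and "A2 = {x \<in> S3. h \<le> Im (snd x)}"
  have A12: "A1 \<union> A2 = S3" by (auto simp: A1_def A2_def)
  have clS: "closed S3" by (simp add: S3_def)
  have clA: "closed A1" "closed A2"
    unfolding A1_def A2_def by (intro closed_Collect_conj closed_Collect_le continuous_intros; simp add: clS)+
  have st1: "stereo x \<in> cball 0 R" if "x \<in> A1" for x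
    using cmp[of x] that h1 by (auto simp: A1_def)
  have st12: "stereo x \<in> sphere 0 R" if "x \<in> A1 \<inter> A2" for x
    using cmp[of x] that h1 by (auto simp: A1_def A2_def)
  have cs: "continuous_on A1 stereo" using h1 by (intro continuous_on_stereo) (auto simp: A1_def)
  have "continuous_on (A1 \<inter> A2) (\<lambda>x. r (stereo x))"
    by (rule continuous_on_compose2[OF r(1) continuous_on_subset[OF cs]]) (use st12 in auto)
  moreover have "closedin (top_of_set A2) (A1 \<inter> A2)"
    using clA by (intro closed_subset) auto
  ultimately obtain q where q: "continuous_on A2 q" "\<And>x. x \<in> A1 \<inter> A2 \<Longrightarrow> q x = r (stereo x)"
    using Tietze_unbounded by metis
  define Fs where "Fs x = (if Im (snd x) \<le> h then F0 (stereo x) else exp (q x))" for x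
  have glue: "F0 (stereo x) = exp (q x)" if "x \<in> A1 \<inter> A2" for x using q(2)[OF that] r(2)[OF st12[OF that]] by simp
  show thesis
  proof (rule that[of Fs])
    have "continuous_on (A1 \<union> A2) Fs" unfolding Fs_def
    proof (rule continuous_on_cases_local)
      show "closedin (top_of_set (A1 \<union> A2)) A1" "closedin (top_of_set (A1 \<union> A2)) A2"
        using clA by (auto intro: closed_subset)
      show "continuous_on A1 (\<lambda>x. F0 (stereo x))"
        by (rule continuous_on_compose2[OF F0(1) cs]) (use st1 in auto)
      show "continuous_on A2 (\<lambda>x. exp (q x))" by (intro continuous_on_exp q)
      show "F0 (stereo x) = exp (q x)" if "x \<in> A1 \<and> \<not> Im (snd x) \<le> h \<or> x \<in> A2 \<and> Im (snd x) \<le> h" for x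
        using that glue[of x] by (auto simp: A1_def A2_def)
    qed
    then show "continuous_on S3 Fs" by (simp add: A12)
    have st: "stereo x \<in> range (D i) \<longleftrightarrow> x \<in> inv_stereo ` range (D i)" if "x \<in> S3" "Im (snd x) \<noteq> 1" for x
      using inv_stereo_stereo[OF that] stereo_inv_stereo by (metis imageE imageI)
    show "Fs x = 0 \<longleftrightarrow> x \<in> inv_stereo ` range (D i)" if x: "x \<in> S3" for x
    proof (cases "Im (snd x) \<le> h")
      case True
      then have "x \<in> A1" "Im (snd x) \<noteq> 1" using x h1 by (auto simp: A1_def)
      then show ?thesis using True F0(2)[OF st1] st[OF x] by (simp add: Fs_def)
    next
      case False
      have "x \<notin> inv_stereo ` range (D i)"
      proof
        assume "x \<in> inv_stereo ` range (D i)"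
        then obtain t where t: "x = inv_stereo (D i t)" by blast
        then have "norm (stereo x) \<le> R" using KR[of t] by (simp add: stereo_inv_stereo)
        then show False using cmp[OF x] False inv_stereo_Im_neq_1 t by blast
      qed
      then show ?thesis using False by (simp add: Fs_def)
    qed
    have inR: "Fs (inv_stereo p) = F0 p" if "p \<in> ball 0 R" for p
    proof -
      have "Im (snd (inv_stereo p)) \<le> h"
        using cmp[OF inv_stereo_in_S3 inv_stereo_Im_neq_1, of p] that by (simp add: stereo_inv_stereo)
      then show ?thesis by (simp add: Fs_def stereo_inv_stereo)
    qed
    show "has_degree_one D nn i (\<lambda>p. Fs (inv_stereo p))" unfolding has_degree_one_def
    proof (intro exI[of _ rad] exI[of _ "\<lambda>p. G (Tb i p)"] conjI allI impI rad)
      show "continuous_on {p. \<bar>Im (fst p)\<bar> < rad \<and> \<bar>snd p\<bar> < rad} (\<lambda>p. G (Tb i p))"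
        by (rule continuous_on_compose2[OF G(1) continuous_on_Tb[OF i]]) (use V(6) R(2) in fastforce)
      fix p :: "complex \<times> real" assume p: "\<bar>Im (fst p)\<bar> < rad \<and> \<bar>snd p\<bar> < rad"
      then have T: "Tb i p \<in> V" "A (Tb i p) = transv p" "Tb i p \<in> ball 0 R" using V(6) R(2) by blast+
      then have "G (Tb i p) \<noteq> 0 \<and> F0 (Tb i p) = A (Tb i p) * G (Tb i p)" using G(2)[of "Tb i p"] by simp
      then show "G (Tb i p) \<noteq> 0" "Fs (inv_stereo (Tb i p)) = transv p * G (Tb i p)"
        using T inR by simp_all
    qed
  qed
qed

section \<open>The angle around the unknotted component and its winding along the others\<close>

lemma unit_angle_ex:
  fixes u :: "'a::real_normed_vector \<Rightarrow> complex"
  assumes "contractible W" "continuous_on W u" "\<And>x. x \<in> W \<Longrightarrow> norm (u x) = 1"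
  obtains \<theta> :: "'a \<Rightarrow> real" where "continuous_on W \<theta>" "\<And>x. x \<in> W \<Longrightarrow> exp (\<i> * \<theta> x) = u x"
proof -
  obtain l where l: "continuous_on W l" "\<And>x. x \<in> W \<Longrightarrow> u x = exp (l x)"
    using continuous_logarithm_on_contractible[OF assms(2,1)] assms(3) by (metis norm_zero zero_neq_one)
  show thesis
  proof (rule that[of "\<lambda>x. Im (l x)"])
    show "continuous_on W (\<lambda>x. Im (l x))" by (intro continuous_intros l)
    fix x assume x: "x \<in> W"
    have "exp (Re (l x)) = 1" using assms(3)[OF x] l(2)[OF x] by simp
    then have "l x = \<i> * Im (l x)" by (simp add: complex_eq_iff)
    then show "exp (\<i> * Im (l x)) = u x" using l(2)[OF x] by simp
  qed
qed

lemma angles_differ: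
  fixes \<theta> \<theta>' :: "'a::topological_space \<Rightarrow> real"
  assumes "connected S" "continuous_on S \<theta>" "continuous_on S \<theta>'"
    and "\<And>x. x \<in> S \<Longrightarrow> exp (\<i> * \<theta> x) = exp (\<i> * \<theta>' x)"
  shows "\<exists>k::int. \<forall>x\<in>S. \<theta> x = \<theta>' x + 2 * pi * k"
proof -
  have "\<exists>k::int. \<forall>x\<in>S. \<i> * \<theta> x = \<i> * \<theta>' x + 2 * pi * \<i> * k"
    using assms by (intro logs_differ continuous_intros) auto
  then obtain k :: int where k: "\<And>x. x \<in> S \<Longrightarrow> \<i> * \<theta> x = \<i> * \<theta>' x + 2 * pi * \<i> * k" by blast
  have "\<theta> x = \<theta>' x + 2 * pi * k" if "x \<in> S" for x
    using arg_cong[OF k[OF that], of Im] by simp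
  then show ?thesis by blast
qed

text \<open>\<open>f\<close> is only a homeomorphism: it carries the knot of the diagram to the
  great circle, but is not assumed to respect tubes or orientations.\<close>

locale unknot_diag = diag I D nn b \<delta> for I :: "'i set" and D nn b \<delta> +
  fixes K :: 'i and f g :: "complex \<times> complex \<Rightarrow> complex \<times> complex"
  assumes K: "K \<in> I" and hom: "homeomorphism S3 S3 f g"
    and fK: "f ` (inv_stereo ` range (D K)) = great_circle"
    and lk: "\<And>i. i \<in> I \<Longrightarrow> i \<noteq> K \<Longrightarrow> even (linking_number I D K i)"
begin

text \<open>Outside the great circle a point \<open>y\<close> of the 3-sphere is determined by the direction of \<open>snd y\<close>,
  which turns around the great circle, and by \<open>fst y\<close> in the open unit disc.\<close>

definition jj :: "complex \<times> real \<Rightarrow> complex \<times> complex" where "jj p = f (inv_stereo p)"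
definition al :: "complex \<times> real \<Rightarrow> complex" where "al p = sgn (snd (jj p))"
definition be :: "complex \<times> real \<Rightarrow> complex" where "be p = fst (jj p)"
definition pt :: "complex \<Rightarrow> complex \<Rightarrow> complex \<times> complex"
  where "pt a z = (z, a * of_real (sqrt (1 - (norm z)\<^sup>2)))"

lemma jj_S3: "jj p \<in> S3"
  using hom inv_stereo_in_S3 unfolding jj_def homeomorphism_def by blast

lemma g_jj: "g (jj p) = inv_stereo p"
  using hom inv_stereo_in_S3 unfolding jj_def homeomorphism_def by blast

lemma jj_inj: "jj p = jj q \<longleftrightarrow> p = q"
  using g_jj inv_stereo_eq_iff by metis

lemma continuous_on_jj: "continuous_on S jj"
proof -
  have "continuous_on S3 f" using hom by (simp add: homeomorphism_def)
  then show ?thesis unfolding jj_def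
    by (rule continuous_on_compose2[OF _ continuous_on_inv_stereo]) (use inv_stereo_in_S3 in auto)
qed

lemma snd_jj: "p \<notin> range (D K) \<Longrightarrow> snd (jj p) \<noteq> 0"
proof
  assume p: "p \<notin> range (D K)" "snd (jj p) = 0"
  then have "jj p \<in> f ` (inv_stereo ` range (D K))" unfolding fK great_circle_def using jj_S3 by simp
  then obtain t where "jj p = jj (D K t)" by (auto simp: jj_def)
  then show False using p(1) by (auto simp: jj_inj)
qed

lemma norm_al: "p \<notin> range (D K) \<Longrightarrow> norm (al p) = 1"
  using snd_jj by (simp add: al_def norm_sgn)

lemma S3_norms: "x \<in> S3 \<longleftrightarrow> (norm (fst x))\<^sup>2 + (norm (snd x))\<^sup>2 = 1"
  unfolding S3_iff by (simp add: cmod_power2 add.assoc)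

lemma norm_be: "p \<notin> range (D K) \<Longrightarrow> norm (be p) < 1"
proof -
  assume "p \<notin> range (D K)"
  then have "(norm (snd (jj p)))\<^sup>2 > 0" using snd_jj by simp
  moreover have "(norm (be p))\<^sup>2 + (norm (snd (jj p)))\<^sup>2 = 1" using jj_S3[of p] unfolding S3_norms be_def .
  ultimately have "(norm (be p))\<^sup>2 < 1" by linarith
  then show ?thesis by (simp add: abs_square_less_1)
qed

lemma jj_pt: "p \<notin> range (D K) \<Longrightarrow> jj p = pt (al p) (be p)"
proof -
  assume p: "p \<notin> range (D K)"
  have "1 - (norm (be p))\<^sup>2 = (norm (snd (jj p)))\<^sup>2" using jj_S3[of p] unfolding S3_norms be_def by simp
  then have "sqrt (1 - (norm (be p))\<^sup>2) = norm (snd (jj p))" by simp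
  moreover have "sgn (snd (jj p)) * of_real (norm (snd (jj p))) = snd (jj p)"
    using snd_jj[OF p] by (simp add: sgn_div_norm scaleR_conv_of_real)
  ultimately show ?thesis by (simp add: pt_def al_def be_def prod_eq_iff)
qed

lemma pt_S3: "norm a = 1 \<Longrightarrow> norm z < 1 \<Longrightarrow> pt a z \<in> S3 \<and> snd (pt a z) \<noteq> 0"
proof -
  assume a: "norm a = 1" "norm z < 1"
  then have z: "(norm z)\<^sup>2 < 1" by (simp add: abs_square_less_1)
  then show ?thesis unfolding S3_norms using a by (auto simp: pt_def norm_mult power_mult_distrib)
qed

lemma continuous_on_al_be: "S \<inter> range (D K) = {} \<Longrightarrow> continuous_on S al" "continuous_on S be"
proof -
  show "continuous_on S be" unfolding be_def by (intro continuous_on_fst continuous_on_jj)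
  show "continuous_on S al" if "S \<inter> range (D K) = {}"
    unfolding al_def using that snd_jj by (intro continuous_on_sgn continuous_on_snd continuous_on_jj) blast
qed

lemma al_be_inj: "p \<notin> range (D K) \<Longrightarrow> q \<notin> range (D K) \<Longrightarrow> al p = al q \<Longrightarrow> be p = be q \<Longrightarrow> p = q"
  using jj_pt jj_inj by metis

lemma other_component: "i \<in> I \<Longrightarrow> i \<noteq> K \<Longrightarrow> D i t \<notin> range (D K)"
  using LD(8)[OF K] by (metis imageE)

text \<open>The universal cover of the complement of the great circle is \<open>\<real> \<times> ball 0 1\<close>, on which the
  function of the knot has a logarithm \<open>lam\<close>.\<close>

lemma knot_log:
  obtains F :: "complex \<times> real \<Rightarrow> complex" and lam :: "real \<times> complex \<Rightarrow> complex" and d :: int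
  where "continuous_on (- range (D K)) F" "\<And>p. p \<notin> range (D K) \<Longrightarrow> F p \<noteq> 0" "has_degree_one D nn K F"
    "continuous_on (UNIV \<times> ball 0 1) lam"
    "\<And>p \<theta>. p \<notin> range (D K) \<Longrightarrow> exp (\<i> * of_real \<theta>) = al p \<Longrightarrow> F p = exp (lam (\<theta>, be p))"
    "\<And>\<theta> z (k::int). norm z < 1 \<Longrightarrow> lam (\<theta> + 2 * pi * k, z) = lam (\<theta>, z) + 2 * pi * \<i> * (d * k)"
proof -
  obtain Fs where Fs: "continuous_on S3 Fs" "\<And>x. x \<in> S3 \<Longrightarrow> Fs x = 0 \<longleftrightarrow> x \<in> inv_stereo ` range (D K)"
    "has_degree_one D nn K (\<lambda>p. Fs (inv_stereo p))" using knot_function[OF K] by blast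
  let ?U = "UNIV \<times> ball 0 1 :: (real \<times> complex) set"
  define w where "w x = pt (exp (\<i> * of_real (fst x))) (snd x)" for x :: "real \<times> complex"
  have w: "w x \<in> S3" "snd (w x) \<noteq> 0" if "x \<in> ?U" for x
    using pt_S3[of "exp (\<i> * of_real (fst x))" "snd x"] that by (auto simp: w_def mem_Times_iff)
  have cw: "continuous_on ?U w" unfolding w_def pt_def by (intro continuous_intros)
  have gS: "g x \<in> S3" "f (g x) = x" if "x \<in> S3" for x using hom that unfolding homeomorphism_def by blast+
  have cg: "continuous_on S3 g" using hom by (simp add: homeomorphism_def)
  have cF: "continuous_on ?U (\<lambda>x. Fs (g (w x)))"
    by (rule continuous_on_compose2[OF Fs(1) continuous_on_compose2[OF cg cw]])(use w gS in blast)+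
  have nz: "Fs (g (w x)) \<noteq> 0" if x: "x \<in> ?U" for x
  proof
    assume "Fs (g (w x)) = 0"
    then have "g (w x) \<in> inv_stereo ` range (D K)" using Fs(2) gS(1) w(1)[OF x] by blast
    then have "f (g (w x)) \<in> great_circle" unfolding fK[symmetric] by blast
    then show False using gS(2) w[OF x] by (simp add: great_circle_def)
  qed
  have convU: "convex ?U" by (intro convex_Times convex_ball convex_UNIV)
  obtain lam where lam: "continuous_on ?U lam" "\<And>x. x \<in> ?U \<Longrightarrow> Fs (g (w x)) = exp (lam x)"
    using continuous_logarithm_on_contractible[OF cF convex_imp_contractible[OF convU] nz] by blast
  have wper: "w (\<theta> + 2 * pi, z) = w (\<theta>, z)" for \<theta> z
    by (simp add: w_def distrib_left exp_add exp_two_pi_i mult.commute mult.left_commute)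
  \<comment> \<open>\<open>d\<close> is the winding number of the knot function along a circle on
    which the angle makes one turn.\<close>
  have "\<exists>d::int. \<forall>x\<in>?U. lam (fst x + 2 * pi, snd x) = lam x + 2 * pi * \<i> * d"
  proof (rule logs_differ[OF convex_connected[OF convU] _ lam(1)])
    show "continuous_on ?U (\<lambda>x. lam (fst x + 2 * pi, snd x))"
      by (intro continuous_on_compose2[OF lam(1)] continuous_intros) auto
    fix x assume x: "x \<in> ?U"
    then have "(fst x + 2 * pi, snd x) \<in> ?U" by (auto simp: mem_Times_iff)
    then show "exp (lam (fst x + 2 * pi, snd x)) = exp (lam x)"
      using lam(2)[OF x] lam(2) wper[of "fst x" "snd x"] by (metis prod.collapse)
  qed
  then obtain d :: int where d: "\<And>\<theta> z. norm z < 1 \<Longrightarrow> lam (\<theta> + 2 * pi, z) = lam (\<theta>, z) + 2 * pi * \<i> * d"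
    by (force simp: mem_Times_iff)
  have dk: "lam (\<theta> + 2 * pi * k, z) = lam (\<theta>, z) + 2 * pi * \<i> * (d * k)" if z: "norm z < 1" for \<theta> z and k :: int
  proof -
    \<comment> \<open>Without its linear growth \<open>lam\<close> has period one in this scale, so
      \<open>periodic_shift\<close> treats all integers at once.\<close>
    define h where "h t = lam (2 * pi * t, z) - 2 * pi * \<i> * (d * t)" for t :: real
    have "h (t + 1) = h t" for t
      using d[OF z, of "2 * pi * t"] by (simp add: h_def algebra_simps)
    from periodic_shift[of h, OF this, of "\<theta> / (2 * pi)" k]
    have "lam (2 * pi * (\<theta> / (2 * pi) + k), z) - 2 * pi * \<i> * (d * (\<theta> / (2 * pi) + k)) = lam (2 * pi * (\<theta> / (2 * pi)), z) - 2 * pi * \<i> * (d * (\<theta> / (2 * pi)))"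
      by (simp add: h_def)
    moreover have "2 * pi * (\<theta> / (2 * pi) + k) = \<theta> + 2 * pi * k" "2 * pi * (\<theta> / (2 * pi)) = \<theta>"
      by (simp_all add: field_simps)
    ultimately show ?thesis by (simp add: algebra_simps)
  qed
  show thesis
  proof (rule that[OF _ _ Fs(3) lam(1) _ dk])
    show "continuous_on (- range (D K)) (\<lambda>p. Fs (inv_stereo p))"
      by (rule continuous_on_compose2[OF Fs(1) continuous_on_inv_stereo]) (use inv_stereo_in_S3 in auto)
    show "Fs (inv_stereo p) \<noteq> 0" if "p \<notin> range (D K)" for p
      using that Fs(2)[OF inv_stereo_in_S3, of p] by (auto simp: inv_stereo_eq_iff)
    show "Fs (inv_stereo p) = exp (lam (\<theta>, be p))" if p: "p \<notin> range (D K)" "exp (\<i> * of_real \<theta>) = al p" for p \<theta>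
    proof -
      have "(\<theta>, be p) \<in> ?U" using norm_be[OF p(1)] by simp
      moreover have "w (\<theta>, be p) = jj p" using jj_pt[OF p(1)] p(2) by (simp add: w_def)
      ultimately show ?thesis using lam(2) g_jj by metis
    qed
  qed
qed

text \<open>The jump of the angle by \<open>k\<close> turns makes \<open>lam\<close> jump by
  \<open>d * k\<close> periods, whereas degree one makes it jump by exactly one. So a meridian of
  the diagram winds once around the great circle, up to sign, although \<open>f\<close> has no
  derivative to show it.\<close>

lemma meridian_angle_odd:
  fixes k :: int
  assumes a: "0 < a" and \<theta>d: "continuous_on (bx s a \<inter> lower) \<theta>d" and \<theta>u: "continuous_on (bx s a \<inter> upper) \<theta>u"
    and ed: "\<And>p. p \<in> bx s a \<Longrightarrow> p \<in> lower \<Longrightarrow> Tb K p \<notin> range (D K) \<and> exp (\<i> * of_real (\<theta>d p)) = al (Tb K p)"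
    and eu: "\<And>p. p \<in> bx s a \<Longrightarrow> p \<in> upper \<Longrightarrow> Tb K p \<notin> range (D K) \<and> exp (\<i> * of_real (\<theta>u p)) = al (Tb K p)"
    and right: "\<And>p. p \<in> bx s a \<Longrightarrow> Im (fst p) < 0 \<Longrightarrow> \<theta>d p = \<theta>u p"
    and left: "\<And>p. p \<in> bx s a \<Longrightarrow> 0 < Im (fst p) \<Longrightarrow> \<theta>d p = \<theta>u p + 2 * pi * k"
    and F: "has_degree_one D nn K F"
    and lam: "continuous_on (UNIV \<times> ball 0 1) lam"
    "\<And>p \<theta>. p \<notin> range (D K) \<Longrightarrow> exp (\<i> * of_real \<theta>) = al p \<Longrightarrow> F p = exp (lam (\<theta>, be p))"
    "\<And>\<theta> z (k::int). norm z < 1 \<Longrightarrow> lam (\<theta> + 2 * pi * k, z) = lam (\<theta>, z) + 2 * pi * \<i> * (d * k)"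
  shows "d * k = 1"
proof -
  have cb: "continuous_on S (\<lambda>p. be (Tb K p))" for S
    by (rule continuous_on_compose2[OF continuous_on_al_be(2) continuous_on_Tb[OF K]]) auto
  have "\<exists>p\<in>bx s a. 0 < Im (fst p) \<and> lam (\<theta>d p, be (Tb K p)) = lam (\<theta>u p, be (Tb K p)) + 2 * pi * \<i>"
  proof (rule degree_one_jump[OF K F a])
    show "continuous_on (bx s a \<inter> lower) (\<lambda>p. lam (\<theta>d p, be (Tb K p)))"
    proof (rule continuous_on_compose2[OF lam(1) continuous_on_Pair[OF \<theta>d cb]], rule image_subsetI)
      fix p assume "p \<in> bx s a \<inter> lower"
      then show "(\<theta>d p, be (Tb K p)) \<in> UNIV \<times> ball 0 1" using ed[of p] norm_be[of "Tb K p"] by simp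
    qed
    show "continuous_on (bx s a \<inter> upper) (\<lambda>p. lam (\<theta>u p, be (Tb K p)))"
    proof (rule continuous_on_compose2[OF lam(1) continuous_on_Pair[OF \<theta>u cb]], rule image_subsetI)
      fix p assume "p \<in> bx s a \<inter> upper"
      then show "(\<theta>u p, be (Tb K p)) \<in> UNIV \<times> ball 0 1" using eu[of p] norm_be[of "Tb K p"] by simp
    qed
    show "exp (lam (\<theta>d p, be (Tb K p))) = F (Tb K p)" if "p \<in> bx s a" "p \<in> lower" for p
      using lam(2)[of "Tb K p" "\<theta>d p"] ed[OF that] by simp
    show "exp (lam (\<theta>u p, be (Tb K p))) = F (Tb K p)" if "p \<in> bx s a" "p \<in> upper" for p
      using lam(2)[of "Tb K p" "\<theta>u p"] eu[OF that] by simp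
    show "lam (\<theta>d p, be (Tb K p)) = lam (\<theta>u p, be (Tb K p))" if "p \<in> bx s a" "Im (fst p) < 0" for p
      using right[OF that] by simp
  qed
  then obtain p where p: "p \<in> bx s a" "0 < Im (fst p)"
    "lam (\<theta>d p, be (Tb K p)) = lam (\<theta>u p, be (Tb K p)) + 2 * pi * \<i>" by blast
  have "p \<in> upper" using p(2) by (simp add: upper_def)
  then have "norm (be (Tb K p)) < 1" using eu[OF p(1)] norm_be by blast
  then have "2 * pi * \<i> * (d * k) = 2 * pi * \<i>" using p(3) left[OF p(1,2)] lam(3) by simp
  then have "(of_int (d * k) :: complex) = 1" by simp
  then show ?thesis by (metis of_int_eq_1_iff)
qed

lemma Tb_avoid: "p \<in> bx s rad \<Longrightarrow> p \<in> lower \<or> p \<in> upper \<Longrightarrow> i \<in> I \<Longrightarrow> Tb i p \<notin> L"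
  using Tb_avoids_L[of i s] by blast

lemma range_L: "i \<in> I \<Longrightarrow> range (D i) \<subseteq> L"
  using in_L by blast

text \<open>Along the component \<open>lam\<close> changes by \<open>d * m\<close> periods, and each
  of the two crossing counts equals this number. Hence \<open>div 2\<close> loses nothing and the
  linking number is \<open>d * m\<close>; as \<open>d\<close> divides \<open>1\<close>, evenness
  passes to \<open>m\<close>.\<close>

lemma angle_period_even:
  assumes i: "i \<in> I" "i \<noteq> K" and \<theta>: "continuous_on UNIV \<theta>" "\<And>t. exp (\<i> * of_real (\<theta> t)) = al (D i t)"
  obtains m :: int where "even m" "\<And>t. \<theta> (t + 1) = \<theta> t + 2 * pi * m"
proof -
  obtain F lam d where F: "continuous_on (- range (D K)) F" "\<And>p. p \<notin> range (D K) \<Longrightarrow> F p \<noteq> 0" "has_degree_one D nn K F"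
    and lam: "continuous_on (UNIV \<times> ball 0 1) lam"
    "\<And>p \<theta>. p \<notin> range (D K) \<Longrightarrow> exp (\<i> * of_real \<theta>) = al p \<Longrightarrow> F p = exp (lam (\<theta>, be p))"
    "\<And>\<theta> z (k::int). norm z < 1 \<Longrightarrow> lam (\<theta> + 2 * pi * k, z) = lam (\<theta>, z) + 2 * pi * \<i> * (d * k)"
    using knot_log by blast
  \<comment> \<open>One meridian of the knot suffices, here the one at parameter \<open>0\<close>.
    The angles below and above the strand are chosen independently and then matched on the right by
    \<open>k1\<close>.\<close>
  have "odd d"
  proof -
    have sub: "Tb K p \<notin> range (D K)" if "p \<in> bx 0 rad" "p \<in> lower \<or> p \<in> upper" for p
      using Tb_avoid[OF that K] range_L[OF K] by blast
    have cal: "continuous_on (bx 0 rad \<inter> X) (\<lambda>p. al (Tb K p))" if X: "X = lower \<or> X = upper" for X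
    proof (rule continuous_on_compose2[OF continuous_on_al_be(1) continuous_on_Tb[OF K] order_refl])
      show "Tb K ` (bx 0 rad \<inter> X) \<inter> range (D K) = {}" using sub X by blast
    qed
    obtain \<theta>d :: "complex \<times> real \<Rightarrow> real" where \<theta>d: "continuous_on (bx 0 rad \<inter> lower) \<theta>d"
      "\<And>p. p \<in> bx 0 rad \<inter> lower \<Longrightarrow> exp (\<i> * of_real (\<theta>d p)) = al (Tb K p)"
    proof (rule unit_angle_ex[OF contractible_bx_lower[OF rad(1)] cal])
      show "norm (al (Tb K p)) = 1" if "p \<in> bx 0 rad \<inter> lower" for p using sub[of p] that by (intro norm_al) blast
    qed (blast, rule that)
    obtain \<theta>u :: "complex \<times> real \<Rightarrow> real" where \<theta>u: "continuous_on (bx 0 rad \<inter> upper) \<theta>u"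
      "\<And>p. p \<in> bx 0 rad \<inter> upper \<Longrightarrow> exp (\<i> * of_real (\<theta>u p)) = al (Tb K p)"
    proof (rule unit_angle_ex[OF contractible_bx_upper[OF rad(1)] cal])
      show "norm (al (Tb K p)) = 1" if "p \<in> bx 0 rad \<inter> upper" for p using sub[of p] that by (intro norm_al) blast
    qed (blast, rule that)
    have half: "\<exists>k::int. \<forall>p\<in>bx 0 rad \<inter> H. \<theta>d p = \<theta>u p + 2 * pi * k"
      if "connected (bx 0 rad \<inter> H)" "H \<subseteq> lower" "H \<subseteq> upper" for H
    proof (rule angles_differ[OF that(1)])
      show "continuous_on (bx 0 rad \<inter> H) \<theta>d" using that by (intro continuous_on_subset[OF \<theta>d(1)]) auto
      show "continuous_on (bx 0 rad \<inter> H) \<theta>u" using that by (intro continuous_on_subset[OF \<theta>u(1)]) auto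
      show "exp (\<i> * of_real (\<theta>d x)) = exp (\<i> * of_real (\<theta>u x))" if x: "x \<in> bx 0 rad \<inter> H" for x
      proof -
        have "x \<in> bx 0 rad \<inter> lower" "x \<in> bx 0 rad \<inter> upper" using x \<open>H \<subseteq> lower\<close> \<open>H \<subseteq> upper\<close> by blast+
        then show ?thesis using \<theta>d(2) \<theta>u(2) by simp
      qed
    qed
    obtain k1 :: int where k1: "\<And>p. p \<in> bx 0 rad \<Longrightarrow> Im (fst p) < 0 \<Longrightarrow> \<theta>d p = \<theta>u p + 2 * pi * k1"
    proof -
      have "\<exists>k::int. \<forall>p\<in>bx 0 rad \<inter> {p. Im (fst p) < 0}. \<theta>d p = \<theta>u p + 2 * pi * k"
        by (rule half[OF convex_connected[OF convex_bx_half(1)]]) (auto simp: lower_def upper_def)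
      then show thesis using that by blast
    qed
    obtain k2 :: int where k2: "\<And>p. p \<in> bx 0 rad \<Longrightarrow> 0 < Im (fst p) \<Longrightarrow> \<theta>d p = \<theta>u p + 2 * pi * k2"
    proof -
      have "\<exists>k::int. \<forall>p\<in>bx 0 rad \<inter> {p. 0 < Im (fst p)}. \<theta>d p = \<theta>u p + 2 * pi * k"
        by (rule half[OF convex_connected[OF convex_bx_half(2)]]) (auto simp: lower_def upper_def)
      then show thesis using that by blast
    qed
    have "d * (k2 - k1) = 1"
    proof (rule meridian_angle_odd[OF rad(1) \<theta>d(1) _ _ _ _ _ F(3) lam])
      show "continuous_on (bx 0 rad \<inter> upper) (\<lambda>p. \<theta>u p + 2 * pi * k1)" by (intro continuous_intros \<theta>u)
      show "Tb K p \<notin> range (D K) \<and> exp (\<i> * of_real (\<theta>d p)) = al (Tb K p)" if "p \<in> bx 0 rad" "p \<in> lower" for p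
        using \<theta>d(2) sub that by blast
      show "Tb K p \<notin> range (D K) \<and> exp (\<i> * of_real (\<theta>u p + 2 * pi * k1)) = al (Tb K p)" if p: "p \<in> bx 0 rad" "p \<in> upper" for p
      proof -
        have "exp (\<i> * of_real (\<theta>u p + 2 * pi * k1)) = exp (\<i> * of_real (\<theta>u p))"
          unfolding exp_eq by (intro exI[of _ k1]) (simp add: algebra_simps)
        then show ?thesis using \<theta>u(2) sub p by auto
      qed
      show "\<theta>d p = \<theta>u p + 2 * pi * k1" if "p \<in> bx 0 rad" "Im (fst p) < 0" for p using k1 that by blast
      show "\<theta>d p = \<theta>u p + 2 * pi * k1 + 2 * pi * of_int (k2 - k1)" if "p \<in> bx 0 rad" "0 < Im (fst p)" for p
        using k2[OF that] by (simp add: algebra_simps)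
    qed
    then show ?thesis by (metis dvd_mult2 odd_one)
  qed
  have "\<exists>m::int. \<forall>t\<in>UNIV. \<theta> (t + 1) = \<theta> t + 2 * pi * m"
    by (rule angles_differ) (use \<theta> LD(2)[OF i(1)] in \<open>auto intro!: continuous_intros continuous_on_compose2[OF \<theta>(1)]\<close>)
  then obtain m :: int where m: "\<And>t. \<theta> (t + 1) = \<theta> t + 2 * pi * m" by blast
  define l where "l t = lam (\<theta> t, be (D i t))" for t
  have nK: "D i t \<notin> range (D K)" for t by (rule other_component[OF i])
  have cl: "continuous_on UNIV l" unfolding l_def
  proof (rule continuous_on_compose2[OF lam(1)])
    show "continuous_on UNIV (\<lambda>t. (\<theta> t, be (D i t)))"
      by (intro continuous_intros \<theta> continuous_on_compose2[OF continuous_on_al_be(2) LD(4)[OF i(1)]]) auto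
    show "(\<lambda>t. (\<theta> t, be (D i t))) ` UNIV \<subseteq> UNIV \<times> ball 0 1"
    proof (rule image_subsetI)
      show "(\<theta> t, be (D i t)) \<in> UNIV \<times> ball 0 1" for t using norm_be[OF nK[of t]] by simp
    qed
  qed
  have el: "exp (l t) = F (D i t)" for t using lam(2)[OF nK \<theta>(2)] by (simp add: l_def)
  have "l 1 - l 0 = 2 * pi * \<i> * (d * m)"
    using m[of 0] LD(2)[OF i(1), of 0] lam(3)[OF norm_be[OF nK], of "\<theta> 0" m 0] by (simp add: l_def)
  moreover have "l 1 - l 0 = 2 * pi * \<i> * of_int (signed_crossings I D K i)"
    by (rule winding_count[OF K i(1) _ F cl el]) (use i in auto)
  moreover have "l 1 - l 0 = 2 * pi * \<i> * of_int (signed_crossings I D i K)"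
    by (rule winding_count_mirror[OF K i(1) _ F cl el]) (use i in auto)
  ultimately have "(of_int (d * m) :: complex) = of_int (signed_crossings I D K i)"
    "(of_int (d * m) :: complex) = of_int (signed_crossings I D i K)" by simp_all
  then have "signed_crossings I D K i = d * m" "signed_crossings I D i K = d * m" by (metis of_int_eq_iff)+
  then have "linking_number I D K i = d * m" by (simp add: linking_number_def)
  then have "even m" using lk[OF i] \<open>odd d\<close> by simp
  then show thesis using m that by blast
qed

end

section \<open>A function with divisor one lift of every other component\<close>

text \<open>The complement of the great circle, and likewise its double cover, is realised as a solid torus in
  space, with angle \<open>a\<close> and disc coordinate \<open>z\<close>.\<close>

definition solid :: "complex \<Rightarrow> complex \<Rightarrow> complex \<times> real"
  where "solid a z = (of_real (2 + Re z) * a, Im z)"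
definition solid_angle :: "complex \<times> real \<Rightarrow> complex" where "solid_angle x = sgn (fst x)"
definition solid_disc :: "complex \<times> real \<Rightarrow> complex" where "solid_disc x = Complex (norm (fst x) - 2) (snd x)"
definition solid_torus :: "(complex \<times> real) set" where "solid_torus = {x. norm (solid_disc x) < 1}"

text \<open>The offset \<open>2\<close> keeps the distance from the axis between \<open>1\<close>
  and \<open>3\<close>, so that angle and disc coordinate can be recovered. The torus is placed in
  Euclidean space to make \<open>divisor_on_cbox\<close> applicable.\<close>

lemma solid_coords:
  assumes "norm a = 1" "norm z < 1"
  shows "solid_angle (solid a z) = a" "solid_disc (solid a z) = z" "solid a z \<in> solid_torus"
proof -
  have r: "2 + Re z > 0" using abs_Re_le_cmod[of z] assms(2) by linarith
  have n: "norm (of_real (2 + Re z) * a) = 2 + Re z" unfolding norm_mult norm_of_real assms(1) using r by simp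
  show "solid_angle (solid a z) = a"
    unfolding solid_angle_def solid_def fst_conv sgn_div_norm n
  proof -
    have "(of_real \<rho> * w) /\<^sub>R \<rho> = w" if "\<rho> > 0" for \<rho> :: real and w :: complex
      using that by (simp add: scaleR_conv_of_real)
    from this[OF r] show "(of_real (2 + Re z) * a) /\<^sub>R (2 + Re z) = a" .
  qed
  show d: "solid_disc (solid a z) = z"
    unfolding solid_disc_def solid_def fst_conv n by (simp add: complex_eq_iff)
  show "solid a z \<in> solid_torus" unfolding solid_torus_def using d assms(2) by simp
qed

lemma solid_torus_coords:
  assumes x: "x \<in> solid_torus"
  shows "norm (solid_angle x) = 1" "solid (solid_angle x) (solid_disc x) = x" "norm (solid_disc x) < 1" "fst x \<noteq> 0"
proof -
  show n: "norm (solid_disc x) < 1" using x by (simp add: solid_torus_def)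
  have "\<bar>norm (fst x) - 2\<bar> < 1" using abs_Re_le_cmod[of "solid_disc x"] n by (simp add: solid_disc_def)
  then show nz: "fst x \<noteq> 0" by auto
  then show "norm (solid_angle x) = 1" by (simp add: solid_angle_def norm_sgn)
  show "solid (solid_angle x) (solid_disc x) = x"
    using nz by (simp add: solid_def solid_angle_def solid_disc_def sgn_div_norm scaleR_conv_of_real prod_eq_iff)
qed

lemma continuous_on_solid_disc: "continuous_on S solid_disc"
  unfolding solid_disc_def Complex_eq by (intro continuous_intros)

lemma continuous_on_solid_angle: "continuous_on solid_torus solid_angle"
  unfolding solid_angle_def using solid_torus_coords(4) by (intro continuous_on_sgn continuous_intros) auto

lemma open_solid_torus: "open solid_torus"
  unfolding solid_torus_def by (intro open_Collect_less continuous_intros continuous_on_solid_disc)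

lemma bounded_solid_torus: "bounded solid_torus"
  unfolding bounded_iff
proof (intro exI[of _ 4] ballI)
  fix x assume x: "x \<in> solid_torus"
  have n: "norm (solid_disc x) < 1" by (rule solid_torus_coords(3)[OF x])
  have "\<bar>norm (fst x) - 2\<bar> < 1" "\<bar>snd x\<bar> < 1"
    using abs_Re_le_cmod[of "solid_disc x"] abs_Im_le_cmod[of "solid_disc x"] n by (auto simp: solid_disc_def)
  moreover have "norm x \<le> norm (fst x) + norm (snd x)" by (metis norm_Pair_le prod.collapse)
  ultimately show "norm x \<le> 4" by simp
qed

context unknot_diag
begin

lemma pt_coords:
  assumes "norm a = 1" "norm z < 1"
  shows "fst (pt a z) = z" "sgn (snd (pt a z)) = a"
proof -
  have "(norm z)\<^sup>2 < 1" using assms(2) by (simp add: abs_square_less_1)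
  then have s: "sqrt (1 - (norm z)\<^sup>2) > 0" by simp
  show "fst (pt a z) = z" by (simp add: pt_def)
  show "sgn (snd (pt a z)) = a"
    using s assms(1)unfolding pt_def snd_conv sgn_mult by (simp add: sgn_div_norm scaleR_conv_of_real)
qed

section \<open>The double cover of the complement of the knot\<close>

text \<open>Squaring the angle makes this the double covering; \<open>g\<close> returns from the
  complement of the great circle to that of the knot.\<close>

definition proj :: "complex \<times> real \<Rightarrow> complex \<times> complex"
  where "proj x = g (pt ((solid_angle x)\<^sup>2) (solid_disc x))"

lemma proj_S3:
  assumes x: "x \<in> solid_torus"
  shows "proj x \<in> S3" "f (proj x) = pt ((solid_angle x)\<^sup>2) (solid_disc x)"
proof -
  have "pt ((solid_angle x)\<^sup>2) (solid_disc x) \<in> S3"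
    using pt_S3[of "(solid_angle x)\<^sup>2" "solid_disc x"] solid_torus_coords[OF x] by (simp add: norm_power)
  then show "proj x \<in> S3" "f (proj x) = pt ((solid_angle x)\<^sup>2) (solid_disc x)"
    using hom unfolding proj_def homeomorphism_def by blast+
qed

lemma continuous_on_proj: "continuous_on solid_torus proj"
proof -
  have cg: "continuous_on S3 g" using hom by (simp add: homeomorphism_def)
  show ?thesis unfolding proj_def
  proof (rule continuous_on_compose2[OF cg])
    show "continuous_on solid_torus (\<lambda>x. pt ((solid_angle x)\<^sup>2) (solid_disc x))"
      unfolding pt_def by (intro continuous_intros continuous_on_solid_angle continuous_on_solid_disc)
    show "(\<lambda>x. pt ((solid_angle x)\<^sup>2) (solid_disc x)) ` solid_torus \<subseteq> S3"
    proof (rule image_subsetI)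
      fix x assume "x \<in> solid_torus"
      from solid_torus_coords[OF this] show "pt ((solid_angle x)\<^sup>2) (solid_disc x) \<in> S3"
        using pt_S3[of "(solid_angle x)\<^sup>2" "solid_disc x"] by (simp add: norm_power)
    qed
  qed
qed

lemma proj_solid:
  assumes p: "p \<notin> range (D K)" and a: "norm a = 1" "a\<^sup>2 = al p"
  shows "proj (solid a (be p)) = inv_stereo p"
proof -
  have "proj (solid a (be p)) = g (pt (al p) (be p))"
    using solid_coords[OF a(1) norm_be[OF p]] a(2) by (simp add: proj_def)
  then show ?thesis using jj_pt[OF p] g_jj by metis
qed

lemma stereo_proj:
  assumes x: "x \<in> solid_torus" and Im: "Im (snd (proj x)) \<noteq> 1"
  shows "stereo (proj x) \<notin> range (D K)" "be (stereo (proj x)) = solid_disc x" "al (stereo (proj x)) = (solid_angle x)\<^sup>2"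
proof -
  have j: "jj (stereo (proj x)) = pt ((solid_angle x)\<^sup>2) (solid_disc x)"
    unfolding jj_def inv_stereo_stereo[OF proj_S3(1)[OF x] Im] by (rule proj_S3(2)[OF x])
  have n: "norm ((solid_angle x)\<^sup>2) = 1" "norm (solid_disc x) < 1"
    using solid_torus_coords[OF x] by (simp_all add: norm_power)
  show "be (stereo (proj x)) = solid_disc x" "al (stereo (proj x)) = (solid_angle x)\<^sup>2"
    unfolding be_def al_def j using pt_coords[OF n] by simp_all
  show "stereo (proj x) \<notin> range (D K)"
  proof
    assume "stereo (proj x) \<in> range (D K)"
    then have "jj (stereo (proj x)) \<in> great_circle" unfolding fK[symmetric] jj_def by blast
    then show False unfolding j using pt_S3[OF n] by (simp add: great_circle_def)
  qed
qed

text \<open>Half of a continuous angle along the component gives a square root of the direction, and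
  the root closes up because the angle makes an even number of turns.\<close>

lemma component_angles:
  obtains lift :: "'i \<Rightarrow> real \<Rightarrow> complex"
  where "\<And>i. i \<in> I - {K} \<Longrightarrow> continuous_on UNIV (lift i)" "\<And>i t. i \<in> I - {K} \<Longrightarrow> norm (lift i t) = 1"
    "\<And>i t. i \<in> I - {K} \<Longrightarrow> (lift i t)\<^sup>2 = al (D i t)" "\<And>i t. i \<in> I - {K} \<Longrightarrow> lift i (t + 1) = lift i t"
proof -
  have "\<exists>c. continuous_on UNIV c \<and> (\<forall>t. norm (c t) = 1 \<and> (c t)\<^sup>2 = al (D i t) \<and> c (t + 1) = c t)" if i: "i \<in> I - {K}" for i
  proof -
    have i': "i \<in> I" "i \<noteq> K" using i by auto
    have "continuous_on UNIV (\<lambda>t. al (D i t))"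
      by (rule continuous_on_compose2[OF continuous_on_al_be(1) LD(4)[OF i'(1)] order_refl])
        (use other_component[OF i'] in blast)
    then obtain \<theta> :: "real \<Rightarrow> real" where \<theta>: "continuous_on UNIV \<theta>" "\<And>t. exp (\<i> * of_real (\<theta> t)) = al (D i t)"
      using unit_angle_ex[of UNIV "\<lambda>t. al (D i t)"] norm_al[OF other_component[OF i']]
      by (metis UNIV_I contractible_UNIV)
    obtain m :: int where m: "even m" "\<And>t. \<theta> (t + 1) = \<theta> t + 2 * pi * m" using angle_period_even[OF i' \<theta>] by blast
    obtain n :: int where n: "m = 2 * n" using m(1) by (elim evenE)
    define c where "c t = exp (\<i> * of_real (\<theta> t / 2))" for t
    have "c (t + 1) = c t" for t
    proof -
      have "\<i> * of_real (\<theta> (t + 1) / 2) = \<i> * of_real (\<theta> t / 2) + of_int (2 * n) * of_real pi * \<i>"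
        unfolding m(2) n by (simp add: algebra_simps)
      then show ?thesis unfolding c_def exp_eq by (intro exI[of _ n]) simp
    qed
    moreover have "continuous_on UNIV c" unfolding c_def by (intro continuous_intros \<theta>) auto
    moreover have "norm (c t) = 1" for t unfolding c_def by simp
    moreover have "(c t)\<^sup>2 = al (D i t)" for t
      unfolding c_def \<theta>(2)[symmetric] by (simp add: power2_eq_square flip: exp_add)
    ultimately show ?thesis by blast
  qed
  then obtain lift where "\<And>i. i \<in> I - {K} \<Longrightarrow> continuous_on UNIV (lift i) \<and> (\<forall>t. norm (lift i t) = 1 \<and> (lift i t)\<^sup>2 = al (D i t) \<and> lift i (t + 1) = lift i t)"
    by metis
  then show thesis using that by blast
qed

text \<open>The normal coordinate of the tubes, pulled back by \<open>proj\<close>, vanishes on both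
  lifts of every component. It becomes a local equation of the chosen lifts alone once the other
  lifts are removed from its domain. The function found on the solid torus is then unwrapped in the
  angle.\<close>

lemma lift_function:
  obtains Fn :: "real \<times> complex \<Rightarrow> complex"
  where "continuous_on (UNIV \<times> ball 0 1) Fn" "\<And>\<theta> z. Fn (\<theta> + 4 * pi, z) = Fn (\<theta>, z)"
    "\<And>p \<theta>. p \<notin> L \<Longrightarrow> exp (\<i> * of_real \<theta>) = al p \<Longrightarrow> Fn (\<theta>, be p) \<noteq> 0"
    "\<And>i s \<theta>0. i \<in> I \<Longrightarrow> i \<noteq> K \<Longrightarrow> exp (\<i> * of_real \<theta>0) = al (D i s) \<Longrightarrow>
       \<exists>\<theta>1\<in>{\<theta>0, \<theta>0 + 2 * pi}. Fn (\<theta>1 + 2 * pi, be (D i s)) \<noteq> 0 \<and>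
         (\<exists>U H. open U \<and> (\<theta>1, be (D i s)) \<in> U \<and> continuous_on U H \<and> (\<forall>x\<in>U. H x \<noteq> 0) \<and>
           (\<forall>\<theta> q. \<bar>Im (fst q)\<bar> < rad \<longrightarrow> \<bar>snd q\<bar> < rad \<longrightarrow> (\<theta>, be (Tb i q)) \<in> U \<longrightarrow>
             exp (\<i> * of_real \<theta>) = al (Tb i q) \<longrightarrow> Tb i q \<notin> range (D K) \<longrightarrow>
             Fn (\<theta>, be (Tb i q)) = transv q * H (\<theta>, be (Tb i q))))"
proof -
  let ?J = "I - {K}"
  obtain lift where lc: "\<And>i. i \<in> ?J \<Longrightarrow> continuous_on UNIV (lift i)" and ln: "\<And>i t. i \<in> ?J \<Longrightarrow> norm (lift i t) = 1"
    and ls: "\<And>i t. i \<in> ?J \<Longrightarrow> (lift i t)\<^sup>2 = al (D i t)" and lp: "\<And>i t. i \<in> ?J \<Longrightarrow> lift i (t + 1) = lift i t"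
    using component_angles by blast
  obtain V A where V: "open V" "continuous_on V A" "link_of ?J D \<subseteq> V"
    "\<And>q. q \<in> V \<Longrightarrow> A q = 0 \<longleftrightarrow> q \<in> link_of ?J D"
    "\<And>i p. i \<in> ?J \<Longrightarrow> \<bar>Im (fst p)\<bar> < rad \<Longrightarrow> \<bar>snd p\<bar> < rad \<Longrightarrow> Tb i p \<in> V \<and> A (Tb i p) = transv p"
    using tube_coordinate[of ?J] by (metis Diff_subset)
  have nK: "D i t \<notin> range (D K)" if "i \<in> ?J" for i t using other_component that by blast
  \<comment> \<open>\<open>Zs 1\<close> is the union of the chosen lifts, \<open>Zs (-1)\<close>
    that of their images under the deck transformation.\<close>
  define Zs where "Zs \<sigma> = (\<Union>i\<in>?J. range (\<lambda>t. solid (\<sigma> * lift i t) (be (D i t))))" for \<sigma> :: complex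
  have cZ: "compact (Zs \<sigma>)" for \<sigma>
  proof -
    have "compact (range (\<lambda>t. solid (\<sigma> * lift i t) (be (D i t))))" if i: "i \<in> ?J" for i
    proof -
      have "i \<in> I" using i by blast
      have "(\<lambda>t. solid (\<sigma> * lift i t) (be (D i t))) (t + 1) = (\<lambda>t. solid (\<sigma> * lift i t) (be (D i t))) t" for t
        using lp[OF i] LD(2)[OF \<open>i \<in> I\<close>] by simp
      from periodic_range[of "\<lambda>t. solid (\<sigma> * lift i t) (be (D i t))", OF this]
      have "range (\<lambda>t. solid (\<sigma> * lift i t) (be (D i t))) = (\<lambda>t. solid (\<sigma> * lift i t) (be (D i t))) ` {0..1}" .
      moreover have "continuous_on {0..1} (\<lambda>t. solid (\<sigma> * lift i t) (be (D i t)))"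
        unfolding solid_def using lc[OF i] LD(4)[OF \<open>i \<in> I\<close>]
        by (intro continuous_intros continuous_on_compose2[OF continuous_on_al_be(2)])
          (auto elim: continuous_on_subset)
      ultimately show ?thesis by (simp add: compact_continuous_image)
    qed
    then show ?thesis unfolding Zs_def using LD(1) by (intro compact_UN) auto
  qed
  have Zs_iff: "solid a z \<in> Zs \<sigma> \<longleftrightarrow> (\<exists>i\<in>?J. \<exists>t. a = \<sigma> * lift i t \<and> z = be (D i t))"
    if a: "norm a = 1" "norm z < 1" and \<sigma>: "norm \<sigma> = 1" for a z \<sigma>
  proof
    assume "solid a z \<in> Zs \<sigma>"
    then obtain i t where it: "i \<in> ?J" "solid a z = solid (\<sigma> * lift i t) (be (D i t))" unfolding Zs_def by blast
    have "norm (\<sigma> * lift i t) = 1" using \<sigma> ln[OF it(1)] by (simp add: norm_mult)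
    note c = solid_coords[OF this norm_be[OF nK[OF it(1)]], of t]
    show "\<exists>i\<in>?J. \<exists>t. a = \<sigma> * lift i t \<and> z = be (D i t)"
      using solid_coords[OF a] c it by metis
  qed (auto simp: Zs_def)
  \<comment> \<open>A common point of a chosen and a rejected lift would lie over a single point of
    a single component, where \<open>lift\<close> would be its own negative.\<close>
  have disj: "lift i t \<noteq> - lift j s" if "i \<in> ?J" "j \<in> ?J" "be (D i t) = be (D j s)" for i j s t
  proof
    assume eq: "lift i t = - lift j s"
    then have "al (D i t) = al (D j s)" using ls that by (metis power2_minus)
    then have D: "D i t = D j s" using al_be_inj nK that by blast
    have ij: "i = j" using LD(8)[OF _ _ D] that(1,2) by blast
    have "i \<in> I" "D i t = D i s" using that(1) D ij by auto
    then obtain k where "t - s = of_int k"using LD(9)[of i t s] by (metis Ints_cases)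
    then have "lift i t = lift i s" using periodic_shift[of "lift i", OF lp[OF that(1)], of s k] by (simp add: algebra_simps)
    then show False using eq ij ln[OF that(1), of s] by auto
  qed
  \<comment> \<open>The points over infinity are excluded as well, since the tubes live in Euclidean
    space.\<close>
  define V' where "V' = {x \<in> solid_torus. x \<notin> Zs (-1) \<and> Im (snd (proj x)) \<noteq> 1 \<and> stereo (proj x) \<in> V}"
  define U1 where "U1 = solid_torus \<inter> proj -` {x. Im (snd x) \<noteq> 1}"
  have U1: "open U1" unfolding U1_def
    by (intro continuous_open_preimage continuous_on_proj open_solid_torus open_Collect_neq continuous_intros)
  have cst: "continuous_on U1 (\<lambda>x. stereo (proj x))"
  proof (rule continuous_on_compose2[OF continuous_on_stereo[of "{x. Im (snd x) \<noteq> 1}"]])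
    show "continuous_on U1 proj" by (rule continuous_on_subset[OF continuous_on_proj]) (auto simp: U1_def)
  qed (auto simp: U1_def)
  have V'eq: "V' = (U1 \<inter> (\<lambda>x. stereo (proj x)) -` V) \<inter> - Zs (-1)" by (auto simp: V'_def U1_def)
  have oV': "open V'" unfolding V'eq
    using cZ by (intro open_Int continuous_open_preimage cst U1 V(1)) (simp add: compact_imp_closed open_Compl)
  have cA': "continuous_on V' (\<lambda>x. A (stereo (proj x)))"
    by (rule continuous_on_compose2[OF V(2) continuous_on_subset[OF cst]]) (auto simp: V'eq)
  have solidV: "solid a (be p) \<in> V' \<and> stereo (proj (solid a (be p))) = p"
    if p: "p \<notin> range (D K)" "norm a = 1" "a\<^sup>2 = al p" "p \<in> V" "solid a (be p) \<notin> Zs (-1)" for a p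
    using proj_solid[OF p(1-3)] solid_coords[OF p(2) norm_be[OF p(1)]] p(4,5) inv_stereo_Im_neq_1 stereo_inv_stereo
    by (simp add: V'_def)
  have inZ: "solid (lift i t) (be (D i t)) \<in> Zs 1" if "i \<in> ?J" for i t
    unfolding Zs_def using that by auto
  have notZ: "solid (lift i t) (be (D i t)) \<notin> Zs (-1)" "solid (- lift i t) (be (D i t)) \<notin> Zs 1" if i: "i \<in> ?J" for i t
  proof -
    have b: "norm (be (D i t)) < 1" using norm_be[OF nK[OF i]] .
    show "solid (lift i t) (be (D i t)) \<notin> Zs (-1)"
      using Zs_iff[OF ln[OF i] b, of "-1"] disj[OF i] by auto
    have "norm (- lift i t) = 1" using ln[OF i] by simp
    note iff = Zs_iff[OF this b, of 1]
    show "solid (- lift i t) (be (D i t)) \<notin> Zs 1"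
    proof
      assume "solid (- lift i t) (be (D i t)) \<in> Zs 1"
      then obtain j s where js: "j \<in> ?J" "- lift i t = 1 * lift j s" "be (D i t) = be (D j s)" using iff by auto
      then have "lift i t = - lift j s" by (metis minus_minus mult_1)
      then show False using disj[OF i js(1,3)] by blast
    qed
  qed
  have DV: "D i t \<in> V" if "i \<in> ?J" for i t using V(3) that unfolding link_of_def by blast
  have Z1V: "Zs 1 \<subseteq> V'"
  proof
    fix x assume "x \<in> Zs 1"
    then obtain i t where it: "i \<in> ?J" "x = solid (lift i t) (be (D i t))" unfolding Zs_def by auto
    then show "x \<in> V'" using solidV[OF nK[OF it(1)] ln[OF it(1)] ls[OF it(1)] DV[OF it(1)] notZ(1)[OF it(1)]] by blast
  qed
  \<comment> \<open>A zero has one of two opposite angles over a point of the link; the wrong one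
    belongs to \<open>Zs (-1)\<close>, which \<open>V'\<close> avoids.\<close>
  have zA: "A (stereo (proj x)) = 0 \<longleftrightarrow> x \<in> Zs 1" if x: "x \<in> V'" for x
  proof
    have xs: "x \<in> solid_torus" "Im (snd (proj x)) \<noteq> 1" "stereo (proj x) \<in> V" "x \<notin> Zs (-1)" using x by (auto simp: V'_def)
    assume "A (stereo (proj x)) = 0"
    then obtain i t where it: "i \<in> ?J" "stereo (proj x) = D i t" using V(4)[OF xs(3)] unfolding link_of_def by blast
    have "(solid_angle x)\<^sup>2 = (lift i t)\<^sup>2" "solid_disc x = be (D i t)"
      using stereo_proj(2,3)[OF xs(1,2)] it ls[OF it(1)] by simp_all
    then consider "solid_angle x = lift i t" | "solid_angle x = - lift i t" by (auto simp: power2_eq_iff)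
    then show "x \<in> Zs 1"
    proof cases
      case 1
      then show ?thesis using inZ[OF it(1), of t] solid_torus_coords(2)[OF xs(1)] \<open>solid_disc x = _\<close> by simp
    next
      case 2
      then have "x = solid (- lift i t) (be (D i t))" using solid_torus_coords(2)[OF xs(1)] \<open>solid_disc x = _\<close> by simp
      then have "x \<in> Zs (-1)" unfolding Zs_def using it(1) by auto
      then show ?thesis using xs(4) by blast
    qed
  next
    assume "x \<in> Zs 1"
    then obtain i t where it: "i \<in> ?J" "x = solid (lift i t) (be (D i t))" unfolding Zs_def by auto
    then have "stereo (proj x) = D i t"
      using solidV[OF nK[OF it(1)] ln[OF it(1)] ls[OF it(1)] DV[OF it(1)] notZ(1)[OF it(1)]] by blast
    then show "A (stereo (proj x)) = 0" using V(4)[OF DV[OF it(1)]] it(1) unfolding link_of_def by auto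
  qed
  obtain c :: "complex \<times> real" where c: "solid_torus \<subseteq> cbox (- c) c"
    using bounded_subset_cbox_symmetric[OF bounded_solid_torus] by blast
  have "divisor_on V' (\<lambda>x. A (stereo (proj x))) (Zs 1) solid_torus"
    by (rule divisor_on_subset[OF divisor_on_cbox[OF oV' compact_imp_closed[OF cZ] Z1V cA' zA] c])
  then obtain F' G' where F': "continuous_on solid_torus F'" "\<And>x. x \<in> solid_torus \<Longrightarrow> F' x = 0 \<longleftrightarrow> x \<in> Zs 1"
    and G': "continuous_on (solid_torus \<inter> V') G'"
    "\<And>x. x \<in> solid_torus \<inter> V' \<Longrightarrow> G' x \<noteq> 0 \<and> F' x = A (stereo (proj x)) * G' x"
    unfolding divisor_on_def by blast
  have VS: "solid_torus \<inter> V' = V'" by (auto simp: V'_def)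
  \<comment> \<open>\<open>\<theta>\<close> is the angle downstairs. Upstairs it is halved, so
    adding \<open>2 * pi\<close> leads to the other point of the fibre and the period is
    \<open>4 * pi\<close>.\<close>
  define sol where "sol x = solid (exp (\<i> * of_real (fst x / 2))) (snd x)" for x :: "real \<times> complex"
  have csol: "continuous_on S sol" for S unfolding sol_def solid_def by (intro continuous_intros) auto
  have n1: "norm (exp (\<i> * of_real (r / 2))) = 1" for r :: real by simp
  have sol: "sol x \<in> solid_torus" if "x \<in> UNIV \<times> ball 0 1" for x
    using solid_coords(3)[OF n1[of "fst x"], of "snd x"] that by (auto simp: sol_def mem_Times_iff)
  have sq: "(exp (\<i> * of_real (r / 2)))\<^sup>2 = exp (\<i> * of_real r)" for r :: real
    by (simp add: power2_eq_square flip: exp_add)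
  have half: "exp (\<i> * of_real ((r + 2 * pi) / 2)) = - exp (\<i> * of_real (r / 2))" for r :: real
    by (simp add: add_divide_distrib distrib_left exp_add)
  define Fn where "Fn x = F' (sol x)" for x
  show thesis
  proof (rule that[of Fn])
    show "continuous_on (UNIV \<times> ball 0 1) Fn" unfolding Fn_def
      by (rule continuous_on_compose2[OF F'(1) csol]) (use sol in blast)
    show "Fn (\<theta> + 4 * pi, z) = Fn (\<theta>, z)" for \<theta> z
    proof -
      have "\<theta> + 4 * pi = (\<theta> + 2 * pi) + 2 * pi" by simp
      then have "exp (\<i> * of_real ((\<theta> + 4 * pi) / 2)) = exp (\<i> * of_real (\<theta> / 2))" by (simp only: half minus_minus)
      then show ?thesis by (simp only: Fn_def sol_def fst_conv snd_conv)
    qed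
    show "Fn (\<theta>, be p) \<noteq> 0" if p: "p \<notin> L" "exp (\<i> * of_real \<theta>) = al p" for p \<theta>
    proof
      have pK: "p \<notin> range (D K)" using p(1) range_L[OF K] by blast
      assume "Fn (\<theta>, be p) = 0"
      then have "sol (\<theta>, be p) \<in> Zs 1" using F'(2)[OF sol] norm_be[OF pK] by (simp add: Fn_def)
      then obtain i t where it: "i \<in> ?J" "exp (\<i> * of_real (\<theta> / 2)) = lift i t" "be p = be (D i t)"
        using Zs_iff[OF n1 norm_be[OF pK], of 1 \<theta>] by (auto simp: sol_def)
      have "al p = al (D i t)" using ls[OF it(1), of t] sq[of \<theta>] p(2) it(2) by simp
      then have "p = D i t" using al_be_inj[OF pK nK[OF it(1)]] it(3) by blast
      then show False using p(1) it(1) in_L by blast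
    qed
    fix i s \<theta>0 assume i: "i \<in> I" "i \<noteq> K" and \<theta>0: "exp (\<i> * of_real \<theta>0) = al (D i s)"
    have iJ: "i \<in> ?J" using i by blast
    have b1: "norm (be (D i s)) < 1" by (rule norm_be[OF nK[OF iJ]])
    have "(exp (\<i> * of_real (\<theta>0 / 2)))\<^sup>2 = (lift i s)\<^sup>2" using ls[OF iJ] sq \<theta>0 by simp
    then consider "exp (\<i> * of_real (\<theta>0 / 2)) = lift i s" | "exp (\<i> * of_real ((\<theta>0 + 2 * pi) / 2)) = lift i s"
      unfolding half by (auto simp: power2_eq_iff)
    then obtain \<theta>1 where \<theta>1: "\<theta>1 \<in> {\<theta>0, \<theta>0 + 2 * pi}" "exp (\<i> * of_real (\<theta>1 / 2)) = lift i s" by blast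
    have s1: "sol (\<theta>1, be (D i s)) = solid (lift i s) (be (D i s))" using \<theta>1(2) by (simp only: sol_def fst_conv snd_conv)
    have s2: "sol (\<theta>1 + 2 * pi, be (D i s)) = solid (- lift i s) (be (D i s))"
      using \<theta>1(2) half by (simp only: sol_def fst_conv snd_conv)
    have nz: "Fn (\<theta>1 + 2 * pi, be (D i s)) \<noteq> 0"
      using F'(2)[OF sol, of "(\<theta>1 + 2 * pi, be (D i s))"] notZ(2)[OF iJ] b1 by (simp add: Fn_def s2)
    define U where "U = sol -` V'"
    have U: "open U" unfolding U_def using csol[of UNIV] oV' open_vimage by blast
    have xU: "(\<theta>1, be (D i s)) \<in> U" unfolding U_def using s1 inZ[OF iJ] Z1V by auto
    have cH: "continuous_on U (\<lambda>x. G' (sol x))"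
      by (rule continuous_on_compose2[OF G'(1) csol]) (auto simp: U_def V'_def)
    have eqF: "Fn (\<theta>, be (Tb i q)) = transv q * G' (sol (\<theta>, be (Tb i q)))"
      if q: "\<bar>Im (fst q)\<bar> < rad" "\<bar>snd q\<bar> < rad" "(\<theta>, be (Tb i q)) \<in> U" "exp (\<i> * of_real \<theta>) = al (Tb i q)" "Tb i q \<notin> range (D K)" for \<theta> q
    proof -
      have xV: "sol (\<theta>, be (Tb i q)) \<in> V'" using q(3) by (simp add: U_def)
      have "(exp (\<i> * of_real (\<theta> / 2)))\<^sup>2 = al (Tb i q)" using sq q(4) by simp
      from proj_solid[OF q(5) n1 this] have "stereo (proj (sol (\<theta>, be (Tb i q)))) = Tb i q"
        by (simp add: sol_def stereo_inv_stereo)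
      then show ?thesis using G'(2)[unfolded VS, OF xV] V(5)[OF iJ q(1,2)] by (simp add: Fn_def)
    qed
    show "\<exists>\<theta>1\<in>{\<theta>0, \<theta>0 + 2 * pi}. Fn (\<theta>1 + 2 * pi, be (D i s)) \<noteq> 0 \<and>
         (\<exists>U H. open U \<and> (\<theta>1, be (D i s)) \<in> U \<and> continuous_on U H \<and> (\<forall>x\<in>U. H x \<noteq> 0) \<and>
           (\<forall>\<theta> q. \<bar>Im (fst q)\<bar> < rad \<longrightarrow> \<bar>snd q\<bar> < rad \<longrightarrow> (\<theta>, be (Tb i q)) \<in> U \<longrightarrow>
             exp (\<i> * of_real \<theta>) = al (Tb i q) \<longrightarrow> Tb i q \<notin> range (D K) \<longrightarrow>
             Fn (\<theta>, be (Tb i q)) = transv q * H (\<theta>, be (Tb i q))))"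
    proof (rule bexI[OF _ \<theta>1(1)], rule conjI[OF nz], rule exI[of _ U], rule exI[of _ "\<lambda>x. G' (sol x)"], intro conjI U xU cH)
      show "\<forall>x\<in>U. G' (sol x) \<noteq> 0" using G'(2)[unfolded VS] by (auto simp: U_def)
    qed (use eqF in blast)
  qed
qed

end

section \<open>The infinite dihedral covering\<close>

text \<open>The covering unwraps the angle completely, so \<open>k\<close> is kept as an integer and
  the group is an extension of the infinite dihedral group. The second coordinate is reversed
  according to the parity of \<open>k\<close>, which is all that the coloring will retain of
  \<open>k\<close>.\<close>

definition act :: "int \<Rightarrow> int \<Rightarrow> real \<times> complex \<Rightarrow> real \<times> complex"
  where "act k m x = (fst x + 2 * pi * k, (if even k then snd x else - snd x) + of_int m)"

definition deck :: "(real \<times> complex \<Rightarrow> real \<times> complex) set"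
  where "deck = {act k m | k m. True}"

lemma act_comp: "act k m \<circ> act k' m' = act (k + k') (m + (if even k then m' else - m'))"
  by (auto simp: act_def fun_eq_iff algebra_simps)

lemma act_id: "act 0 0 = id"
  by (auto simp: act_def fun_eq_iff)

lemma act_free: "act k m x = act k' m' x \<Longrightarrow> k = k' \<and> m = m'"
  by (auto simp: act_def)

text \<open>\<open>Fn\<close> is a function on the double cover, whose angle is \<open>\<theta> / 2\<close>, so that its deck transformation
  adds \<open>2 * pi\<close> to \<open>\<theta>\<close>. Of the two lifts of a component only one is a zero of \<open>Fn\<close>.\<close>

locale lifted_diag = unknot_diag I D nn b \<delta> K f g for I :: "'i set" and D nn b \<delta> K f g +
  fixes Fn :: "real \<times> complex \<Rightarrow> complex"
  assumes Fn_cont: "continuous_on (UNIV \<times> ball 0 1) Fn" and Fn_per: "\<And>\<theta> z. Fn (\<theta> + 4 * pi, z) = Fn (\<theta>, z)"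
    and Fn_nz: "\<And>p \<theta>. p \<notin> L \<Longrightarrow> exp (\<i> * of_real \<theta>) = al p \<Longrightarrow> Fn (\<theta>, be p) \<noteq> 0"
    and Fn_local: "\<And>i s \<theta>0. i \<in> I \<Longrightarrow> i \<noteq> K \<Longrightarrow> exp (\<i> * of_real \<theta>0) = al (D i s) \<Longrightarrow>
       \<exists>\<theta>1\<in>{\<theta>0, \<theta>0 + 2 * pi}. Fn (\<theta>1 + 2 * pi, be (D i s)) \<noteq> 0 \<and>
         (\<exists>U H. open U \<and> (\<theta>1, be (D i s)) \<in> U \<and> continuous_on U H \<and> (\<forall>x\<in>U. H x \<noteq> 0) \<and>
           (\<forall>\<theta> q. \<bar>Im (fst q)\<bar> < rad \<longrightarrow> \<bar>snd q\<bar> < rad \<longrightarrow> (\<theta>, be (Tb i q)) \<in> U \<longrightarrow>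
             exp (\<i> * of_real \<theta>) = al (Tb i q) \<longrightarrow> Tb i q \<notin> range (D K) \<longrightarrow>
             Fn (\<theta>, be (Tb i q)) = transv q * H (\<theta>, be (Tb i q))))"
begin

definition Q :: "real \<Rightarrow> complex \<Rightarrow> complex" where "Q \<theta> z = Fn (\<theta>, z) / Fn (\<theta> + 2 * pi, z)"

text \<open>The second coordinate is a logarithm of \<open>Q\<close> divided by
  \<open>2 * pi * \<i>\<close>, which turns the periods into integers.\<close>

definition fib :: "complex \<times> real \<Rightarrow> (real \<times> complex) set"
  where "fib p = {x. exp (\<i> * of_real (fst x)) = al p \<and> exp (2 * pi * \<i> * snd x) = Q (fst x) (be p)}"

lemma exp_angle_shift: "exp (\<i> * of_real (\<theta> + 2 * pi * of_int k)) = exp (\<i> * of_real \<theta>)"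
  unfolding exp_eq by (intro exI[of _ k]) (simp add: algebra_simps)

text \<open>Two turns are a period of \<open>Fn\<close>, and one turn exchanges numerator and
  denominator. Inverting \<open>Q\<close> negates its logarithm; this is where reflections come
  from.\<close>

lemma Q_shift: "Q (\<theta> + 2 * pi * of_int k) z = (if even k then Q \<theta> z else inverse (Q \<theta> z))"
proof -
  have even_shift: "Fn (\<theta> + 4 * pi * of_int l, z) = Fn (\<theta>, z)" for \<theta> l
  proof -
    have "(\<lambda>t. Fn (4 * pi * t, z)) (t + 1) = (\<lambda>t. Fn (4 * pi * t, z)) t" for t
      using Fn_per[of "4 * pi * t" z] by (simp add: algebra_simps)
    from periodic_shift[of "\<lambda>t. Fn (4 * pi * t, z)", OF this, of "\<theta> / (4 * pi)" l]
    show ?thesis by (simp add: algebra_simps)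
  qed
  show ?thesis
  proof (cases "even k")
    case True
    then obtain l where l: "k = 2 * l" by (elim evenE)
    have 1: "\<theta> + 2 * pi * of_int k = \<theta> + 4 * pi * of_int l" by (simp add: l)
    have 2: "\<theta> + 2 * pi * of_int k + 2 * pi = (\<theta> + 2 * pi) + 4 * pi * of_int l" by (simp add: l)
    show ?thesis using True unfolding Q_def 1[symmetric] 2 even_shift unfolding 1 even_shift by simp
  next
    case False
    then obtain l where l: "k = 2 * l + 1" by (elim oddE)
    have 1: "\<theta> + 2 * pi * of_int k = (\<theta> + 2 * pi) + 4 * pi * of_int l" by (simp add: l algebra_simps)
    have 2: "\<theta> + 2 * pi * of_int k + 2 * pi = \<theta> + 4 * pi * of_int (l + 1)" by (simp add: l algebra_simps)
    have "Q (\<theta> + 2 * pi * of_int k) z = Fn (\<theta> + 2 * pi, z) / Fn (\<theta>, z)"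
      unfolding Q_def 2 even_shift unfolding 1 even_shift by simp
    then show ?thesis using False by (simp add: Q_def)
  qed
qed

lemma not_L_K: "p \<notin> L \<Longrightarrow> p \<notin> range (D K)"
  using range_L[OF K] by blast

lemma Q_nz: "p \<notin> L \<Longrightarrow> exp (\<i> * of_real \<theta>) = al p \<Longrightarrow> Q \<theta> (be p) \<noteq> 0"
  using Fn_nz[of p \<theta>] Fn_nz[of p "\<theta> + 2 * pi"] exp_angle_shift[of \<theta> 1] by (simp add: Q_def)

lemma continuous_on_Fn:
  assumes "continuous_on W \<theta>" "continuous_on W z" "\<And>x. x \<in> W \<Longrightarrow> norm (z x) < 1"
  shows "continuous_on W (\<lambda>x. Fn (\<theta> x, z x))"
proof (rule continuous_on_compose2[OF Fn_cont continuous_on_Pair[OF assms(1,2)]], rule image_subsetI)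
  fix x assume "x \<in> W"
  then show "(\<theta> x, z x) \<in> UNIV \<times> ball 0 1" using assms(3)[of x] by simp
qed

text \<open>A section is an angle together with a logarithm of \<open>Q\<close> along that angle.
  Two sections are compared in the same order: first their angles, which fixes \<open>k\<close>,
  then the logarithms, one of them negated if \<open>k\<close> is odd.\<close>

lemma deck_cover: "cover I D nn b \<delta> fib deck"
proof
  show "g \<circ> h \<in> deck" if "g \<in> deck" "h \<in> deck" for g h
    using that act_comp unfolding deck_def by blast
  have "act 0 0 \<in> deck" unfolding deck_def by blast
  then show "id \<in> deck" by (simp only: act_id)
  show "\<exists>h\<in>deck. h \<circ> g = id \<and> g \<circ> h = id" if "g \<in> deck" for g
  proof -
    obtain k m where g: "g = act k m" using \<open>g \<in> deck\<close> unfolding deck_def by blast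
    let ?h = "act (- k) (if even k then - m else m)"
    have "?h \<circ> g = id" "g \<circ> ?h = id" unfolding g act_comp by (simp_all add: act_id[symmetric])
    moreover have "?h \<in> deck" unfolding deck_def by blast
    ultimately show ?thesis by blast
  qed
  show "continuous_on UNIV g" if "g \<in> deck" for g
  proof -
    obtain k m where g: "g = act k m" using \<open>g \<in> deck\<close> unfolding deck_def by blast
    show ?thesis unfolding g act_def[abs_def] by (cases "even k") (auto intro!: continuous_intros)
  qed
  show "g e \<in> fib p" if "g \<in> deck" "p \<notin> L" "e \<in> fib p" for g p e
  proof -
    obtain k m where g: "g = act k m" using \<open>g \<in> deck\<close> unfolding deck_def by blast
    have e: "exp (\<i> * of_real (fst e)) = al p" "exp (2 * pi * \<i> * snd e) = Q (fst e) (be p)"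
      using that(3) by (auto simp: fib_def)
    have "exp (2 * pi * \<i> * of_int m) = 1" by (simp add: exp_eq_1 mult.commute)
    then have "exp (2 * pi * \<i> * snd (g e)) = Q (fst (g e)) (be p)"
      unfolding g act_def fst_conv snd_conv Q_shift e(2)[symmetric]
      by (simp add: distrib_left exp_add exp_minus)
    moreover have "exp (\<i> * of_real (fst (g e))) = al p"
      unfolding g act_def fst_conv exp_angle_shift by (rule e(1))
    ultimately show ?thesis by (simp add: fib_def)
  qed
  show "g = h" if "g \<in> deck" "h \<in> deck" "g e = h e" for g h e
    using that act_free unfolding deck_def by blast
  show "\<exists>\<sigma>. section_on fib W \<sigma>" if W: "contractible W" "W \<inter> L = {}" for W
  proof -
    have nL: "p \<notin> L" "p \<notin> range (D K)" if "p \<in> W" for p using W(2) that not_L_K by blast+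
    have "W \<inter> range (D K) = {}" using nL by blast
    then have "continuous_on W al" by (rule continuous_on_al_be)
    then obtain \<theta> :: "complex \<times> real \<Rightarrow> real" where \<theta>: "continuous_on W \<theta>" "\<And>x. x \<in> W \<Longrightarrow> exp (\<i> * of_real (\<theta> x)) = al x"
      using unit_angle_ex[OF W(1)] norm_al nL by blast
    have z: "continuous_on W be" "\<And>x. x \<in> W \<Longrightarrow> norm (be x) < 1" using continuous_on_al_be(2) norm_be nL by blast+
    have nz: "Fn (\<theta> x, be x) \<noteq> 0" "Fn (\<theta> x + 2 * pi, be x) \<noteq> 0" if "x \<in> W" for x
      using Fn_nz[OF nL(1)[OF that] \<theta>(2)[OF that]] Fn_nz[OF nL(1)[OF that], of "\<theta> x + 2 * pi"] exp_angle_shift[of "\<theta> x" 1] \<theta>(2)[OF that] by simp_all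
    have cQ: "continuous_on W (\<lambda>x. Q (\<theta> x) (be x))" unfolding Q_def using nz
      by (intro continuous_on_divide continuous_on_Fn continuous_intros \<theta> z) auto
    have Qn: "Q (\<theta> x) (be x) \<noteq> 0" if "x \<in> W" for x using Q_nz[OF nL(1)[OF that] \<theta>(2)[OF that]] .
    obtain l where l: "continuous_on W l" "\<And>x. x \<in> W \<Longrightarrow> Q (\<theta> x) (be x) = exp (l x)"
      using continuous_logarithm_on_contractible[OF cQ W(1) Qn] by blast
    have "section_on fib W (\<lambda>x. (\<theta> x, l x / (2 * pi * \<i>)))"
      unfolding section_on_def fib_def using \<theta> l by (auto intro!: continuous_intros)
    then show ?thesis by blast
  qed
  show "\<exists>g\<in>deck. \<forall>p\<in>W. \<tau> p = g (\<sigma> p)"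
    if W: "connected W" "W \<inter> L = {}" and \<sigma>: "section_on fib W \<sigma>" and \<tau>: "section_on fib W \<tau>" for W \<sigma> \<tau>
  proof -
    have c: "continuous_on W (\<lambda>x. fst (\<sigma> x))" "continuous_on W (\<lambda>x. fst (\<tau> x))"
      "continuous_on W (\<lambda>x. snd (\<sigma> x))" "continuous_on W (\<lambda>x. snd (\<tau> x))"
      using \<sigma> \<tau> unfolding section_on_def by (auto intro: continuous_on_fst continuous_on_snd)
    have e: "exp (\<i> * of_real (fst (\<sigma> x))) = al x" "exp (2 * pi * \<i> * snd (\<sigma> x)) = Q (fst (\<sigma> x)) (be x)"
      "exp (\<i> * of_real (fst (\<tau> x))) = al x" "exp (2 * pi * \<i> * snd (\<tau> x)) = Q (fst (\<tau> x)) (be x)" if "x \<in> W" for x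
      using \<sigma> \<tau> that unfolding section_on_def fib_def by auto
    obtain k :: int where k: "\<And>x. x \<in> W \<Longrightarrow> fst (\<tau> x) = fst (\<sigma> x) + 2 * pi * k"
      using angles_differ[OF W(1) c(2,1)] e by metis
    have "\<exists>m::int. \<forall>x\<in>W. 2 * pi * \<i> * snd (\<tau> x) = 2 * pi * \<i> * (if even k then snd (\<sigma> x) else - snd (\<sigma> x)) + 2 * pi * \<i> * m"
    proof (rule logs_differ[OF W(1)])
      show "continuous_on W (\<lambda>x. 2 * pi * \<i> * snd (\<tau> x))" by (intro continuous_intros c)
      show "continuous_on W (\<lambda>x. 2 * pi * \<i> * (if even k then snd (\<sigma> x) else - snd (\<sigma> x)))"
        by (cases "even k") (auto intro!: continuous_intros c)
      show "exp (2 * pi * \<i> * snd (\<tau> x)) = exp (2 * pi * \<i> * (if even k then snd (\<sigma> x) else - snd (\<sigma> x)))" if "x \<in> W" for x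
        using e[OF that] k[OF that] Q_shift[of "fst (\<sigma> x)" k "be x"] by (simp add: exp_minus)
    qed
    then obtain m :: int where m: "\<And>x. x \<in> W \<Longrightarrow> 2 * pi * \<i> * snd (\<tau> x) = 2 * pi * \<i> * ((if even k then snd (\<sigma> x) else - snd (\<sigma> x)) + m)"
      by (auto simp: distrib_left)
    have "\<tau> x = act k m (\<sigma> x)" if "x \<in> W" for x
    proof -
      have "snd (\<tau> x) = (if even k then snd (\<sigma> x) else - snd (\<sigma> x)) + m" using m[OF that] by simp
      then show ?thesis using k[OF that] by (simp add: act_def prod_eq_iff)
    qed
    moreover have "act k m \<in> deck" unfolding deck_def by blast
    ultimately show ?thesis by blast
  qed
qed

end

sublocale lifted_diag \<subseteq> E: cover I D nn b \<delta> fib deck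
  by (rule deck_cover)

section \<open>Monodromy around the knot and around the other components\<close>

context lifted_diag
begin

text \<open>The first coordinates of the two sections are angles below and above the strand, so
  \<open>meridian_angle_odd\<close> gives \<open>d * k = 1\<close>.\<close>

lemma mon_knot:
  assumes "E.mon \<sigma>0 K s h"
  shows "\<exists>k m. h = act k m \<and> odd k"
proof -
  obtain a \<sigma> where a: "0 < a" "a \<le> rad" and \<sigma>0: "section_on fib (Tb K ` (bx s a \<inter> upper)) \<sigma>0"
    and \<sigma>: "section_on fib (Tb K ` (bx s a \<inter> lower)) \<sigma>"
    "\<forall>p\<in>bx s a. Im (fst p) < 0 \<longrightarrow> \<sigma> (Tb K p) = \<sigma>0 (Tb K p)"
    "\<forall>p\<in>bx s a. 0 < Im (fst p) \<longrightarrow> \<sigma> (Tb K p) = h (\<sigma>0 (Tb K p))" and hG: "h \<in> deck"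
    using assms unfolding E.mon_def by blast
  obtain k m where km: "h = act k m" using hG unfolding deck_def by blast
  obtain F lam d where F0: "continuous_on (- range (D K)) F" "\<And>p. p \<notin> range (D K) \<Longrightarrow> F p \<noteq> 0"
    and F: "has_degree_one D nn K F"
    and lam: "continuous_on (UNIV \<times> ball 0 1) lam"
    "\<And>p \<theta>. p \<notin> range (D K) \<Longrightarrow> exp (\<i> * of_real \<theta>) = al p \<Longrightarrow> F p = exp (lam (\<theta>, be p))"
    "\<And>\<theta> z (k::int). norm z < 1 \<Longrightarrow> lam (\<theta> + 2 * pi * k, z) = lam (\<theta>, z) + 2 * pi * \<i> * (d * k)"
    using knot_log by blast
  have sub: "bx s a \<subseteq> bx s rad" using a by (intro bx_mono) simp
  have out: "Tb K p \<notin> range (D K)" if "p \<in> bx s a" "p \<in> lower \<or> p \<in> upper" for p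
    using Tb_avoid[OF subsetD[OF sub that(1)] that(2) K] not_L_K by blast
  have "d * k = 1"
  proof (rule meridian_angle_odd[OF a(1) _ _ _ _ _ _ F lam])
    show "continuous_on (bx s a \<inter> lower) (\<lambda>p. fst (\<sigma> (Tb K p)))"
      using \<sigma>(1) unfolding section_on_def
      by (intro continuous_on_fst continuous_on_compose2[OF _ continuous_on_Tb[OF K]]) auto
    show "continuous_on (bx s a \<inter> upper) (\<lambda>p. fst (\<sigma>0 (Tb K p)))"
      using \<sigma>0 unfolding section_on_def
      by (intro continuous_on_fst continuous_on_compose2[OF _ continuous_on_Tb[OF K]]) auto
    show "Tb K p \<notin> range (D K) \<and> exp (\<i> * of_real (fst (\<sigma> (Tb K p)))) = al (Tb K p)" if "p \<in> bx s a" "p \<in> lower" for p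
      using out \<sigma>(1) that unfolding section_on_def fib_def by blast
    show "Tb K p \<notin> range (D K) \<and> exp (\<i> * of_real (fst (\<sigma>0 (Tb K p)))) = al (Tb K p)" if "p \<in> bx s a" "p \<in> upper" for p
      using out \<sigma>0 that unfolding section_on_def fib_def by blast
    show "fst (\<sigma> (Tb K p)) = fst (\<sigma>0 (Tb K p))" if "p \<in> bx s a" "Im (fst p) < 0" for p using \<sigma>(2) that by simp
    show "fst (\<sigma> (Tb K p)) = fst (\<sigma>0 (Tb K p)) + 2 * pi * k" if "p \<in> bx s a" "0 < Im (fst p)" for p
      using \<sigma>(3) that by (simp add: km act_def)
  qed
  then have "odd k" by (metis dvd_mult odd_one)
  then show ?thesis using km by blast
qed

text \<open>The angle is defined on the strand itself and is continued across it without a jump, so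
  \<open>k = 0\<close>. Of the two points over a point of the strand exactly one is a zero of
  \<open>Fn\<close>; depending on the sheet, \<open>Q\<close> behaves like \<open>transv\<close> or
  like its inverse, and the logarithm gains or loses one period.\<close>

lemma mon_other:
  assumes i: "i \<in> I" "i \<noteq> K" and h: "E.mon \<sigma>0 i s h"
  shows "h = act 0 1 \<or> h = act 0 (- 1)"
proof -
  obtain a \<sigma> where a: "0 < a" "a \<le> rad" and \<sigma>0: "section_on fib (Tb i ` (bx s a \<inter> upper)) \<sigma>0"
    and \<sigma>: "section_on fib (Tb i ` (bx s a \<inter> lower)) \<sigma>"
    "\<forall>p\<in>bx s a. Im (fst p) < 0 \<longrightarrow> \<sigma> (Tb i p) = \<sigma>0 (Tb i p)"
    "\<forall>p\<in>bx s a. 0 < Im (fst p) \<longrightarrow> \<sigma> (Tb i p) = h (\<sigma>0 (Tb i p))" and hG: "h \<in> deck"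
    using h unfolding E.mon_def by blast
  obtain k m where km: "h = act k m" using hG unfolding deck_def by blast
  have sub: "bx s a \<subseteq> bx s rad" using a by (intro bx_mono) simp
  have cT: "continuous_on S (Tb i)" for S by (rule continuous_on_Tb[OF i(1)])
  have out: "Tb i p \<notin> range (D K)" if "p \<in> bx s a" for p
  proof
    assume "Tb i p \<in> range (D K)"
    then obtain t where "D K t = Tb i p" by (metis imageE)
    then show False using L_in_Tb(1)[OF i(1) K subsetD[OF sub that]] i(2) by blast
  qed
  have c\<sigma>: "continuous_on (bx s a \<inter> lower) (\<lambda>p. \<sigma> (Tb i p))" "continuous_on (bx s a \<inter> upper) (\<lambda>p. \<sigma>0 (Tb i p))"
    using \<sigma>(1) \<sigma>0 unfolding section_on_def by (auto intro: continuous_on_compose2[OF _ cT])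
  have e\<sigma>: "exp (\<i> * of_real (fst (\<sigma> (Tb i p)))) = al (Tb i p)" "exp (2 * pi * \<i> * snd (\<sigma> (Tb i p))) = Q (fst (\<sigma> (Tb i p))) (be (Tb i p))"
    if "p \<in> bx s a" "p \<in> lower" for p
    using \<sigma>(1) that unfolding section_on_def fib_def by blast+
  have e\<sigma>0: "exp (\<i> * of_real (fst (\<sigma>0 (Tb i p)))) = al (Tb i p)" "exp (2 * pi * \<i> * snd (\<sigma>0 (Tb i p))) = Q (fst (\<sigma>0 (Tb i p))) (be (Tb i p))"
    if "p \<in> bx s a" "p \<in> upper" for p
    using \<sigma>0 that unfolding section_on_def fib_def by blast+
  have "continuous_on (bx s a) (\<lambda>p. al (Tb i p))"
    by (rule continuous_on_compose2[OF continuous_on_al_be(1) cT order_refl]) (use out in blast)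
  then obtain \<theta>N :: "complex \<times> real \<Rightarrow> real" where \<theta>N: "continuous_on (bx s a) \<theta>N" "\<And>p. p \<in> bx s a \<Longrightarrow> exp (\<i> * of_real (\<theta>N p)) = al (Tb i p)"
    using unit_angle_ex[OF convex_imp_contractible[OF convex_bx]] norm_al out by blast
  have "\<exists>k::int. \<forall>p\<in>bx s a \<inter> lower. fst (\<sigma> (Tb i p)) = \<theta>N p + 2 * pi * k"
  proof (rule angles_differ)
    show "connected (bx s a \<inter> lower)" by (intro contractible_imp_connected contractible_bx_lower a)
    show "continuous_on (bx s a \<inter> lower) (\<lambda>p. fst (\<sigma> (Tb i p)))" by (intro continuous_on_fst c\<sigma>)
    show "continuous_on (bx s a \<inter> lower) \<theta>N" by (rule continuous_on_subset[OF \<theta>N(1)]) blast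
  qed (use e\<sigma> \<theta>N(2) in auto)
  then obtain k1 :: int where k1: "\<And>p. p \<in> bx s a \<Longrightarrow> p \<in> lower \<Longrightarrow> fst (\<sigma> (Tb i p)) = \<theta>N p + 2 * pi * k1" by blast
  have "\<exists>k::int. \<forall>p\<in>bx s a \<inter> upper. fst (\<sigma>0 (Tb i p)) = \<theta>N p + 2 * pi * k"
  proof (rule angles_differ)
    show "connected (bx s a \<inter> upper)" by (intro contractible_imp_connected contractible_bx_upper a)
    show "continuous_on (bx s a \<inter> upper) (\<lambda>p. fst (\<sigma>0 (Tb i p)))" by (intro continuous_on_fst c\<sigma>)
    show "continuous_on (bx s a \<inter> upper) \<theta>N" by (rule continuous_on_subset[OF \<theta>N(1)]) blast
  qed (use e\<sigma>0 \<theta>N(2) in auto)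
  then obtain k2 :: int where k2: "\<And>p. p \<in> bx s a \<Longrightarrow> p \<in> upper \<Longrightarrow> fst (\<sigma>0 (Tb i p)) = \<theta>N p + 2 * pi * k2" by blast
  let ?r = "(Complex s (- a / 2), 0)" and ?l = "(Complex s (a / 2), 0)"
  have r: "?r \<in> bx s a" "?r \<in> lower" "?r \<in> upper" "Im (fst ?r) < 0" and l: "?l \<in> bx s a" "?l \<in> lower" "?l \<in> upper" "0 < Im (fst ?l)"
    using a by (auto simp: bx_def lower_def upper_def)
  \<comment> \<open>Agreement on the right identifies the two angle constants; on the left this
    excludes a change of the angle.\<close>
  have "\<theta>N ?r + 2 * pi * k1 = \<theta>N ?r + 2 * pi * k2" using k1[OF r(1,2)] k2[OF r(1,3)] bspec[OF \<sigma>(2) r(1)] r(4) by simp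
  then have k12: "k1 = k2" by simp
  have "\<sigma> (Tb i ?l) = h (\<sigma>0 (Tb i ?l))" using \<sigma>(3) l by blast
  then have "fst (\<sigma> (Tb i ?l)) = fst (\<sigma>0 (Tb i ?l)) + 2 * pi * k" unfolding km act_def by simp
  then have k0: "k = 0" using k1[OF l(1,2)] k2[OF l(1,3)] k12 by simp
  define \<theta> where "\<theta> p = \<theta>N p + 2 * pi * k1" for p
  have \<theta>: "continuous_on (bx s a) \<theta>" unfolding \<theta>_def by (intro continuous_intros \<theta>N)
  have e\<theta>: "exp (\<i> * of_real (\<theta> p)) = al (Tb i p)" if "p \<in> bx s a" for p
    unfolding \<theta>_def exp_angle_shift using \<theta>N(2)[OF that] .
  let ?c = "(Complex s 0, 0)"
  have c: "?c \<in> bx s a" using a by (simp add: bx_def)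
  have cD: "Tb i ?c = D i s" by (rule Tb_center)
  have e\<theta>c: "exp (\<i> * of_real (\<theta> ?c)) = al (D i s)" using e\<theta>[OF c] unfolding cD .
  obtain \<theta>1 U H where \<theta>1: "\<theta>1 \<in> {\<theta> ?c, \<theta> ?c + 2 * pi}" "Fn (\<theta>1 + 2 * pi, be (D i s)) \<noteq> 0"
    and U: "open U" "(\<theta>1, be (D i s)) \<in> U" "continuous_on U H" "\<forall>x\<in>U. H x \<noteq> 0"
    and FH: "\<forall>\<theta> q. \<bar>Im (fst q)\<bar> < rad \<longrightarrow> \<bar>snd q\<bar> < rad \<longrightarrow> (\<theta>, be (Tb i q)) \<in> U \<longrightarrow>
             exp (\<i> * of_real \<theta>) = al (Tb i q) \<longrightarrow> Tb i q \<notin> range (D K) \<longrightarrow>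
             Fn (\<theta>, be (Tb i q)) = transv q * H (\<theta>, be (Tb i q))"
    using Fn_local[OF i e\<theta>c] by (elim bexE conjE exE) (rule that)
  \<comment> \<open>\<open>j = 0\<close> if the zero lies in the sheet of the sections,
    \<open>j = 1\<close> if it lies in the opposite one. In the second case
    \<open>\<epsilon>\<close> negates the logarithm, so that \<open>local_degree\<close> serves
    both.\<close>
  define j where "j = (if \<theta>1 = \<theta> ?c then 0 else 1 :: int)"
  have \<theta>1j: "\<theta>1 = \<theta> ?c + 2 * pi * j" using \<theta>1(1) by (auto simp: j_def)
  have j01: "j = 0 \<or> j = 1" by (simp add: j_def)
  define \<psi> where "\<psi> p = \<theta> p + 2 * pi * j" for p
  have \<psi>: "continuous_on (bx s a) \<psi>" unfolding \<psi>_def by (intro continuous_intros \<theta>)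
  have e\<psi>: "exp (\<i> * of_real (\<psi> p)) = al (Tb i p)" if "p \<in> bx s a" for p
    unfolding \<psi>_def exp_angle_shift using e\<theta>[OF that] .
  have \<psi>c: "\<psi> ?c = \<theta>1" by (simp add: \<psi>_def \<theta>1j)
  have cbe: "continuous_on (bx s a) (\<lambda>p. be (Tb i p))"
    by (rule continuous_on_compose2[OF continuous_on_al_be(2) cT order_refl])
  have nbe: "norm (be (Tb i p)) < 1" if "p \<in> bx s a" for p using norm_be[OF out[OF that]] .
  have cF: "continuous_on (bx s a) (\<lambda>p. Fn (\<psi> p + 2 * pi, be (Tb i p)))"
    by (rule continuous_on_Fn) (use \<psi> cbe nbe in \<open>auto intro!: continuous_intros\<close>)
  have o1: "open (bx s a \<inter> (\<lambda>p. (\<psi> p, be (Tb i p))) -` U)"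
    by (intro continuous_open_preimage continuous_on_Pair \<psi> cbe open_bx U)
  have o2: "open (bx s a \<inter> (\<lambda>p. Fn (\<psi> p + 2 * pi, be (Tb i p))) -` (- {0}))"
    by (intro continuous_open_preimage cF open_bx) auto
  let ?W = "(bx s a \<inter> (\<lambda>p. (\<psi> p, be (Tb i p))) -` U) \<inter> (bx s a \<inter> (\<lambda>p. Fn (\<psi> p + 2 * pi, be (Tb i p))) -` (- {0}))"
  have "?c \<in> ?W" using c U(2) \<theta>1(2) cD \<psi>c by simp
  then obtain e where e: "e > 0" "ball ?c e \<subseteq> ?W" using open_Int[OF o1 o2] open_contains_ball by blast
  define a' where "a' = e / 3"
  have a': "a' > 0" using e by (simp add: a'_def)
  have bW: "bx s a' \<subseteq> ?W"
  proof
    fix p assume p: "p \<in> bx s a'"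
    have "norm (p - ?c) \<le> norm (fst p - Complex s 0) + norm (snd p)"
      using norm_Pair_le[of "fst p - Complex s 0" "snd p"] by (cases p) simp
    also have "norm (fst p - Complex s 0) \<le> \<bar>Re (fst p) - s\<bar> + \<bar>Im (fst p)\<bar>"
      using cmod_le[of "fst p - Complex s 0"] by simp
    finally have "norm (p - ?c) < e" using p by (simp add: bx_def a'_def)
    then have "p \<in> ball ?c e" by (simp add: dist_norm norm_minus_commute)
    then show "p \<in> ?W" using e(2) by blast
  qed
  then have ba: "bx s a' \<subseteq> bx s a" by blast
  define G where "G p = H (\<psi> p, be (Tb i p)) / Fn (\<psi> p + 2 * pi, be (Tb i p))" for p
  have cG: "continuous_on (bx s a') G" unfolding G_def
  proof (rule continuous_on_divide)
    show "continuous_on (bx s a') (\<lambda>p. H (\<psi> p, be (Tb i p)))"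
      by (rule continuous_on_compose2[OF U(3) continuous_on_Pair[OF continuous_on_subset[OF \<psi> ba] continuous_on_subset[OF cbe ba]]])
        (use bW in blast)
    show "continuous_on (bx s a') (\<lambda>p. Fn (\<psi> p + 2 * pi, be (Tb i p)))" by (rule continuous_on_subset[OF cF ba])
    show "\<forall>p\<in>bx s a'. Fn (\<psi> p + 2 * pi, be (Tb i p)) \<noteq> 0" using bW by blast
  qed
  have nG: "G p \<noteq> 0" if "p \<in> bx s a'" for p
  proof -
    have "(\<psi> p, be (Tb i p)) \<in> U" "Fn (\<psi> p + 2 * pi, be (Tb i p)) \<noteq> 0" using bW that by blast+
    then show ?thesis using bspec[OF U(4)] by (simp add: G_def)
  qed
  have QG: "Q (\<psi> p) (be (Tb i p)) = transv p * G p" if p: "p \<in> bx s a'" for p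
  proof -
    have "(\<psi> p, be (Tb i p)) \<in> U" "p \<in> bx s a" "p \<in> bx s rad" using bW sub p by blast+
    moreover have "\<bar>Im (fst p)\<bar> < rad" "\<bar>snd p\<bar> < rad" using \<open>p \<in> bx s rad\<close> by (auto simp: bx_def)
    ultimately have "Fn (\<psi> p, be (Tb i p)) = transv p * H (\<psi> p, be (Tb i p))" using FH e\<psi> out by blast
    then show ?thesis unfolding Q_def G_def by simp
  qed
  define \<epsilon> :: complex where "\<epsilon> = (if j = 0 then 1 else - 1)"
  have flip: "exp (2 * pi * \<i> * (\<epsilon> * r)) = transv p * G p" if "exp (2 * pi * \<i> * r) = Q (\<theta> p) (be (Tb i p))" "p \<in> bx s a'" for r p
    using that(1) Q_shift[of "\<theta> p" j "be (Tb i p)"] j01 unfolding QG[OF that(2), symmetric] \<psi>_def \<epsilon>_def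
    by (auto simp: exp_minus)
  have "2 * pi * \<i> * (\<epsilon> * snd (\<sigma> (Tb i p))) = 2 * pi * \<i> * (\<epsilon> * snd (\<sigma>0 (Tb i p))) + 2 * pi * \<i>"
    if p: "p \<in> bx s a'" "0 < Im (fst p)" for p
  proof (rule local_degree[OF a' _ _ cG nG _ _ _ p])
    show "continuous_on (bx s a' \<inter> lower) (\<lambda>p. 2 * pi * \<i> * (\<epsilon> * snd (\<sigma> (Tb i p))))"
      by (intro continuous_intros continuous_on_subset[OF c\<sigma>(1)]) (use ba in blast)
    show "continuous_on (bx s a' \<inter> upper) (\<lambda>p. 2 * pi * \<i> * (\<epsilon> * snd (\<sigma>0 (Tb i p))))"
      by (intro continuous_intros continuous_on_subset[OF c\<sigma>(2)]) (use ba in blast)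
    show "exp (2 * pi * \<i> * (\<epsilon> * snd (\<sigma> (Tb i p)))) = transv p * G p" if "p \<in> bx s a'" "p \<in> lower" for p
    proof -
      have pa: "p \<in> bx s a" using that(1) ba by blast
      have "fst (\<sigma> (Tb i p)) = \<theta> p" using k1[OF pa that(2)] by (simp add: \<theta>_def)
      then have "exp (2 * pi * \<i> * snd (\<sigma> (Tb i p))) = Q (\<theta> p) (be (Tb i p))" using e\<sigma>(2)[OF pa that(2)] by simp
      then show ?thesis by (rule flip[OF _ that(1)])
    qed
    show "exp (2 * pi * \<i> * (\<epsilon> * snd (\<sigma>0 (Tb i p)))) = transv p * G p" if "p \<in> bx s a'" "p \<in> upper" for p
    proof -
      have pa: "p \<in> bx s a" using that(1) ba by blast
      have "fst (\<sigma>0 (Tb i p)) = \<theta> p" using k2[OF pa that(2)] by (simp add: \<theta>_def k12)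
      then have "exp (2 * pi * \<i> * snd (\<sigma>0 (Tb i p))) = Q (\<theta> p) (be (Tb i p))" using e\<sigma>0(2)[OF pa that(2)] by simp
      then show ?thesis by (rule flip[OF _ that(1)])
    qed
    show "2 * pi * \<i> * (\<epsilon> * snd (\<sigma> (Tb i p))) = 2 * pi * \<i> * (\<epsilon> * snd (\<sigma>0 (Tb i p)))" if "p \<in> bx s a'" "Im (fst p) < 0" for p
    proof -
      have "p \<in> bx s a" using that(1) ba by blast
      then show ?thesis using \<sigma>(2) that(2) by simp
    qed
  qed
  moreover have la: "(Complex s (a' / 2), 0) \<in> bx s a'" "0 < Im (fst (Complex s (a' / 2), 0 :: real))"
    using a' by (auto simp: bx_def)
  ultimately have "2 * pi * \<i> * (\<epsilon> * snd (\<sigma> (Tb i (Complex s (a' / 2), 0)))) =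
      2 * pi * \<i> * (\<epsilon> * snd (\<sigma>0 (Tb i (Complex s (a' / 2), 0))) + 1)" by (simp add: distrib_left)
  then have "\<epsilon> * snd (\<sigma> (Tb i (Complex s (a' / 2), 0))) = \<epsilon> * snd (\<sigma>0 (Tb i (Complex s (a' / 2), 0))) + 1" by simp
  moreover have "\<sigma> (Tb i (Complex s (a' / 2), 0)) = h (\<sigma>0 (Tb i (Complex s (a' / 2), 0)))" using \<sigma>(3) la ba by blast
  then have "snd (\<sigma> (Tb i (Complex s (a' / 2), 0))) = snd (\<sigma>0 (Tb i (Complex s (a' / 2), 0))) + of_int m"
    unfolding km k0 act_def by simp
  ultimately have "\<epsilon> * of_int m = 1" by (simp add: distrib_left)
  then have "(of_int m :: complex) = of_int 1 \<or> (of_int m :: complex) = of_int (- 1)"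
    by (auto simp: \<epsilon>_def minus_equation_iff split: if_splits)
  then have "m = 1 \<or> m = - 1" by (metis of_int_eq_iff)
  then show ?thesis using km k0 by blast
qed

end

section \<open>The coloring\<close>

definition deck_code :: "(real \<times> complex \<Rightarrow> real \<times> complex) \<Rightarrow> int \<times> int"
  where "deck_code h = (THE km. h = act (fst km) (snd km))"

lemma deck_code_act: "deck_code (act k m) = (k, m)"
  unfolding deck_code_def
proof (rule the_equality)
  fix km assume "act k m = act (fst km) (snd km)"
  then have "act k m x = act (fst km) (snd km) x" for x by simp
  then show "km = (k, m)" using act_free[of k m undefined "fst km" "snd km"] by (simp add: prod_eq_iff)
qed simp

text \<open>The translations of the second coordinate become rotations, the maps that reverse it reflections.
  The sign accounts for the convention \<open>a\<^sup>r b\<^sup>i\<close> for the elements of the dihedral group.\<close>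

definition to_dihedral :: "nat \<Rightarrow> (real \<times> complex \<Rightarrow> real \<times> complex) \<Rightarrow> bool \<times> int"
  where "to_dihedral n h = (case deck_code h of (k, m) \<Rightarrow> (odd k, (if even k then m else - m) mod int n))"

lemma to_dihedral_act: "to_dihedral n (act k m) = (odd k, (if even k then m else - m) mod int n)"
  by (simp add: to_dihedral_def deck_code_act)

text \<open>The coloring conditions are equations between products, so a homomorphism carries the
  relations between deck transformations over to the colors.\<close>

lemma to_dihedral_comp:
  assumes "h \<in> deck" "h' \<in> deck"
  shows "to_dihedral n (h \<circ> h') = to_dihedral n h \<otimes>\<^bsub>dihedral n\<^esub> to_dihedral n h'"
proof -
  obtain k m k' m' where "h = act k m" "h' = act k' m'" using assms unfolding deck_def by blast
  then show ?thesis
    by (cases "even k"; cases "even k'")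
      (simp_all add: act_comp to_dihedral_act dihedral_def mod_simps add.commute)
qed

context lifted_diag
begin

text \<open>If the point at parameter \<open>0\<close> is hidden, it is an under point, and by
  \<open>wirtinger\<close> the strand is visible next to it. Thus every component has an arc and
  both tones really occur.\<close>

lemma top_point_ex:
  assumes i: "i \<in> I"
  shows "\<exists>s. top_at i s"
proof (cases "top_at i 0")
  case False
  then have "D i 0 \<in> under_points I D" using top_at_iff[OF i] by blast
  then obtain j s k t where D: "D i 0 = D k t" and c: "crossing I D j s k t" unfolding under_points_def by blast
  have k: "k \<in> I" "j \<in> I" using c by (auto simp: crossing_def)
  have ik: "i = k" using LD(8)[OF i k(1) D] .
  obtain h where "E.mon E.\<sigma>T j s h" using E.mon_top_ex[OF k(2) crossing_top[OF c]] by blast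
  from E.wirtinger[OF c this] obtain m m' where
    "\<forall>\<^sub>F t' in at t. top_at k t' \<and>
       (plane_det (plane_velocity D j s) (plane_velocity D k t) * (t' - t) < 0 \<longrightarrow> E.mon E.\<sigma>T k t' m) \<and>
       (plane_det (plane_velocity D j s) (plane_velocity D k t) * (t' - t) > 0 \<longrightarrow> E.mon E.\<sigma>T k t' m')" by blast
  then have "\<forall>\<^sub>F t' in at t. top_at k t'" by eventually_elim blast
  then have "\<exists>t'. top_at k t'" by (rule eventually_happens'[rotated]) simp
  then show ?thesis using ik by simp
qed blast

lemma arc_ex:
  assumes i: "i \<in> I"
  shows "\<exists>x\<in>arcs I D. \<exists>s. D i s \<in> x"
proof -
  obtain s where "top_at i s" using top_point_ex[OF i] by blast
  then have "D i s \<in> (\<Union>i\<in>I. range (D i)) - under_points I D" using top_at_iff[OF i] i by blast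
  then have "D i s \<in> \<Union> (arcs I D)" unfolding arcs_def by (simp only: Union_components)
  then show ?thesis by blast
qed

lemma arc_point:
  assumes "x \<in> arcs I D"
  obtains i s where "i \<in> I" "D i s \<in> x"
proof -
  have "x \<noteq> {}" "x \<subseteq> (\<Union>i\<in>I. range (D i))"
    using assms in_components_nonempty in_components_subset unfolding arcs_def by blast+
  then show thesis using that by blast
qed

text \<open>The color of an arc is the image of its monodromy. The tone is decided by
  \<open>mon_knot\<close> and \<open>mon_other\<close>, and the crossing conditions are the images
  of the equation in \<open>wirtinger\<close>.\<close>

lemma two_tone_coloring:
  assumes n: "n \<ge> 2" and J: "I - {K} \<noteq> {}"
  shows "\<exists>\<Gamma>. dihedral_coloring n I D \<Gamma> \<and> two_tone n I D \<Gamma> \<and>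
    (\<forall>x\<in>arcs I D. x \<subseteq> range (D K) \<longrightarrow> \<Gamma> x \<in> reflections n) \<and>
    (\<forall>i\<in>I - {K}. \<forall>x\<in>arcs I D. x \<subseteq> range (D i) \<longrightarrow> \<Gamma> x \<in> nontrivial_rotations n)"
proof -
  have "\<forall>x\<in>arcs I D. \<exists>h\<in>deck. \<forall>i\<in>I. \<forall>s. D i s \<in> x \<longrightarrow> E.mon E.\<sigma>T i s h" using E.arc_color by blast
  then obtain col where col: "\<And>x. x \<in> arcs I D \<Longrightarrow> col x \<in> deck"
    "\<And>x i s. x \<in> arcs I D \<Longrightarrow> i \<in> I \<Longrightarrow> D i s \<in> x \<Longrightarrow> E.mon E.\<sigma>T i s (col x)" by metis
  define \<Gamma> where "\<Gamma> x = to_dihedral n (col x)" for x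
  have knot: "\<Gamma> x \<in> reflections n" if x: "x \<in> arcs I D" "D K s \<in> x" for x s
  proof -
    obtain k m where km: "col x = act k m" "odd k" using mon_knot[OF col(2)[OF x(1) K x(2)]] by blast
    have "int (nat (- m mod int n)) mod int n = - m mod int n" using n by simp
    then have "\<Gamma> x = dih_reflection n (nat (- m mod int n))"
      using n km by (simp only: \<Gamma>_def to_dihedral_act dih_reflection_eq) simp
    moreover have "nat (- m mod int n) \<in> {0..<n}" using n by (simp add: nat_less_iff)
    ultimately show ?thesis unfolding reflections_def by blast
  qed
  have other: "\<Gamma> x \<in> nontrivial_rotations n" if x: "x \<in> arcs I D" "D i s \<in> x" and i: "i \<in> I - {K}" for x i s
  proof -
    have ik: "i \<in> I" "i \<noteq> K" using i by auto
    obtain m where m: "col x = act 0 m" "m = 1 \<or> m = - 1"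
      using mon_other[OF ik col(2)[OF x(1) ik(1) x(2)]] by blast
    have "m mod int n \<noteq> 0" using m(2) n by (auto simp: zmod_minus1)
    moreover have "0 \<le> m mod int n" "m mod int n < int n" using n by simp_all
    ultimately have "nat (m mod int n) \<in> {1..<n}" "int (nat (m mod int n)) mod int n = m mod int n"
      by (auto simp: nat_less_iff)
    moreover have "\<Gamma> x = (False, m mod int n)" using m(1) by (simp add: \<Gamma>_def to_dihedral_act)
    moreover have "dih_rotation n j = (False, int j mod int n)" for j
      using n by (simp add: dih_rotation_def dih_b_pow)
    ultimately have "\<Gamma> x = dih_rotation n (nat (m mod int n))" "nat (m mod int n) \<in> {1..<n}"
      by presburger+
    then show ?thesis unfolding nontrivial_rotations_def by blast
  qed
  have not_one: "\<Gamma> x \<noteq> \<one>\<^bsub>dihedral n\<^esub>" if x: "x \<in> arcs I D" for x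
  proof -
    obtain i s where D: "i \<in> I" "D i s \<in> x" using arc_point[OF x] by blast
    have "\<one>\<^bsub>dihedral n\<^esub> \<notin> reflections n" "\<one>\<^bsub>dihedral n\<^esub> \<notin> nontrivial_rotations n"
      using n by (auto simp: reflections_def nontrivial_rotations_def dih_reflection_eq dih_rotation_def dih_b_pow)
        (auto simp: dihedral_def)
    then show ?thesis using knot[OF x, of s] other[OF x, of i s] D by (cases "i = K") auto
  qed
  have "dihedral_coloring n I D \<Gamma>" unfolding dihedral_coloring_def
  proof (intro conjI ballI allI impI)
    fix x assume "x \<in> arcs I D"
    then obtain k m where "col x = act k m" using col(1) unfolding deck_def by blast
    then show "\<Gamma> x \<in> carrier (dihedral n)" using n by (simp add: \<Gamma>_def to_dihedral_act dihedral_def)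
  next
    fix i s j t x y z
    assume x: "x \<in> arcs I D" and y: "y \<in> arcs I D" and z: "z \<in> arcs I D"
      and asm: "crossing I D i s j t \<and> D i s \<in> x \<and> (\<forall>\<^sub>F r in at_left t. D j r \<in> y) \<and> (\<forall>\<^sub>F r in at_right t. D j r \<in> z)"
    then have c: "crossing I D i s j t" and Dx: "D i s \<in> x" and Dy: "\<forall>\<^sub>F r in at_left t. D j r \<in> y"
      and Dz: "\<forall>\<^sub>F r in at_right t. D j r \<in> z" by blast+
    have i: "i \<in> I" and j: "j \<in> I" using c by (auto simp: crossing_def)
    let ?d = "plane_det (plane_velocity D i s) (plane_velocity D j t)"
    obtain m m' where m: "m \<in> deck" "m' \<in> deck" "m \<circ> col x = col x \<circ> m'"
      and ev: "\<forall>\<^sub>F r in at t. top_at j r \<and> (?d * (r - t) < 0 \<longrightarrow> E.mon E.\<sigma>T j r m) \<and> (?d * (r - t) > 0 \<longrightarrow> E.mon E.\<sigma>T j r m')"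
      using E.wirtinger[OF c col(2)[OF x i Dx]] by blast
    have evl: "\<forall>\<^sub>F r in at_left t. top_at j r \<and> (?d * (r - t) < 0 \<longrightarrow> E.mon E.\<sigma>T j r m) \<and> (?d * (r - t) > 0 \<longrightarrow> E.mon E.\<sigma>T j r m')"
      and evr: "\<forall>\<^sub>F r in at_right t. top_at j r \<and> (?d * (r - t) < 0 \<longrightarrow> E.mon E.\<sigma>T j r m) \<and> (?d * (r - t) > 0 \<longrightarrow> E.mon E.\<sigma>T j r m')"
      using ev unfolding eventually_at_split by blast+
    have l: "\<forall>\<^sub>F r in at_left t. r < t" and r: "\<forall>\<^sub>F r in at_right t. t < r"
      by (auto simp: eventually_at_filter)
    have "\<forall>\<^sub>F r in at_left t. col y = (if ?d > 0 then m else m')"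
      using evl Dy l
    proof eventually_elim
      case (elim r)
      have "?d > 0 \<or> ?d < 0" using crossing_det[OF c] by linarith
      then have "E.mon E.\<sigma>T j r (if ?d > 0 then m else m')"
        using elim by (auto simp: mult_less_0_iff zero_less_mult_iff)
      then show ?case using E.mon_unique[OF j col(2)[OF y j elim(2)]] by blast
    qed
    \<comment> \<open>At a positive crossing the under strand comes from the right of the over
      strand, at a negative one from the left. This decides which of \<open>m\<close> and
      \<open>m'\<close> belongs to the arc before the crossing.\<close>
    then have cy: "col y = (if ?d > 0 then m else m')" by simp
    have "\<forall>\<^sub>F r in at_right t. col z = (if ?d > 0 then m' else m)"
      using evr Dz r
    proof eventually_elim
      case (elim r)
      have "?d > 0 \<or> ?d < 0" using crossing_det[OF c] by linarith
      then have "E.mon E.\<sigma>T j r (if ?d > 0 then m' else m)"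
        using elim by (auto simp: mult_less_0_iff zero_less_mult_iff)
      then show ?case using E.mon_unique[OF j col(2)[OF z j elim(2)]] by blast
    qed
    then have cz: "col z = (if ?d > 0 then m' else m)" by simp
    have pr: "\<Gamma> v \<otimes>\<^bsub>dihedral n\<^esub> \<Gamma> w = to_dihedral n (col v \<circ> col w)" if "v \<in> arcs I D" "w \<in> arcs I D" for v w
      unfolding \<Gamma>_def using to_dihedral_comp[OF col(1)[OF that(1)] col(1)[OF that(2)]] by simp
    show "if crossing_positive D i s j t
        then \<Gamma> x \<otimes>\<^bsub>dihedral n\<^esub> \<Gamma> z = \<Gamma> y \<otimes>\<^bsub>dihedral n\<^esub> \<Gamma> x
        else \<Gamma> z \<otimes>\<^bsub>dihedral n\<^esub> \<Gamma> x = \<Gamma> x \<otimes>\<^bsub>dihedral n\<^esub> \<Gamma> y"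
      unfolding pr[OF x z] pr[OF y x] pr[OF z x] pr[OF x y] cy cz crossing_positive_def using m(3) by auto
  qed
  moreover have "two_tone n I D \<Gamma>" unfolding two_tone_def
  proof (intro conjI)
    show "\<one>\<^bsub>dihedral n\<^esub> \<notin> \<Gamma> ` arcs I D" using not_one by (metis imageE)
    obtain x s where "x \<in> arcs I D" "D K s \<in> x" using arc_ex[OF K] by blast
    then show "\<Gamma> ` arcs I D \<inter> reflections n \<noteq> {}" using knot by blast
    obtain i where i: "i \<in> I - {K}" using J by blast
    then obtain x' s' where "x' \<in> arcs I D" "D i s' \<in> x'" using arc_ex[of i] by blast
    then show "\<Gamma> ` arcs I D \<inter> nontrivial_rotations n \<noteq> {}" using other i by blast
  qed
  moreover have "\<forall>x\<in>arcs I D. x \<subseteq> range (D K) \<longrightarrow> \<Gamma> x \<in> reflections n"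
  proof (intro ballI impI)
    fix x assume x: "x \<in> arcs I D" "x \<subseteq> range (D K)"
    obtain j r where "D j r \<in> x" using arc_point[OF x(1)] by blast
    then obtain s where "D K s \<in> x" using x(2) by (metis rangeE subsetD)
    then show "\<Gamma> x \<in> reflections n" by (rule knot[OF x(1)])
  qed
  moreover have "\<forall>i\<in>I - {K}. \<forall>x\<in>arcs I D. x \<subseteq> range (D i) \<longrightarrow> \<Gamma> x \<in> nontrivial_rotations n"
  proof (intro ballI impI)
    fix i x assume i: "i \<in> I - {K}" and x: "x \<in> arcs I D" "x \<subseteq> range (D i)"
    obtain j r where "D j r \<in> x" using arc_point[OF x(1)] by blast
    then obtain s where "D i s \<in> x" using x(2) by (metis rangeE subsetD)
    then show "\<Gamma> x \<in> nontrivial_rotations n" using i by (rule other[OF x(1)])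
  qed
  ultimately show ?thesis by blast
qed

end

lemma (in unknot_diag) coloring_exists:
  assumes "n \<ge> 2" and "I - {K} \<noteq> {}"
  shows "\<exists>\<Gamma>. dihedral_coloring n I D \<Gamma> \<and> two_tone n I D \<Gamma> \<and>
    (\<forall>x\<in>arcs I D. x \<subseteq> range (D K) \<longrightarrow> \<Gamma> x \<in> reflections n) \<and>
    (\<forall>i\<in>I - {K}. \<forall>x\<in>arcs I D. x \<subseteq> range (D i) \<longrightarrow> \<Gamma> x \<in> nontrivial_rotations n)"
proof (rule lift_function)
  fix Fn assume "continuous_on (UNIV \<times> ball 0 1) Fn" "\<And>\<theta> z. Fn (\<theta> + 4 * pi, z) = Fn (\<theta>, z)"
    "\<And>p \<theta>. p \<notin> L \<Longrightarrow> exp (\<i> * of_real \<theta>) = al p \<Longrightarrow> Fn (\<theta>, be p) \<noteq> 0"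
    "\<And>i s \<theta>0. i \<in> I \<Longrightarrow> i \<noteq> K \<Longrightarrow> exp (\<i> * of_real \<theta>0) = al (D i s) \<Longrightarrow>
       \<exists>\<theta>1\<in>{\<theta>0, \<theta>0 + 2 * pi}. Fn (\<theta>1 + 2 * pi, be (D i s)) \<noteq> 0 \<and>
         (\<exists>U H. open U \<and> (\<theta>1, be (D i s)) \<in> U \<and> continuous_on U H \<and> (\<forall>x\<in>U. H x \<noteq> 0) \<and>
           (\<forall>\<theta> q. \<bar>Im (fst q)\<bar> < rad \<longrightarrow> \<bar>snd q\<bar> < rad \<longrightarrow> (\<theta>, be (Tb i q)) \<in> U \<longrightarrow>
             exp (\<i> * of_real \<theta>) = al (Tb i q) \<longrightarrow> Tb i q \<notin> range (D K) \<longrightarrow>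
             Fn (\<theta>, be (Tb i q)) = transv q * H (\<theta>, be (Tb i q))))"
  then have "lifted_diag I D nn b \<delta> K f g Fn"
    by (intro lifted_diag.intro unknot_diag_axioms lifted_diag_axioms.intro)
  then interpret lifted_diag I D nn b \<delta> K f g Fn .
  show ?thesis by (rule two_tone_coloring[OF assms])
qed

theorem proposition1p5:
  fixes L l0 :: "(complex \<times> complex) set"
    and D :: "(complex \<times> complex) set \<Rightarrow> real \<Rightarrow> complex \<times> real"
    and n :: nat
  assumes "is_link L"
    and "card (components L) \<ge> 2"
    and "l0 \<in> components L"
    and "unknot l0"
    and "diagram_of_link D L"
    and "\<And>l. l \<in> components L \<Longrightarrow> l \<noteq> l0 \<Longrightarrow> even (linking_number (components L) D l0 l)"
    and "odd n"
    and "n \<ge> 3"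
  shows "\<exists>\<Gamma>. dihedral_coloring n (components L) D \<Gamma> \<and> two_tone n (components L) D \<Gamma> \<and>
    (\<forall>x\<in>arcs (components L) D. x \<subseteq> range (D l0) \<longrightarrow> \<Gamma> x \<in> reflections n) \<and>
    (\<forall>l\<in>components L - {l0}. \<forall>x\<in>arcs (components L) D.
       x \<subseteq> range (D l) \<longrightarrow> \<Gamma> x \<in> nontrivial_rotations n)"
proof -
  have link: "link_diagram (components L) D"
    and "\<exists>H. ambient_isotopy H \<and> (\<forall>l\<in>components L. H 1 ` l = inv_stereo ` range (D l))"
    by (rule conjunct1[OF assms(5)[unfolded diagram_of_link_def]],
        rule conjunct2[OF assms(5)[unfolded diagram_of_link_def]])
  from this(2) obtain H where "ambient_isotopy H \<and> (\<forall>l\<in>components L. H 1 ` l = inv_stereo ` range (D l))" ..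
  then have H: "ambient_isotopy H" "H 1 ` l0 = inv_stereo ` range (D l0)"
    by (rule conjunct1, rule bspec[OF conjunct2 assms(3)])
  obtain nn b \<delta> where dg: "diag (components L) D nn b \<delta>" using diag_exists[OF link] by blast
  
  obtain H' where H': "ambient_isotopy H'" "H' 1 ` l0 = great_circle" using assms(4) unfolding unknot_def by blast
  have hom: "\<exists>g. homeomorphism S3 S3 (A 1) g" if "ambient_isotopy A" for A
    using that by (simp add: ambient_isotopy_def)
  obtain G where G: "homeomorphism S3 S3 (H 1) G" using hom[OF H(1)] by blast
  obtain G' where G': "homeomorphism S3 S3 (H' 1) G'" using hom[OF H'(1)] by blast
  \<comment> \<open>From the diagram back to the link by the inverse of \<open>H 1\<close>, then on
    to the great circle by the isotopy that unknots \<open>l0\<close>.\<close>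
  have "homeomorphism S3 S3 (H' 1 \<circ> G) (H 1 \<circ> G')"
    by (rule homeomorphism_compose[OF homeomorphism_symD[OF G] G'])
  moreover have "(H' 1 \<circ> G) ` (inv_stereo ` range (D l0)) = great_circle"
  proof -
    have "l0 \<subseteq> S3" using assms(1,3) in_components_subset unfolding is_link_def by blast
    then have "G (H 1 x) = x" if "x \<in> l0" for x
      using homeomorphism_apply1[OF G] that by blast
    then have "G ` (H 1 ` l0) = l0" by (simp add: image_image cong: image_cong_simp)
    then show ?thesis unfolding image_comp[symmetric] H(2)[symmetric] H'(2)[symmetric] by (rule arg_cong)
  qed
  ultimately have "unknot_diag (components L) D nn b \<delta> l0 (H' 1 \<circ> G) (H 1 \<circ> G')"
    using assms(3,6) dg by (intro unknot_diag.intro unknot_diag_axioms.intro)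
  moreover have "components L - {l0} \<noteq> {}"
  proof
    assume "components L - {l0} = {}"
    then have "components L \<subseteq> {l0}" by blast
    then have "card (components L) \<le> card {l0}" by (rule card_mono[rotated]) simp
    then show False using assms(2) by simp
  qed
  moreover have "n \<ge> 2" using assms(8) by simp
  ultimately show ?thesis by (intro unknot_diag.coloring_exists)
qed

end
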